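(* Let $(X_0,X_1)$ be a compatible couple of operator spaces and $0<\theta<1$. Let $\mathcal{PO}$ be the pushout of the inclusion $\ker(\delta_\theta)\hookrightarrow\mathcal F$ and the map $\delta'_\theta:\ker(\delta_\theta)\to X_\theta$, and let $$0\to X_\theta\xrightarrow{\,i\,}\mathcal{PO}\xrightarrow{\,q\,}X_\theta\to0$$ be the induced extension sequence, $i(x)=(0,x)+\Delta$, $q((f,x)+\Delta)=f(\theta)$. Let $$dX_\theta=\mathcal F/(\ker(\delta_\theta)\cap\ker(\delta'_\theta))=\{(f(\theta),f'(\theta)):f\in\mathcal F\}$$ with the quotient norm (and quotient operator space structure), $j:X_\theta\to dX_\theta$, $j(y)=(0,y)$, and $p:dX_\theta\to X_\theta$, $p(x,y)=x$. Then $$0\to X_\theta\xrightarrow{\,j\,}dX_\theta\xrightarrow{\,p\,}X_\theta\to0$$ is an extension sequence, and it is completely equivalent to the pushout sequence: there is a complete isomorphism $T:\mathcal{PO}\to dX_\theta$ with $T\circ i=j$ and $p\circ T=q$.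
   Context: Operator spaces $X$ carry matrix norms on $M_n(X)$ (Ruan's axioms); quotients have $M_n(X/Y)=M_n(X)/M_n(Y)$; direct sums $X\oplus Y$ carry the max norms on $M_n(X)\oplus M_n(Y)$. A complete isomorphism is an invertible linear map $T$ with $T,T^{-1}$ completely bounded. A compatible couple $(X_0,X_1)$ consists of spaces continuously and linearly embedded in a common Hausdorff topological vector space; $\Sigma=X_0+X_1$ with norm $\inf\{\|x_0\|_{X_0}+\|x_1\|_{X_1}:x=x_0+x_1\}$; $\mathbb S=\{0\le\mathrm{Re}\,z\le1\}$. $\mathcal F=\mathcal F(X_0,X_1)$ is the Banach space of functions $f:\mathbb S\to\Sigma$ bounded and continuous on $\mathbb S$, analytic in its interior, with $f(it)\in X_0$, $f(1+it)\in X_1$ and $t\mapsto\|f(it)\|_{X_0}$, $t\mapsto\|f(1+it)\|_{X_1}$ bounded and continuous, with norm $\max\{\sup_t\|f(it)\|_{X_0},\sup_t\|f(1+it)\|_{X_1}\}$ and operator space structure $M_n(\mathcal F(X_0,X_1))=\mathcal F(M_n(X_0),M_n(X_1))$. $\delta_\theta(f)=f(\theta)$, $\delta'_\theta(f)=f'(\theta)$, $X_\theta=\mathcal F/\ker\delta_\theta$ (quotient structure); $\delta_\theta'$ maps $\ker\delta_\theta$ onto $X_\theta$ and is completely bounded. The pushout of completely bounded maps $A:Y\to X$, $B:Y\to K$ is $\mathcal{PO}=(X\oplus K)/\Delta$, where $\Delta$ is the closure of $\{(Ay,-By):y\in Y\}$. An extension sequence $0\to Y\xrightarrow{i}X\xrightarrow{q}Z\to0$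 is a short exact sequence of operator spaces and completely bounded maps with $i$ a complete isomorphism onto its image and with the map $X/\ker q\to Z$ induced by $q$ a complete isomorphism.
   Formalization: In the definition of F, the maps t -> f(it) and t -> f(1+it) are required to be bounded and continuous into X_0 and X_1 (Calderon's condition), not merely to have continuous norms, since with continuity of the norms alone F need not be a vector space. *)

theory Defs
  imports "HOL-Analysis.Analysis" "HOL-Algebra.AbelCoset" "HOL-Algebra.Module"
    "HOL-Algebra.Algebraic_Closure_Type"
begin

no_notation var (\<open>X\<index>\<close>) (* frees the variable name X *)

subsection \<open>Operator spaces\<close>

text \<open>
  An \<open>n \<times> n\<close> matrix over \<open>X\<close> is a function \<open>nat \<Rightarrow> nat \<Rightarrow> 'a\<close> of which only the entries with
  indices below \<open>n\<close> matter; \<open>mnorm X n\<close> is the norm of \<open>M\<^sub>n(X)\<close> for \<open>n > 0\<close>.  The fields \<open>mult\<close>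
  and \<open>one\<close> that \<^type>\<open>module\<close> records inherit from rings play no role.
\<close>

record 'a opspace = "(complex, 'a) module" +
  mnorm :: "nat \<Rightarrow> (nat \<Rightarrow> nat \<Rightarrow> 'a) \<Rightarrow> real"

definition mats :: "'a opspace \<Rightarrow> nat \<Rightarrow> (nat \<Rightarrow> nat \<Rightarrow> 'a) set" where
  "mats X n = {x. \<forall>i<n. \<forall>j<n. x i j \<in> carrier X}"

definition vnorm :: "'a opspace \<Rightarrow> 'a \<Rightarrow> real" where
  "vnorm X x = mnorm X 1 (\<lambda>i j. x)"

text \<open>The locale \<^locale>\<open>Metric_space\<close> constrains the distance off the carrier too, hence the
  default value.\<close>

definition norm_dist :: "'a set \<Rightarrow> ('a \<Rightarrow> 'a \<Rightarrow> 'a) \<Rightarrow> ('a \<Rightarrow> real) \<Rightarrow> 'a \<Rightarrow> 'a \<Rightarrow> real" where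
  "norm_dist A sub N x y = (if x \<in> A \<and> y \<in> A then N (sub x y) else 0)"

definition op_dist :: "'a opspace \<Rightarrow> 'a \<Rightarrow> 'a \<Rightarrow> real" where
  "op_dist X = norm_dist (carrier X) (\<lambda>x y. x \<ominus>\<^bsub>X\<^esub> y) (vnorm X)"

definition op_topology :: "'a opspace \<Rightarrow> 'a topology" where
  "op_topology X = Metric_space.mtopology (carrier X) (op_dist X)"

text \<open>The operator norm of an \<open>n \<times> m\<close> complex matrix between Hilbert spaces.\<close>

definition cmat_norm :: "nat \<Rightarrow> nat \<Rightarrow> (nat \<Rightarrow> nat \<Rightarrow> complex) \<Rightarrow> real" where
  "cmat_norm n m \<alpha> =
     Sup {L2_set (\<lambda>i. cmod (\<Sum>j<m. \<alpha> i j * v j)) {..<n} | v. L2_set (\<lambda>j. cmod (v j)) {..<m} \<le> 1}"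

definition mat_sandwich ::
    "'a opspace \<Rightarrow> nat \<Rightarrow> (nat \<Rightarrow> nat \<Rightarrow> complex) \<Rightarrow> (nat \<Rightarrow> nat \<Rightarrow> 'a) \<Rightarrow> (nat \<Rightarrow> nat \<Rightarrow> complex)
      \<Rightarrow> nat \<Rightarrow> nat \<Rightarrow> 'a" where
  "mat_sandwich X m \<alpha> x \<beta> =
     (\<lambda>i j. finsum X (\<lambda>(k, l). (\<alpha> i k * \<beta> l j) \<odot>\<^bsub>X\<^esub> x k l) ({..<m} \<times> {..<m}))"

definition mat_diag ::
    "'a opspace \<Rightarrow> nat \<Rightarrow> nat \<Rightarrow> (nat \<Rightarrow> nat \<Rightarrow> 'a) \<Rightarrow> (nat \<Rightarrow> nat \<Rightarrow> 'a) \<Rightarrow> nat \<Rightarrow> nat \<Rightarrow> 'a" where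
  "mat_diag X m n x y =
     (\<lambda>i j. if i < m \<and> j < m then x i j
            else if m \<le> i \<and> m \<le> j then y (i - m) (j - m) else \<zero>\<^bsub>X\<^esub>)"

text \<open>
  Operator spaces are complex and complete.  Completeness of the first matrix level gives that
  of all \<open>M\<^sub>n(X)\<close>, since the matrix norms are equivalent to the maximum of the entry norms.
\<close>

definition operator_space :: "'a opspace \<Rightarrow> bool" where
  "operator_space X \<longleftrightarrow>
     Module.module (ring_of_type_algebra :: complex ring) X \<and>
     (\<forall>n>0. \<forall>x y. (\<forall>i<n. \<forall>j<n. x i j = y i j) \<longrightarrow> mnorm X n x = mnorm X n y) \<and>
     (\<forall>n>0. \<forall>x\<in>mats X n. mnorm X n x = 0 \<longleftrightarrow> (\<forall>i<n. \<forall>j<n. x i j = \<zero>\<^bsub>X\<^esub>)) \<and>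
     (\<forall>n>0. \<forall>c. \<forall>x\<in>mats X n. mnorm X n (\<lambda>i j. c \<odot>\<^bsub>X\<^esub> x i j) = cmod c * mnorm X n x) \<and>
     (\<forall>n>0. \<forall>x\<in>mats X n. \<forall>y\<in>mats X n.
        mnorm X n (\<lambda>i j. x i j \<oplus>\<^bsub>X\<^esub> y i j) \<le> mnorm X n x + mnorm X n y) \<and>
     (\<forall>n>0. \<forall>m>0. \<forall>\<alpha> \<beta>. \<forall>x\<in>mats X m.
        mnorm X n (mat_sandwich X m \<alpha> x \<beta>) \<le> cmat_norm n m \<alpha> * mnorm X m x * cmat_norm m n \<beta>) \<and>
     (\<forall>m>0. \<forall>n>0. \<forall>x\<in>mats X m. \<forall>y\<in>mats X n.
        mnorm X (m + n) (mat_diag X m n x y) = max (mnorm X m x) (mnorm X n y)) \<and>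
     Metric_space.mcomplete (carrier X) (op_dist X)"

definition completely_bounded :: "'a opspace \<Rightarrow> 'b opspace \<Rightarrow> ('a \<Rightarrow> 'b) \<Rightarrow> bool" where
  "completely_bounded X Y T \<longleftrightarrow>
     T \<in> carrier X \<rightarrow> carrier Y \<and>
     (\<forall>x\<in>carrier X. \<forall>y\<in>carrier X. T (x \<oplus>\<^bsub>X\<^esub> y) = T x \<oplus>\<^bsub>Y\<^esub> T y) \<and>
     (\<forall>c. \<forall>x\<in>carrier X. T (c \<odot>\<^bsub>X\<^esub> x) = c \<odot>\<^bsub>Y\<^esub> T x) \<and>
     (\<exists>C. \<forall>n>0. \<forall>x\<in>mats X n. mnorm Y n (\<lambda>i j. T (x i j)) \<le> C * mnorm X n x)"

definition complete_iso :: "'a opspace \<Rightarrow> 'b opspace \<Rightarrow> ('a \<Rightarrow> 'b) \<Rightarrow> bool" where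
  "complete_iso X Y T \<longleftrightarrow>
     completely_bounded X Y T \<and> bij_betw T (carrier X) (carrier Y) \<and>
     completely_bounded Y X (inv_into (carrier X) T)"

definition op_subspace :: "'a opspace \<Rightarrow> 'a set \<Rightarrow> 'a opspace" where
  "op_subspace X S = X\<lparr>carrier := S\<rparr>"

definition op_quotient :: "'a opspace \<Rightarrow> 'a set \<Rightarrow> 'a set opspace" where
  "op_quotient X S =
     \<lparr>carrier = a_rcosets\<^bsub>X\<^esub> S, mult = undefined, one = undefined, zero = S, add = set_add X,
      smult = (\<lambda>c C. \<Union>x\<in>C. S +>\<^bsub>X\<^esub> (c \<odot>\<^bsub>X\<^esub> x)),
      mnorm = (\<lambda>n C. Inf {mnorm X n x | x. x \<in> mats X n \<and>
                 (\<forall>i<n. \<forall>j<n. S +>\<^bsub>X\<^esub> x i j = C i j)})\<rparr>"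

definition op_sum :: "'a opspace \<Rightarrow> 'b opspace \<Rightarrow> ('a \<times> 'b) opspace" where
  "op_sum X Y =
     \<lparr>carrier = carrier X \<times> carrier Y, mult = undefined, one = undefined, zero = (\<zero>\<^bsub>X\<^esub>, \<zero>\<^bsub>Y\<^esub>),
      add = (\<lambda>u v. (fst u \<oplus>\<^bsub>X\<^esub> fst v, snd u \<oplus>\<^bsub>Y\<^esub> snd v)),
      smult = (\<lambda>c u. (c \<odot>\<^bsub>X\<^esub> fst u, c \<odot>\<^bsub>Y\<^esub> snd u)),
      mnorm = (\<lambda>n u. max (mnorm X n (\<lambda>i j. fst (u i j))) (mnorm Y n (\<lambda>i j. snd (u i j))))\<rparr>"

text \<open>
  For a linear map \<open>\<Phi>\<close> from \<open>X\<close> into a vector space \<open>W\<close>: the quotient \<open>X / ker \<Phi>\<close>, carried over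
  to the range of \<open>\<Phi>\<close> by identifying a value \<open>y\<close> with the coset \<open>{x. \<Phi> x = y}\<close>.
\<close>

definition quotient_on_range :: "'a opspace \<Rightarrow> (complex, 'b) module \<Rightarrow> ('a \<Rightarrow> 'b) \<Rightarrow> 'b opspace" where
  "quotient_on_range X W \<Phi> =
     \<lparr>carrier = \<Phi> ` carrier X, mult = undefined, one = undefined, zero = \<zero>\<^bsub>W\<^esub>, add = add W,
      smult = smult W,
      mnorm = (\<lambda>n y. mnorm (op_quotient X (a_kernel X W \<Phi>)) n
                 (\<lambda>i j. {x \<in> carrier X. \<Phi> x = y i j}))\<rparr>"

subsection \<open>Extension sequences and pushouts\<close>

definition extension_sequence ::
    "'a opspace \<Rightarrow> 'b opspace \<Rightarrow> 'c opspace \<Rightarrow> ('a \<Rightarrow> 'b) \<Rightarrow> ('b \<Rightarrow> 'c) \<Rightarrow> bool" where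
  "extension_sequence Y X Z i q \<longleftrightarrow>
     operator_space Y \<and> operator_space X \<and> operator_space Z \<and>
     completely_bounded Y X i \<and> completely_bounded X Z q \<and>
     inj_on i (carrier Y) \<and> i ` carrier Y = a_kernel X Z q \<and> q ` carrier X = carrier Z \<and>
     complete_iso Y (op_subspace X (i ` carrier Y)) i \<and>
     complete_iso (op_quotient X (a_kernel X Z q)) Z (\<lambda>C. the_elem (q ` C))"

definition pushout_rel ::
    "'y opspace \<Rightarrow> 'a opspace \<Rightarrow> 'k opspace \<Rightarrow> ('y \<Rightarrow> 'a) \<Rightarrow> ('y \<Rightarrow> 'k) \<Rightarrow> ('a \<times> 'k) set" where
  "pushout_rel Y X K A B =
     op_topology (op_sum X K) closure_of {(A y, \<ominus>\<^bsub>K\<^esub> B y) | y. y \<in> carrier Y}"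

definition pushout ::
    "'y opspace \<Rightarrow> 'a opspace \<Rightarrow> 'k opspace \<Rightarrow> ('y \<Rightarrow> 'a) \<Rightarrow> ('y \<Rightarrow> 'k) \<Rightarrow> ('a \<times> 'k) set opspace" where
  "pushout Y X K A B = op_quotient (op_sum X K) (pushout_rel Y X K A B)"

subsection \<open>Compatible couples and complex interpolation\<close>

text \<open>
  The ambient topological vector space is a type \<open>'v\<close> with an explicit complex scalar
  multiplication \<open>s\<close>.
\<close>

definition complex_tvs ::
    "(complex \<Rightarrow> 'v \<Rightarrow> 'v::{topological_ab_group_add, t2_space}) \<Rightarrow> bool" where
  "complex_tvs s \<longleftrightarrow> vector_space s \<and> continuous_on UNIV (\<lambda>(c, v). s c v)"

definition embedded_in ::
    "'v opspace \<Rightarrow> (complex \<Rightarrow> 'v \<Rightarrow> 'v::{topological_ab_group_add, t2_space}) \<Rightarrow> bool" where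
  "embedded_in X s \<longleftrightarrow>
     add X = (+) \<and> zero X = 0 \<and> smult X = s \<and>
     continuous_map (op_topology X) euclidean (\<lambda>x. x)"

definition compatible_couple ::
    "(complex \<Rightarrow> 'v \<Rightarrow> 'v::{topological_ab_group_add, t2_space}) \<Rightarrow> 'v opspace \<Rightarrow> 'v opspace \<Rightarrow> bool" where
  "compatible_couple s X0 X1 \<longleftrightarrow>
     complex_tvs s \<and> operator_space X0 \<and> operator_space X1 \<and> embedded_in X0 s \<and> embedded_in X1 s"

definition sum_carrier :: "'v::ab_group_add opspace \<Rightarrow> 'v opspace \<Rightarrow> 'v set" where
  "sum_carrier X0 X1 = {a + b | a b. a \<in> carrier X0 \<and> b \<in> carrier X1}"

definition sum_norm :: "'v::ab_group_add opspace \<Rightarrow> 'v opspace \<Rightarrow> 'v \<Rightarrow> real" where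
  "sum_norm X0 X1 x =
     Inf {vnorm X0 a + vnorm X1 b | a b. a \<in> carrier X0 \<and> b \<in> carrier X1 \<and> x = a + b}"

definition sum_topology :: "'v::ab_group_add opspace \<Rightarrow> 'v opspace \<Rightarrow> 'v topology" where
  "sum_topology X0 X1 =
     Metric_space.mtopology (sum_carrier X0 X1)
       (norm_dist (sum_carrier X0 X1) (\<lambda>x y. x - y) (sum_norm X0 X1))"

definition strip :: "complex set" where
  "strip = {z. 0 \<le> Re z \<and> Re z \<le> 1}"

definition has_sum_deriv ::
    "(complex \<Rightarrow> 'v \<Rightarrow> 'v::ab_group_add) \<Rightarrow> 'v opspace \<Rightarrow> 'v opspace \<Rightarrow> (complex \<Rightarrow> 'v) \<Rightarrow> 'v \<Rightarrow> complex \<Rightarrow> bool" where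
  "has_sum_deriv s X0 X1 f L z \<longleftrightarrow>
     L \<in> sum_carrier X0 X1 \<and>
     ((\<lambda>w. sum_norm X0 X1 (s (inverse (w - z)) (f w - f z) - L)) \<longlongrightarrow> 0) (at z)"

definition sum_deriv ::
    "(complex \<Rightarrow> 'v \<Rightarrow> 'v::ab_group_add) \<Rightarrow> 'v opspace \<Rightarrow> 'v opspace \<Rightarrow> (complex \<Rightarrow> 'v) \<Rightarrow> complex \<Rightarrow> 'v" where
  "sum_deriv s X0 X1 f z = (THE L. has_sum_deriv s X0 X1 f L z)"

text \<open>
  The space \<open>\<F>(X0, X1)\<close>.  Functions on the strip are represented by their extension by zero, so
  that equality on the strip is equality.  The boundary functions are bounded and continuous as
  maps into \<open>X0\<close> and \<open>X1\<close>; continuity of \<open>t \<mapsto> \<parallel>f(it)\<parallel>\<close> alone would not be stable under sums.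
  The norm of \<open>M\<^sub>n(\<F>(X0, X1))\<close> is the norm of \<open>\<F>(M\<^sub>n(X0), M\<^sub>n(X1))\<close>.
\<close>

definition calderon_carrier ::
    "(complex \<Rightarrow> 'v \<Rightarrow> 'v::ab_group_add) \<Rightarrow> 'v opspace \<Rightarrow> 'v opspace \<Rightarrow> (complex \<Rightarrow> 'v) set" where
  "calderon_carrier s X0 X1 =
     {f. (\<forall>z. z \<notin> strip \<longrightarrow> f z = 0) \<and>
         continuous_map (top_of_set strip) (sum_topology X0 X1) f \<and>
         bdd_above ((\<lambda>z. sum_norm X0 X1 (f z)) ` strip) \<and>
         (\<forall>z\<in>interior strip. \<exists>L. has_sum_deriv s X0 X1 f L z) \<and>
         continuous_map euclideanreal (op_topology X0) (\<lambda>t. f (\<i> * of_real t)) \<and>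
         bdd_above (range (\<lambda>t. vnorm X0 (f (\<i> * of_real t)))) \<and>
         continuous_map euclideanreal (op_topology X1) (\<lambda>t. f (1 + \<i> * of_real t)) \<and>
         bdd_above (range (\<lambda>t. vnorm X1 (f (1 + \<i> * of_real t))))}"

definition calderon ::
    "(complex \<Rightarrow> 'v \<Rightarrow> 'v::ab_group_add) \<Rightarrow> 'v opspace \<Rightarrow> 'v opspace \<Rightarrow> (complex \<Rightarrow> 'v) opspace" where
  "calderon s X0 X1 =
     \<lparr>carrier = calderon_carrier s X0 X1, mult = undefined, one = undefined, zero = (\<lambda>z. 0),
      add = (\<lambda>f g z. f z + g z), smult = (\<lambda>c f z. s c (f z)),
      mnorm = (\<lambda>n f. max (SUP t. mnorm X0 n (\<lambda>i j. f i j (\<i> * of_real t)))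
                         (SUP t. mnorm X1 n (\<lambda>i j. f i j (1 + \<i> * of_real t))))\<rparr>"

definition ambient :: "(complex \<Rightarrow> 'v \<Rightarrow> 'v::ab_group_add) \<Rightarrow> (complex, 'v) module" where
  "ambient s =
     \<lparr>carrier = UNIV, mult = undefined, one = undefined, zero = 0, add = (+), smult = s\<rparr>"

definition eval_at :: "real \<Rightarrow> (complex \<Rightarrow> 'v) \<Rightarrow> 'v" where
  "eval_at \<theta> f = f (of_real \<theta>)"

definition deriv_at ::
    "(complex \<Rightarrow> 'v \<Rightarrow> 'v::ab_group_add) \<Rightarrow> 'v opspace \<Rightarrow> 'v opspace \<Rightarrow> real \<Rightarrow> (complex \<Rightarrow> 'v) \<Rightarrow> 'v" where
  "deriv_at s X0 X1 \<theta> f = sum_deriv s X0 X1 f (of_real \<theta>)"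

definition ker_eval ::
    "(complex \<Rightarrow> 'v \<Rightarrow> 'v::ab_group_add) \<Rightarrow> 'v opspace \<Rightarrow> 'v opspace \<Rightarrow> real \<Rightarrow> (complex \<Rightarrow> 'v) opspace" where
  "ker_eval s X0 X1 \<theta> =
     op_subspace (calderon s X0 X1) (a_kernel (calderon s X0 X1) (ambient s) (eval_at \<theta>))"

definition interp ::
    "(complex \<Rightarrow> 'v \<Rightarrow> 'v::ab_group_add) \<Rightarrow> 'v opspace \<Rightarrow> 'v opspace \<Rightarrow> real \<Rightarrow> 'v opspace" where
  "interp s X0 X1 \<theta> = quotient_on_range (calderon s X0 X1) (ambient s) (eval_at \<theta>)"

definition dinterp ::
    "(complex \<Rightarrow> 'v \<Rightarrow> 'v::ab_group_add) \<Rightarrow> 'v opspace \<Rightarrow> 'v opspace \<Rightarrow> real \<Rightarrow> ('v \<times> 'v) opspace" where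
  "dinterp s X0 X1 \<theta> =
     quotient_on_range (calderon s X0 X1) (ambient (\<lambda>c u. (s c (fst u), s c (snd u))))
       (\<lambda>f. (eval_at \<theta> f, deriv_at s X0 X1 \<theta> f))"

definition interp_rel ::
    "(complex \<Rightarrow> 'v \<Rightarrow> 'v::ab_group_add) \<Rightarrow> 'v opspace \<Rightarrow> 'v opspace \<Rightarrow> real \<Rightarrow> ((complex \<Rightarrow> 'v) \<times> 'v) set" where
  "interp_rel s X0 X1 \<theta> =
     pushout_rel (ker_eval s X0 X1 \<theta>) (calderon s X0 X1) (interp s X0 X1 \<theta>)
       (\<lambda>f. f) (deriv_at s X0 X1 \<theta>)"

definition interp_pushout ::
    "(complex \<Rightarrow> 'v \<Rightarrow> 'v::ab_group_add) \<Rightarrow> 'v opspace \<Rightarrow> 'v opspace \<Rightarrow> real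
      \<Rightarrow> ((complex \<Rightarrow> 'v) \<times> 'v) set opspace" where
  "interp_pushout s X0 X1 \<theta> =
     pushout (ker_eval s X0 X1 \<theta>) (calderon s X0 X1) (interp s X0 X1 \<theta>)
       (\<lambda>f. f) (deriv_at s X0 X1 \<theta>)"

definition pushout_incl ::
    "(complex \<Rightarrow> 'v \<Rightarrow> 'v::ab_group_add) \<Rightarrow> 'v opspace \<Rightarrow> 'v opspace \<Rightarrow> real
      \<Rightarrow> 'v \<Rightarrow> ((complex \<Rightarrow> 'v) \<times> 'v) set" where
  "pushout_incl s X0 X1 \<theta> x =
     interp_rel s X0 X1 \<theta> +>\<^bsub>op_sum (calderon s X0 X1) (interp s X0 X1 \<theta>)\<^esub> (\<lambda>z. 0, x)"

definition pushout_proj :: "real \<Rightarrow> ((complex \<Rightarrow> 'v) \<times> 'v) set \<Rightarrow> 'v" where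
  "pushout_proj \<theta> C = the_elem ((\<lambda>(f, x). eval_at \<theta> f) ` C)"

end

theory Submission
  imports Defs "HOL-Complex_Analysis.Complex_Analysis" "HOL-Real_Asymp.Real_Asymp"
begin

text \<open>
  Write \<open>\<F>\<close> for the space of functions on the strip, \<open>E\<close> for the interpolation space \<open>X\<^sub>\<theta>\<close> and
  \<open>dE\<close> for \<open>dX\<^sub>\<theta>\<close>.  The isomorphism comes from the map \<open>R (f, x) = (f \<theta>, f' \<theta> + x)\<close> from
  \<open>\<F> \<oplus> E\<close> to \<open>dE\<close>.  Its kernel consists of the pairs \<open>(f, - f' \<theta>)\<close> with \<open>f \<theta> = 0\<close>, which are
  exactly the pairs whose closure \<open>\<Delta>\<close> is divided out in the pushout.  As the kernel of a completely
  bounded map this set is closed already, so \<open>\<Delta> = ker R\<close>, and \<open>R\<close> induces an injective map \<open>T\<close> on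
  the pushout.  A matrix of jets \<open>(f \<theta>, f' \<theta>)\<close> lifts to \<open>(f, 0)\<close>, with control of the norm because
  \<open>dE\<close> is a quotient of \<open>\<F>\<close>; hence \<open>T\<close> is a complete isomorphism (\<open>T_complete_iso\<close>).  It sends
  the class of \<open>(0, x)\<close> to \<open>(0, x)\<close> and preserves the first coordinate, and the extension property of
  the pushout sequence is pulled back along \<open>T\<close> from that of the sequence through \<open>dE\<close>.

  That \<open>R\<close> is completely bounded and that \<open>E \<rightarrow> dE \<rightarrow> E\<close> is an extension sequence both rest on a
  comparison between the values at \<open>\<theta>\<close> and the derivatives at \<open>\<theta>\<close> of functions vanishing there
  (\<open>derivative_lift\<close>, \<open>kernel_lift\<close>).  Let \<open>u\<close> map the strip conformally to the unit disc with a
  simple zero at \<open>\<theta>\<close> and derivative \<open>d\<close> there.  If \<open>g \<theta> = y\<close>, then \<open>(u / d) g\<close> vanishes at \<open>\<theta>\<close>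
  and has derivative \<open>y\<close>; conversely, if \<open>f \<theta> = 0\<close>, then \<open>(d / u) f\<close> takes the value \<open>f' \<theta>\<close>.  Since \<open>u\<close> has
  modulus 1 on the boundary lines, where the norm of \<open>\<F>\<close> is computed, both operations change all
  matrix norms by a constant factor.  So \<open>y \<mapsto> (0, y)\<close> is a complete isomorphism of \<open>E\<close> onto its
  image, and this image is the kernel of the first projection.

  It remains to see that all spaces involved are operator spaces.  Ruan's axioms pass to suprema of
  pullbacks, which covers \<open>\<F>\<close> and direct sums, and the axioms and completeness pass to quotients by
  closed kernels (\<open>operator_space_quotient\<close>).  The kernels of the evaluation and of the derivative
  are closed because the maximum principle on the strip and Cauchy's inequality bound \<open>f \<theta>\<close> and
  \<open>f' \<theta>\<close> in the norm of \<open>X\<^sub>0 + X\<^sub>1\<close> by the norm of \<open>f\<close>.  Vector-valued statements of this kind are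
  reduced to scalar ones by norming functionals (\<open>exists_norming_functional\<close>), and a bounded function
  all of whose scalar compositions are holomorphic is differentiable in norm
  (\<open>weakly_holomorphic_imp_has_sum_deriv\<close>).  The last fact gives a criterion for membership in \<open>\<F>\<close>
  (\<open>calderonI\<close>) from which completeness of \<open>\<F>\<close> and the division by \<open>u\<close> follow.
\<close>

section \<open>Complex modules\<close>

abbreviation complex_ring :: "complex ring" where
  "complex_ring \<equiv> ring_of_type_algebra"

lemma complex_ring_simps [simp]:
  "carrier complex_ring = UNIV" "zero complex_ring = 0" "one complex_ring = 1"
  "add complex_ring = (+)" "mult complex_ring = (*)"
  by (simp_all add: ring_of_type_algebra_def)

lemma cring_complex_ring: "cring complex_ring"
  by (rule cring_from_type_algebra)

text \<open>The condition at zero is part of the definition because the target may be a bare record, which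
  \<open>cmodule_image\<close> then proves to be a module.\<close>

definition linear_map ::
    "(complex, 'a, 'm) module_scheme \<Rightarrow> (complex, 'b, 'n) module_scheme \<Rightarrow> ('a \<Rightarrow> 'b) \<Rightarrow> bool" where
  "linear_map X Y T \<longleftrightarrow>
     T \<in> carrier X \<rightarrow> carrier Y \<and> T \<zero>\<^bsub>X\<^esub> = \<zero>\<^bsub>Y\<^esub> \<and>
     (\<forall>x\<in>carrier X. \<forall>y\<in>carrier X. T (x \<oplus>\<^bsub>X\<^esub> y) = T x \<oplus>\<^bsub>Y\<^esub> T y) \<and>
     (\<forall>c. \<forall>x\<in>carrier X. T (c \<odot>\<^bsub>X\<^esub> x) = c \<odot>\<^bsub>Y\<^esub> T x)"

lemma linear_mapD:
  assumes "linear_map X Y T"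
  shows "x \<in> carrier X \<Longrightarrow> T x \<in> carrier Y"
    and "T \<zero>\<^bsub>X\<^esub> = \<zero>\<^bsub>Y\<^esub>"
    and "\<lbrakk>x \<in> carrier X; y \<in> carrier X\<rbrakk> \<Longrightarrow> T (x \<oplus>\<^bsub>X\<^esub> y) = T x \<oplus>\<^bsub>Y\<^esub> T y"
    and "x \<in> carrier X \<Longrightarrow> T (c \<odot>\<^bsub>X\<^esub> x) = c \<odot>\<^bsub>Y\<^esub> T x"
  using assms by (auto simp: linear_map_def)

locale cmodule = Module.module complex_ring M for M (structure)
begin

lemma smult_in [simp, intro]: "x \<in> carrier M \<Longrightarrow> c \<odot> x \<in> carrier M"
  by (rule smult_closed) simp_all

lemma smult_distrib: "\<lbrakk>x \<in> carrier M; y \<in> carrier M\<rbrakk> \<Longrightarrow> c \<odot> (x \<oplus> y) = c \<odot> x \<oplus> c \<odot> y"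
  by (rule smult_r_distr) simp_all

lemma smult_add: "x \<in> carrier M \<Longrightarrow> (c + d) \<odot> x = c \<odot> x \<oplus> d \<odot> x"
  using smult_l_distr[of c d x] by simp

lemma smult_mult: "x \<in> carrier M \<Longrightarrow> (c * d) \<odot> x = c \<odot> (d \<odot> x)"
  using smult_assoc1[of c d x] by simp

lemma smult_1 [simp]: "x \<in> carrier M \<Longrightarrow> 1 \<odot> x = x"
  using smult_one[of x] by simp

lemma smult_0_left [simp]: "x \<in> carrier M \<Longrightarrow> 0 \<odot> x = \<zero>"
  using smult_l_null[of x] by simp

lemma smult_0_right [simp]: "c \<odot> \<zero> = \<zero>"
  using smult_r_null[of c] by simp

lemma smult_neg_1: "x \<in> carrier M \<Longrightarrow> (-1) \<odot> x = \<ominus> x"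
proof -
  assume x: "x \<in> carrier M"
  have "(-1) \<odot> x \<oplus> x = ((-1) + 1) \<odot> x"
    using smult_add[of x "-1" 1] x by simp
  then have "(-1) \<odot> x \<oplus> x = \<zero>"
    using x by simp
  then show "(-1) \<odot> x = \<ominus> x"
    using x by (simp add: M.minus_equality)
qed

lemma minus_conv_smult:
  "\<lbrakk>x \<in> carrier M; y \<in> carrier M\<rbrakk> \<Longrightarrow> x \<ominus> y = x \<oplus> (-1) \<odot> y"
  by (simp add: smult_neg_1 M.minus_eq)

lemma minus_in [simp, intro]: "\<lbrakk>x \<in> carrier M; y \<in> carrier M\<rbrakk> \<Longrightarrow> x \<ominus> y \<in> carrier M"
  by (rule M.minus_closed)

lemma diff_chain:
  "\<lbrakk>x \<in> carrier M; y \<in> carrier M; z \<in> carrier M\<rbrakk> \<Longrightarrow> (x \<ominus> y) \<oplus> (y \<ominus> z) = x \<ominus> z"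
  by (simp add: M.minus_eq M.a_assoc M.r_neg1)

lemma diff_flip: "\<lbrakk>x \<in> carrier M; y \<in> carrier M\<rbrakk> \<Longrightarrow> \<ominus> (x \<ominus> y) = y \<ominus> x"
  by (simp add: M.minus_eq M.minus_add M.a_comm)

lemma diff_add_cancel: "\<lbrakk>x \<in> carrier M; y \<in> carrier M\<rbrakk> \<Longrightarrow> y \<oplus> (x \<ominus> y) = x"
  by (simp add: M.minus_eq M.a_lcomm[of y x] M.r_neg)

lemma add_diff_cancel: "\<lbrakk>x \<in> carrier M; y \<in> carrier M\<rbrakk> \<Longrightarrow> (x \<oplus> y) \<ominus> x = y"
  by (simp add: M.minus_eq M.a_comm[of x y] M.a_assoc M.r_neg)

lemma diff_eq_zero_iff: "\<lbrakk>x \<in> carrier M; y \<in> carrier M\<rbrakk> \<Longrightarrow> x \<ominus> y = \<zero> \<longleftrightarrow> x = y"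
  using diff_add_cancel[of x y] by (auto simp: M.minus_eq M.r_neg)

end

lemma linear_map_diff:
  assumes "cmodule X" "cmodule Y" "linear_map X Y T" "x \<in> carrier X" "y \<in> carrier X"
  shows "T (x \<ominus>\<^bsub>X\<^esub> y) = T x \<ominus>\<^bsub>Y\<^esub> T y"
proof -
  interpret X: cmodule X by fact
  interpret Y: cmodule Y by fact
  show ?thesis
    using assms linear_mapD[OF assms(3)]
    by (simp add: X.minus_conv_smult Y.minus_conv_smult)
qed

lemma linear_map_finsum:
  assumes "cmodule X" "cmodule Y" "linear_map X Y T" "finite A" "\<And>a. a \<in> A \<Longrightarrow> f a \<in> carrier X"
  shows "T (finsum X f A) = finsum Y (\<lambda>a. T (f a)) A"
proof -
  interpret X: cmodule X by fact
  interpret Y: cmodule Y by fact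
  note T = linear_mapD[OF assms(3)]
  show ?thesis
    using assms(4,5)
  proof (induction A rule: finite_induct)
    case empty
    then show ?case by (simp add: T)
  next
    case (insert a A)
    then have "T (finsum X f (insert a A)) = T (f a \<oplus>\<^bsub>X\<^esub> finsum X f A)"
      by (subst X.finsum_insert) auto
    also have "\<dots> = T (f a) \<oplus>\<^bsub>Y\<^esub> T (finsum X f A)"
      using insert.prems by (intro T X.finsum_closed) auto
    also have "\<dots> = finsum Y (\<lambda>a. T (f a)) (insert a A)"
      using insert T by (subst Y.finsum_insert) auto
    finally show ?case .
  qed
qed

text \<open>The module laws are equations, so they hold in any linear image.  Quotients get their module
  structure in this way.\<close>

lemma cmodule_image:
  fixes X :: "(complex, 'a, 'm) module_scheme" and Y :: "(complex, 'b, 'n) module_scheme"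
  assumes "cmodule X" "linear_map X Y Q" "Q ` carrier X = carrier Y"
  shows "cmodule Y"
proof -
  interpret X: cmodule X by fact
  note Q = linear_mapD[OF assms(2)]
  have E: "\<exists>x\<in>carrier X. y = Q x" if "y \<in> carrier Y" for y
    using that assms(3) by blast
  have ag: "abelian_group Y"
  proof (rule abelian_groupI)
    fix x y assume "x \<in> carrier Y" "y \<in> carrier Y"
    then obtain a b where "a \<in> carrier X" "b \<in> carrier X" "x = Q a" "y = Q b"
      using E by meson
    then show "x \<oplus>\<^bsub>Y\<^esub> y \<in> carrier Y" "x \<oplus>\<^bsub>Y\<^esub> y = y \<oplus>\<^bsub>Y\<^esub> x"
      using Q(1)[of "a \<oplus>\<^bsub>X\<^esub> b"] Q(3)[of a b] Q(3)[of b a] by (auto simp: X.a_comm)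
  next
    show "\<zero>\<^bsub>Y\<^esub> \<in> carrier Y"
      using Q(1)[of "\<zero>\<^bsub>X\<^esub>"] Q(2) by auto
  next
    fix x y z assume "x \<in> carrier Y" "y \<in> carrier Y" "z \<in> carrier Y"
    then obtain a b c where abc: "a \<in> carrier X" "b \<in> carrier X" "c \<in> carrier X"
      "x = Q a" "y = Q b" "z = Q c"
      using E by meson
    show "x \<oplus>\<^bsub>Y\<^esub> y \<oplus>\<^bsub>Y\<^esub> z = x \<oplus>\<^bsub>Y\<^esub> (y \<oplus>\<^bsub>Y\<^esub> z)"
      using abc by (simp add: Q(3)[symmetric] X.a_assoc)
  next
    fix x assume "x \<in> carrier Y"
    then obtain a where a: "a \<in> carrier X" "x = Q a"
      using E by meson
    show "\<zero>\<^bsub>Y\<^esub> \<oplus>\<^bsub>Y\<^esub> x = x"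
      using a Q(3)[of "\<zero>\<^bsub>X\<^esub>" a] Q(2) by simp
    have "Q (\<ominus>\<^bsub>X\<^esub> a) \<oplus>\<^bsub>Y\<^esub> x = \<zero>\<^bsub>Y\<^esub>"
      using a Q(3)[of "\<ominus>\<^bsub>X\<^esub> a" a] Q(2) by (simp add: X.l_neg)
    then show "\<exists>y\<in>carrier Y. y \<oplus>\<^bsub>Y\<^esub> x = \<zero>\<^bsub>Y\<^esub>"
      using a Q(1) by blast
  qed
  show ?thesis
    unfolding cmodule_def
  proof (rule Module.moduleI[OF cring_complex_ring ag]; simp)
    fix c x assume "x \<in> carrier Y"
    then obtain a where a: "a \<in> carrier X" "x = Q a"
      using E by meson
    show "c \<odot>\<^bsub>Y\<^esub> x \<in> carrier Y"
      using a Q(1)[of "c \<odot>\<^bsub>X\<^esub> a"] Q(4)[of a c] by simp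
    show "1 \<odot>\<^bsub>Y\<^esub> x = x"
      using a Q(4)[of a 1] by simp
    fix d
    show "(c + d) \<odot>\<^bsub>Y\<^esub> x = c \<odot>\<^bsub>Y\<^esub> x \<oplus>\<^bsub>Y\<^esub> d \<odot>\<^bsub>Y\<^esub> x"
      using a by (simp add: Q(3,4)[symmetric] X.smult_add)
    show "(c * d) \<odot>\<^bsub>Y\<^esub> x = c \<odot>\<^bsub>Y\<^esub> (d \<odot>\<^bsub>Y\<^esub> x)"
      using a by (simp add: Q(3,4)[symmetric] X.smult_mult)
  next
    fix c x y assume "x \<in> carrier Y" "y \<in> carrier Y"
    then obtain a b where "a \<in> carrier X" "b \<in> carrier X" "x = Q a" "y = Q b"
      using E by meson
    then show "c \<odot>\<^bsub>Y\<^esub> (x \<oplus>\<^bsub>Y\<^esub> y) = c \<odot>\<^bsub>Y\<^esub> x \<oplus>\<^bsub>Y\<^esub> c \<odot>\<^bsub>Y\<^esub> y"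
      by (simp add: Q(3,4)[symmetric] X.smult_distrib)
  qed
qed

section \<open>Normed modules\<close>

locale cnormed = cmodule M for M (structure) +
  fixes N :: "'a \<Rightarrow> real"
  assumes N_zero_iff: "x \<in> carrier M \<Longrightarrow> N x = 0 \<longleftrightarrow> x = \<zero>"
    and N_smult: "x \<in> carrier M \<Longrightarrow> N (c \<odot> x) = cmod c * N x"
    and N_triangle: "\<lbrakk>x \<in> carrier M; y \<in> carrier M\<rbrakk> \<Longrightarrow> N (x \<oplus> y) \<le> N x + N y"
begin

lemma N_zero [simp]: "N \<zero> = 0"
  by (simp add: N_zero_iff)

lemma N_uminus: "x \<in> carrier M \<Longrightarrow> N (\<ominus> x) = N x"
  using N_smult[of x "-1"] by (simp add: smult_neg_1)

lemma N_nonneg: "x \<in> carrier M \<Longrightarrow> 0 \<le> N x"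
  using N_triangle[of x "\<ominus> x"] N_uminus[of x] by (simp add: M.r_neg)

lemma N_diff_commute: "\<lbrakk>x \<in> carrier M; y \<in> carrier M\<rbrakk> \<Longrightarrow> N (x \<ominus> y) = N (y \<ominus> x)"
  using N_uminus[of "x \<ominus> y"] by (simp add: diff_flip)

lemma N_diff_triangle:
  "\<lbrakk>x \<in> carrier M; y \<in> carrier M; z \<in> carrier M\<rbrakk> \<Longrightarrow> N (x \<ominus> z) \<le> N (x \<ominus> y) + N (y \<ominus> z)"
  using N_triangle[of "x \<ominus> y" "y \<ominus> z"] by (simp add: diff_chain)

abbreviation ndist :: "'a \<Rightarrow> 'a \<Rightarrow> real" where
  "ndist \<equiv> norm_dist (carrier M) (\<lambda>x y. x \<ominus> y) N"

sublocale met: Metric_space "carrier M" ndist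
  by unfold_locales
    (auto simp: norm_dist_def N_nonneg N_diff_commute N_zero_iff diff_eq_zero_iff N_diff_triangle)

lemma limitin_iff:
  assumes "\<And>n. \<xi> n \<in> carrier M"
  shows "limitin met.mtopology \<xi> l F \<longleftrightarrow> l \<in> carrier M \<and> ((\<lambda>n. N (\<xi> n \<ominus> l)) \<longlongrightarrow> 0) F"
proof -
  have "(\<lambda>n. ndist (\<xi> n) l) = (\<lambda>n. N (\<xi> n \<ominus> l))" if "l \<in> carrier M"
    using that assms by (simp add: norm_dist_def)
  then show ?thesis
    using assms by (auto simp: met.limitin_metric_dist_null)
qed

lemma MCauchy_iff:
  "met.MCauchy \<xi> \<longleftrightarrow> (\<forall>n. \<xi> n \<in> carrier M) \<and>
     (\<forall>e>0. \<exists>n0. \<forall>m\<ge>n0. \<forall>n\<ge>n0. N (\<xi> m \<ominus> \<xi> n) < e)"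
proof -
  have "range \<xi> \<subseteq> carrier M \<longleftrightarrow> (\<forall>n. \<xi> n \<in> carrier M)" by auto
  then show ?thesis
    by (auto simp: met.MCauchy_def norm_dist_def)
qed

lemma mcompleteD:
  assumes "met.mcomplete" "\<And>n. \<xi> n \<in> carrier M"
    and "\<And>e. e > 0 \<Longrightarrow> \<exists>n0. \<forall>m\<ge>n0. \<forall>n\<ge>n0. N (\<xi> m \<ominus> \<xi> n) < e"
  obtains l where "l \<in> carrier M" "(\<lambda>n. N (\<xi> n \<ominus> l)) \<longlonglongrightarrow> 0"
proof -
  have "met.MCauchy \<xi>"
    using assms(2,3) by (auto simp: MCauchy_iff)
  then obtain l where "limitin met.mtopology \<xi> l sequentially"
    using assms(1) unfolding met.mcomplete_def by blast
  then show ?thesis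
    using that limitin_iff[of \<xi> l sequentially] assms(2) by blast
qed

text \<open>A Cauchy sequence converges as soon as one subsequence does, and it has a subsequence whose
  consecutive distances decay like \<open>2\<^sup>-\<^sup>n\<close>.\<close>

lemma mcompleteI_fast:
  assumes "\<And>\<xi>. \<lbrakk>\<And>n. \<xi> n \<in> carrier M; \<And>n. N (\<xi> (Suc n) \<ominus> \<xi> n) \<le> (1/2) ^ n\<rbrakk>
             \<Longrightarrow> \<exists>l\<in>carrier M. (\<lambda>n. N (\<xi> n \<ominus> l)) \<longlonglongrightarrow> 0"
  shows "met.mcomplete"
  unfolding met.mcomplete_def
proof (intro allI impI)
  fix \<tau> assume \<tau>: "met.MCauchy \<tau>"
  then have in_carr: "\<And>n. \<tau> n \<in> carrier M"
    by (auto simp: MCauchy_iff)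
  have "\<exists>n0. \<forall>m\<ge>n0. \<forall>n\<ge>n0. N (\<tau> m \<ominus> \<tau> n) < (1/2) ^ k" for k
    using \<tau> by (simp add: MCauchy_iff)
  then obtain n0 where n0: "\<And>k m n. \<lbrakk>m \<ge> n0 k; n \<ge> n0 k\<rbrakk> \<Longrightarrow> N (\<tau> m \<ominus> \<tau> n) < (1/2) ^ k"
    by metis
  \<comment> \<open>the summand \<open>k\<close> makes \<open>r\<close> strictly increasing, the sum puts \<open>r k\<close> beyond \<open>n0 k\<close>\<close>
  define r where "r k = k + (\<Sum>j\<le>k. n0 j)" for k
  have r_mono: "strict_mono r"
    by (rule strict_monoI_Suc) (simp add: r_def)
  have r_ge: "n0 k \<le> r k" for k
  proof -
    have "n0 k \<le> (\<Sum>j\<le>k. n0 j)"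
      by (rule member_le_sum) auto
    then show ?thesis by (simp add: r_def)
  qed
  have "n0 k \<le> r (Suc k)" for k
    using r_ge[of k] strict_monoD[OF r_mono, of k "Suc k"] by simp
  then have "N (\<tau> (r (Suc k)) \<ominus> \<tau> (r k)) \<le> (1/2) ^ k" for k
    using n0[of k "r (Suc k)" "r k"] r_ge[of k] by (simp add: less_imp_le)
  then obtain l where "l \<in> carrier M" "(\<lambda>n. N ((\<tau> \<circ> r) n \<ominus> l)) \<longlonglongrightarrow> 0"
    using assms[of "\<tau> \<circ> r"] in_carr by auto
  then have "limitin met.mtopology (\<tau> \<circ> r) l sequentially"
    using limitin_iff[of "\<tau> \<circ> r"] in_carr by auto
  then show "\<exists>x. limitin met.mtopology \<tau> x sequentially"
    using met.MCauchy_convergent_subsequence[OF \<tau> r_mono] by blast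
qed

text \<open>The tail after \<open>n\<close> is dominated by a geometric series with sum \<open>2 C / 2\<^sup>n\<close>; the induction
  proves the telescoped form of this bound.\<close>

lemma fast_Cauchy:
  assumes \<xi>: "\<And>n. \<xi> n \<in> carrier M" and "\<And>n. N (\<xi> (Suc n) \<ominus> \<xi> n) \<le> C * (1/2) ^ n" and "e > 0"
  shows "\<exists>n0. \<forall>m\<ge>n0. \<forall>n\<ge>n0. N (\<xi> m \<ominus> \<xi> n) < e"
proof -
  have C: "0 \<le> C"
    using assms(2)[of 0] N_nonneg[of "\<xi> 1 \<ominus> \<xi> 0"] \<xi> by simp
  have tail: "N (\<xi> (n + k) \<ominus> \<xi> n) \<le> 2 * C * (1/2) ^ n - 2 * C * (1/2) ^ (n + k)" for n k
  proof (induction k)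
    case 0
    have "\<xi> n \<ominus> \<xi> n = \<zero>"
      by (simp add: diff_eq_zero_iff \<xi>)
    then show ?case by simp
  next
    case (Suc k)
    have "N (\<xi> (n + Suc k) \<ominus> \<xi> n) \<le> N (\<xi> (Suc (n + k)) \<ominus> \<xi> (n + k)) + N (\<xi> (n + k) \<ominus> \<xi> n)"
      using N_diff_triangle[of "\<xi> (Suc (n + k))" "\<xi> (n + k)" "\<xi> n"] \<xi> by simp
    also have "\<dots> \<le> C * (1/2) ^ (n + k) + (2 * C * (1/2) ^ n - 2 * C * (1/2) ^ (n + k))"
      using Suc assms(2) by (intro add_mono) auto
    also have "\<dots> = 2 * C * (1/2) ^ n - 2 * C * (1/2) ^ (n + Suc k)"
      by simp
    finally show ?case .
  qed
  have tail': "N (\<xi> m \<ominus> \<xi> n) \<le> 2 * C * (1/2) ^ n" if "n \<le> m" for m n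
  proof -
    have "0 \<le> 2 * C * (1/2) ^ m" using C by simp
    then show ?thesis using tail[of n "m - n"] that by simp
  qed
  have "(\<lambda>n. 4 * C * (1/2) ^ n) \<longlonglongrightarrow> 4 * C * 0"
    by (intro tendsto_intros) simp
  then have "\<forall>\<^sub>F n in sequentially. 4 * C * (1/2) ^ n < e"
    using \<open>e > 0\<close> by (simp add: order_tendstoD)
  then obtain n0 where n0: "4 * C * (1/2) ^ n0 < e"
    by (auto simp: eventually_sequentially)
  show ?thesis
  proof (intro exI allI impI)
    fix m n assume mn: "m \<ge> n0" "n \<ge> n0"
    have "N (\<xi> m \<ominus> \<xi> n) \<le> N (\<xi> m \<ominus> \<xi> n0) + N (\<xi> n \<ominus> \<xi> n0)"
      using N_diff_triangle[of "\<xi> m" "\<xi> n0" "\<xi> n"] N_diff_commute[of "\<xi> n" "\<xi> n0"] \<xi> by simp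
    also have "\<dots> \<le> 4 * C * (1/2) ^ n0"
      using tail'[OF mn(1)] tail'[OF mn(2)] by simp
    finally show "N (\<xi> m \<ominus> \<xi> n) < e"
      using n0 by simp
  qed
qed

end

lemma tendsto_null_le_mult:
  fixes f g :: "'x \<Rightarrow> real"
  assumes "\<And>x. f x \<le> C * g x" "\<And>x. 0 \<le> f x" "(g \<longlongrightarrow> 0) F"
  shows "(f \<longlongrightarrow> 0) F"
proof (rule Lim_null_comparison)
  show "\<forall>\<^sub>F x in F. norm (f x) \<le> C * g x"
    using assms by (intro always_eventually) auto
  show "((\<lambda>x. C * g x) \<longlongrightarrow> 0) F"
    using assms(3) by (rule tendsto_mult_right_zero)
qed

text \<open>Completeness passes to images under maps with norm-controlled lifts: a fast Cauchy sequence is lifted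
  increment by increment to a fast Cauchy sequence upstairs, whose limit is mapped to the limit.  It is
  used for quotients and for the sum \<open>X\<^sub>0 + X\<^sub>1\<close>.\<close>

lemma mcomplete_image:
  fixes A :: "(complex, 'a, 'm) module_scheme" and B :: "(complex, 'b, 'n) module_scheme"
  assumes A: "cnormed A NA" and B: "cnormed B NB"
    and compl: "Metric_space.mcomplete (carrier A) (norm_dist (carrier A) (\<lambda>x y. x \<ominus>\<^bsub>A\<^esub> y) NA)"
    and Q: "linear_map A B Q" and bound: "\<And>a. a \<in> carrier A \<Longrightarrow> NB (Q a) \<le> C * NA a"
    and lift: "\<And>b. b \<in> carrier B \<Longrightarrow> \<exists>a\<in>carrier A. Q a = b \<and> NA a \<le> K * NB b"
  shows "Metric_space.mcomplete (carrier B) (norm_dist (carrier B) (\<lambda>x y. x \<ominus>\<^bsub>B\<^esub> y) NB)"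
proof -
  interpret A: cnormed A NA by fact
  interpret B: cnormed B NB by fact
  note Q' = linear_mapD[OF Q]
  show ?thesis
  proof (rule B.mcompleteI_fast)
    fix \<xi> assume \<xi>: "\<And>n. \<xi> n \<in> carrier B" and fast: "\<And>n. NB (\<xi> (Suc n) \<ominus>\<^bsub>B\<^esub> \<xi> n) \<le> (1/2) ^ n"
    define L where "L b = (SOME a. a \<in> carrier A \<and> Q a = b \<and> NA a \<le> K * NB b)" for b
    have L: "L b \<in> carrier A \<and> Q (L b) = b \<and> NA (L b) \<le> K * NB b" if "b \<in> carrier B" for b
      unfolding L_def using lift[OF that] by (rule_tac someI_ex) blast
    define \<tau> where "\<tau> = rec_nat (L (\<xi> 0)) (\<lambda>n t. t \<oplus>\<^bsub>A\<^esub> L (\<xi> (Suc n) \<ominus>\<^bsub>B\<^esub> \<xi> n))"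
    have \<tau>0: "\<tau> 0 = L (\<xi> 0)" and \<tau>Suc: "\<tau> (Suc n) = \<tau> n \<oplus>\<^bsub>A\<^esub> L (\<xi> (Suc n) \<ominus>\<^bsub>B\<^esub> \<xi> n)" for n
      by (simp_all add: \<tau>_def)
    have \<tau>: "\<tau> n \<in> carrier A \<and> Q (\<tau> n) = \<xi> n" for n
    proof (induction n)
      case 0
      then show ?case using L[OF \<xi>] by (simp add: \<tau>0)
    next
      case (Suc n)
      then show ?case
        using L[of "\<xi> (Suc n) \<ominus>\<^bsub>B\<^esub> \<xi> n"] \<xi>[of n] \<xi>[of "Suc n"]
        by (simp add: \<tau>Suc Q' B.diff_add_cancel)
    qed
    have "NA (\<tau> (Suc n) \<ominus>\<^bsub>A\<^esub> \<tau> n) \<le> \<bar>K\<bar> * (1/2) ^ n" for n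
    proof -
      have "\<tau> (Suc n) \<ominus>\<^bsub>A\<^esub> \<tau> n = L (\<xi> (Suc n) \<ominus>\<^bsub>B\<^esub> \<xi> n)"
        using \<tau>[of n] L[of "\<xi> (Suc n) \<ominus>\<^bsub>B\<^esub> \<xi> n"] \<xi> by (simp add: \<tau>Suc A.add_diff_cancel)
      then have "NA (\<tau> (Suc n) \<ominus>\<^bsub>A\<^esub> \<tau> n) \<le> K * NB (\<xi> (Suc n) \<ominus>\<^bsub>B\<^esub> \<xi> n)"
        using L[of "\<xi> (Suc n) \<ominus>\<^bsub>B\<^esub> \<xi> n"] \<xi> by simp
      also have "\<dots> \<le> \<bar>K\<bar> * NB (\<xi> (Suc n) \<ominus>\<^bsub>B\<^esub> \<xi> n)"
        by (intro mult_right_mono B.N_nonneg) (auto simp: \<xi>)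
      also have "\<dots> \<le> \<bar>K\<bar> * (1/2) ^ n"
        using fast by (intro mult_left_mono) auto
      finally show ?thesis .
    qed
    then have "\<exists>n0. \<forall>m\<ge>n0. \<forall>n\<ge>n0. NA (\<tau> m \<ominus>\<^bsub>A\<^esub> \<tau> n) < e" if "e > 0" for e
      by (rule A.fast_Cauchy[OF conjunct1[OF \<tau>] _ that])
    then obtain l where l: "l \<in> carrier A" "(\<lambda>n. NA (\<tau> n \<ominus>\<^bsub>A\<^esub> l)) \<longlonglongrightarrow> 0"
      by (rule A.mcompleteD[OF compl conjunct1[OF \<tau>]])
    have "NB (\<xi> n \<ominus>\<^bsub>B\<^esub> Q l) \<le> C * NA (\<tau> n \<ominus>\<^bsub>A\<^esub> l)" for n
      using bound[of "\<tau> n \<ominus>\<^bsub>A\<^esub> l"] \<tau>[of n] l(1)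
        linear_map_diff[OF A.cmodule_axioms B.cmodule_axioms Q, of "\<tau> n" l] by simp
    moreover have "0 \<le> NB (\<xi> n \<ominus>\<^bsub>B\<^esub> Q l)" for n
      using Q'(1)[OF l(1)] \<xi> by (simp add: B.N_nonneg)
    ultimately have "(\<lambda>n. NB (\<xi> n \<ominus>\<^bsub>B\<^esub> Q l)) \<longlonglongrightarrow> 0"
      using l(2) by (rule tendsto_null_le_mult)
    then show "\<exists>l\<in>carrier B. (\<lambda>n. NB (\<xi> n \<ominus>\<^bsub>B\<^esub> l)) \<longlonglongrightarrow> 0"
      using Q'(1) l(1) by blast
  qed
qed

section \<open>Norms of scalar matrices\<close>

lemma L2_set_le_1_entry:
  fixes m :: nat
  assumes "L2_set (\<lambda>j. cmod (v j)) {..<m} \<le> 1" "j < m"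
  shows "cmod (v j) \<le> 1"
  using member_le_L2_set[of "{..<m}" j "\<lambda>j. cmod (v j)"] assms by simp

lemma cmat_norm_bdd:
  fixes n m :: nat
  shows "bdd_above {L2_set (\<lambda>i. cmod (\<Sum>j<m. \<alpha> i j * v j)) {..<n} | v. L2_set (\<lambda>j. cmod (v j)) {..<m} \<le> 1}"
proof (rule bdd_aboveI)
  fix x assume "x \<in> {L2_set (\<lambda>i. cmod (\<Sum>j<m. \<alpha> i j * v j)) {..<n} | v. L2_set (\<lambda>j. cmod (v j)) {..<m} \<le> 1}"
  then obtain v where x: "x = L2_set (\<lambda>i. cmod (\<Sum>j<m. \<alpha> i j * v j)) {..<n}"
    and v: "L2_set (\<lambda>j. cmod (v j)) {..<m} \<le> 1" by blast
  have "x \<le> (\<Sum>i<n. cmod (\<Sum>j<m. \<alpha> i j * v j))"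
    unfolding x by (rule L2_set_le_sum) simp
  also have "\<dots> \<le> (\<Sum>i<n. \<Sum>j<m. cmod (\<alpha> i j))"
  proof (intro sum_mono order_trans[OF norm_sum])
    fix i j assume "j \<in> {..<m}"
    then have "cmod (v j) \<le> 1" using L2_set_le_1_entry[OF v] by simp
    then show "cmod (\<alpha> i j * v j) \<le> cmod (\<alpha> i j)"
      by (simp add: norm_mult mult_left_le)
  qed
  finally show "x \<le> (\<Sum>i<n. \<Sum>j<m. cmod (\<alpha> i j))" .
qed

lemma cmat_norm_nonneg: "0 \<le> cmat_norm n m \<alpha>"
  unfolding cmat_norm_def
proof (rule cSup_upper[OF _ cmat_norm_bdd])
  have "0 = L2_set (\<lambda>i. cmod (\<Sum>j<m. \<alpha> i j * 0)) {..<n}" "L2_set (\<lambda>j. cmod 0) {..<m} \<le> 1"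
    by (simp_all add: L2_set_def)
  then show "0 \<in> {L2_set (\<lambda>i. cmod (\<Sum>j<m. \<alpha> i j * v j)) {..<n} | v. L2_set (\<lambda>j. cmod (v j)) {..<m} \<le> 1}"
    by (intro CollectI exI[of _ "\<lambda>_. 0"] conjI) auto
qed

lemma cmat_norm_leI:
  assumes "\<And>v. L2_set (\<lambda>j. cmod (v j)) {..<m} \<le> 1 \<Longrightarrow> L2_set (\<lambda>i. cmod (\<Sum>j<m. \<alpha> i j * v j)) {..<n} \<le> C"
  shows "cmat_norm n m \<alpha> \<le> C"
  unfolding cmat_norm_def
proof (rule cSup_least)
  show "{L2_set (\<lambda>i. cmod (\<Sum>j<m. \<alpha> i j * v j)) {..<n} | v. L2_set (\<lambda>j. cmod (v j)) {..<m} \<le> 1} \<noteq> {}"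
    by (auto intro!: exI[of _ "\<lambda>_. 0"] simp: L2_set_def)
qed (use assms in blast)

lemma L2_set_reindex: "inj_on p A \<Longrightarrow> L2_set (\<lambda>i. f (p i)) A = L2_set f (p ` A)"
  by (simp add: L2_set_def sum.reindex)

text \<open>The two matrices restrict a vector to the coordinates \<open>p i\<close>, and extend a vector by zero from
  these coordinates.\<close>

lemma cmat_norm_select:
  assumes p: "inj_on p {..<n}" "\<And>i. i < n \<Longrightarrow> p i < m"
  shows "cmat_norm n m (\<lambda>i k. if k = p i then 1 else 0) \<le> 1"
    and "cmat_norm m n (\<lambda>k i. if k = p i then 1 else 0) \<le> 1"
proof -
  show "cmat_norm n m (\<lambda>i k. if k = p i then 1 else 0) \<le> 1"
  proof (rule cmat_norm_leI)
    fix v :: "nat \<Rightarrow> complex" assume v: "L2_set (\<lambda>j. cmod (v j)) {..<m} \<le> 1"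
    have "(\<Sum>j<m. (if j = p i then 1 else 0) * v j) = v (p i)" if "i < n" for i
      using p(2)[OF that] by (simp add: if_distrib[of "\<lambda>x. x * _"] cong: if_cong)
    then have "L2_set (\<lambda>i. cmod (\<Sum>j<m. (if j = p i then 1 else 0) * v j)) {..<n} = L2_set (\<lambda>i. cmod (v (p i))) {..<n}"
      by (intro L2_set_cong) auto
    also have "\<dots> = L2_set (\<lambda>i. cmod (v i)) (p ` {..<n})"
      using p(1) by (rule L2_set_reindex)
    also have "\<dots> \<le> L2_set (\<lambda>i. cmod (v i)) {..<m}"
      unfolding L2_set_def using p(2) by (intro real_sqrt_le_mono sum_mono2) auto
    finally show "L2_set (\<lambda>i. cmod (\<Sum>j<m. (if j = p i then 1 else 0) * v j)) {..<n} \<le> 1"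
      using v by linarith
  qed
  show "cmat_norm m n (\<lambda>k i. if k = p i then 1 else 0) \<le> 1"
  proof (rule cmat_norm_leI)
    fix v :: "nat \<Rightarrow> complex" assume v: "L2_set (\<lambda>j. cmod (v j)) {..<n} \<le> 1"
    define w where "w = (\<lambda>k. cmod (\<Sum>i<n. (if k = p i then 1 else 0) * v i))"
    have w: "w (p i) = cmod (v i)" if "i < n" for i
    proof -
      have "(\<Sum>j<n. (if p i = p j then 1 else 0) * v j) = (\<Sum>j<n. (if j = i then v j else 0))"
        using that p(1) by (intro sum.cong) (auto simp: inj_on_def)
      then show ?thesis using that by (simp add: w_def)
    qed
    have w0: "w k = 0" if "k \<notin> p ` {..<n}" for k
      using that by (auto simp: w_def intro!: sum.neutral)
    have "L2_set w {..<m} = L2_set w (p ` {..<n})"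
      unfolding L2_set_def using p(2) w0 by (intro arg_cong[of _ _ sqrt] sum.mono_neutral_right) auto
    also have "\<dots> = L2_set (\<lambda>i. w (p i)) {..<n}"
      using L2_set_reindex[OF p(1), of w] by simp
    also have "\<dots> = L2_set (\<lambda>i. cmod (v i)) {..<n}"
      by (intro L2_set_cong) (auto simp: w)
    finally show "L2_set (\<lambda>k. cmod (\<Sum>i<n. (if k = p i then 1 else 0) * v i)) {..<m} \<le> 1"
      using v by (simp add: w_def)
  qed
qed

section \<open>Matrix norms\<close>

text \<open>Ruan's axioms for a family of norms on the matrices over a module, without definiteness.  In
  this form they pass to pullbacks along linear maps and to suprema.\<close>

definition matrix_seminorm :: "'a opspace \<Rightarrow> (nat \<Rightarrow> (nat \<Rightarrow> nat \<Rightarrow> 'a) \<Rightarrow> real) \<Rightarrow> bool" where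
  "matrix_seminorm X M \<longleftrightarrow>
     (\<forall>n>0. \<forall>x y. (\<forall>i<n. \<forall>j<n. x i j = y i j) \<longrightarrow> M n x = M n y) \<and>
     (\<forall>n>0. \<forall>c. \<forall>x\<in>mats X n. M n (\<lambda>i j. c \<odot>\<^bsub>X\<^esub> x i j) = cmod c * M n x) \<and>
     (\<forall>n>0. \<forall>x\<in>mats X n. \<forall>y\<in>mats X n. M n (\<lambda>i j. x i j \<oplus>\<^bsub>X\<^esub> y i j) \<le> M n x + M n y) \<and>
     (\<forall>n>0. \<forall>m>0. \<forall>\<alpha> \<beta>. \<forall>x\<in>mats X m.
        M n (mat_sandwich X m \<alpha> x \<beta>) \<le> cmat_norm n m \<alpha> * M m x * cmat_norm m n \<beta>) \<and>
     (\<forall>m>0. \<forall>n>0. \<forall>x\<in>mats X m. \<forall>y\<in>mats X n. M (m + n) (mat_diag X m n x y) = max (M m x) (M n y))"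

lemma matrix_seminormI:
  assumes "\<And>n x y. \<lbrakk>n > 0; \<forall>i<n. \<forall>j<n. x i j = y i j\<rbrakk> \<Longrightarrow> M n x = M n y"
    and "\<And>n c x. \<lbrakk>n > 0; x \<in> mats X n\<rbrakk> \<Longrightarrow> M n (\<lambda>i j. c \<odot>\<^bsub>X\<^esub> x i j) = cmod c * M n x"
    and "\<And>n x y. \<lbrakk>n > 0; x \<in> mats X n; y \<in> mats X n\<rbrakk> \<Longrightarrow> M n (\<lambda>i j. x i j \<oplus>\<^bsub>X\<^esub> y i j) \<le> M n x + M n y"
    and "\<And>n m \<alpha> \<beta> x. \<lbrakk>n > 0; m > 0; x \<in> mats X m\<rbrakk> \<Longrightarrow>
      M n (mat_sandwich X m \<alpha> x \<beta>) \<le> cmat_norm n m \<alpha> * M m x * cmat_norm m n \<beta>"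
    and "\<And>m n x y. \<lbrakk>m > 0; n > 0; x \<in> mats X m; y \<in> mats X n\<rbrakk> \<Longrightarrow>
      M (m + n) (mat_diag X m n x y) = max (M m x) (M n y)"
  shows "matrix_seminorm X M"
  unfolding matrix_seminorm_def
  apply (intro conjI allI impI ballI)
      apply (rule assms(1); assumption)
     apply (rule assms(2); assumption)
    apply (rule assms(3); assumption)
   apply (rule assms(4); assumption)
  apply (rule assms(5); assumption)
  done

lemma matrix_seminormD:
  assumes "matrix_seminorm X M"
  shows "\<lbrakk>n > 0; \<And>i j. \<lbrakk>i < n; j < n\<rbrakk> \<Longrightarrow> x i j = y i j\<rbrakk> \<Longrightarrow> M n x = M n y"
    and "\<lbrakk>n > 0; x \<in> mats X n\<rbrakk> \<Longrightarrow> M n (\<lambda>i j. c \<odot>\<^bsub>X\<^esub> x i j) = cmod c * M n x"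
    and "\<lbrakk>n > 0; x \<in> mats X n; y \<in> mats X n\<rbrakk> \<Longrightarrow> M n (\<lambda>i j. x i j \<oplus>\<^bsub>X\<^esub> y i j) \<le> M n x + M n y"
    and "\<lbrakk>n > 0; m > 0; x \<in> mats X m\<rbrakk> \<Longrightarrow>
      M n (mat_sandwich X m \<alpha> x \<beta>) \<le> cmat_norm n m \<alpha> * M m x * cmat_norm m n \<beta>"
    and "\<lbrakk>m > 0; n > 0; x \<in> mats X m; y \<in> mats X n\<rbrakk> \<Longrightarrow>
      M (m + n) (mat_diag X m n x y) = max (M m x) (M n y)"
  using assms unfolding matrix_seminorm_def by meson+

locale matnormed = cmodule X for X :: "'a opspace" (structure) +
  assumes seminorm: "matrix_seminorm X (mnorm X)"
    and definite: "\<lbrakk>n > 0; x \<in> mats X n; mnorm X n x = 0; i < n; j < n\<rbrakk> \<Longrightarrow> x i j = \<zero>"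
begin

lemmas mnorm_cong = matrix_seminormD(1)[OF seminorm]
lemmas mnorm_smult = matrix_seminormD(2)[OF seminorm]
lemmas mnorm_triangle = matrix_seminormD(3)[OF seminorm]
lemmas mnorm_sandwich = matrix_seminormD(4)[OF seminorm]
lemmas mnorm_diag = matrix_seminormD(5)[OF seminorm]

lemma matsD: "\<lbrakk>x \<in> mats X n; i < n; j < n\<rbrakk> \<Longrightarrow> x i j \<in> carrier X"
  by (simp add: mats_def)

lemma mnorm_zero: "n > 0 \<Longrightarrow> mnorm X n (\<lambda>i j. \<zero>) = 0"
  using mnorm_smult[of n "\<lambda>i j. \<zero>" 0] by (simp add: mats_def)

lemma mnorm_zero_iff:
  assumes "n > 0" "x \<in> mats X n"
  shows "mnorm X n x = 0 \<longleftrightarrow> (\<forall>i<n. \<forall>j<n. x i j = \<zero>)"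
  using definite[OF assms] mnorm_cong[OF assms(1), of x "\<lambda>i j. \<zero>"] mnorm_zero[OF assms(1)] by auto

lemma mnorm_nonneg:
  assumes n: "n > 0" and x: "x \<in> mats X n"
  shows "0 \<le> mnorm X n x"
proof -
  have y: "(\<lambda>i j. (-1) \<odot> x i j) \<in> mats X n"
    using x by (simp add: mats_def)
  have "mnorm X n (\<lambda>i j. x i j \<oplus> (-1) \<odot> x i j) \<le> mnorm X n x + mnorm X n (\<lambda>i j. (-1) \<odot> x i j)"
    by (rule mnorm_triangle[OF n x y])
  also have "mnorm X n (\<lambda>i j. x i j \<oplus> (-1) \<odot> x i j) = mnorm X n (\<lambda>i j. \<zero>)"
    using x n by (intro mnorm_cong) (simp_all add: mats_def smult_neg_1 M.r_neg)
  finally show ?thesis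
    using mnorm_smult[OF n x, of "-1"] by (simp add: mnorm_zero[OF n])
qed

lemma const_mats: "x \<in> carrier X \<Longrightarrow> (\<lambda>i j. x) \<in> mats X n"
  by (simp add: mats_def)

sublocale cnormed X "vnorm X"
proof
  fix x y c
  assume x: "x \<in> carrier X"
  show "vnorm X x = 0 \<longleftrightarrow> x = \<zero>"
    using mnorm_zero_iff[OF _ const_mats[OF x], of 1] by (auto simp: vnorm_def)
  show "vnorm X (c \<odot> x) = cmod c * vnorm X x"
    using mnorm_smult[OF _ const_mats[OF x], of 1] by (simp add: vnorm_def)
  assume y: "y \<in> carrier X"
  show "vnorm X (x \<oplus> y) \<le> vnorm X x + vnorm X y"
    using mnorm_triangle[OF _ const_mats[OF x] const_mats[OF y], of 1] by (simp add: vnorm_def)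
qed

lemma op_dist_eq: "op_dist X = ndist"
  by (simp add: op_dist_def)

lemma op_topology_eq: "op_topology X = met.mtopology"
  by (simp add: op_topology_def op_dist_eq)

lemma mat_sandwich_select:
  assumes x: "x \<in> mats X m" and ij: "p i < m" "q j < m"
  shows "mat_sandwich X m (\<lambda>i k. if k = p i then 1 else 0) x (\<lambda>l j. if l = q j then 1 else 0) i j = x (p i) (q j)"
proof -
  have "mat_sandwich X m (\<lambda>i k. if k = p i then 1 else 0) x (\<lambda>l j. if l = q j then 1 else 0) i j
      = (\<Oplus>kl\<in>{..<m}\<times>{..<m}. if (p i, q j) = kl then (case kl of (k, l) \<Rightarrow> x k l) else \<zero>)"
    unfolding mat_sandwich_def using x
    by (intro M.finsum_cong') (auto simp: mats_def split: if_splits)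
  also have "\<dots> = (case (p i, q j) of (k, l) \<Rightarrow> x k l)"
    using x ij by (intro M.finsum_singleton) (auto simp: mats_def)
  finally show ?thesis by simp
qed

text \<open>Extracting a submatrix is a sandwich between selection matrices, which are contractions.\<close>

lemma mnorm_submatrix_le:
  assumes "n > 0" "m > 0" "x \<in> mats X m"
    and p: "inj_on p {..<n}" "\<And>i. i < n \<Longrightarrow> p i < m"
    and q: "inj_on q {..<n}" "\<And>i. i < n \<Longrightarrow> q i < m"
  shows "mnorm X n (\<lambda>i j. x (p i) (q j)) \<le> mnorm X m x"
proof -
  let ?A = "\<lambda>i k. if k = p i then 1 else (0::complex)" and ?B = "\<lambda>l j. if l = q j then 1 else (0::complex)"
  have "mnorm X n (\<lambda>i j. x (p i) (q j)) = mnorm X n (mat_sandwich X m ?A x ?B)"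
    using assms by (intro mnorm_cong) (simp_all add: mat_sandwich_select)
  also have "\<dots> \<le> cmat_norm n m ?A * mnorm X m x * cmat_norm m n ?B"
    by (rule mnorm_sandwich[OF assms(1-3)])
  also have "\<dots> \<le> 1 * mnorm X m x * 1"
    using cmat_norm_select(1)[OF p] cmat_norm_select(2)[OF q] mnorm_nonneg[OF assms(2,3)]
    by (intro mult_mono mult_nonneg_nonneg cmat_norm_nonneg) auto
  finally show ?thesis by simp
qed

lemma vnorm_entry_le:
  assumes "n > 0" "x \<in> mats X n" "i < n" "j < n"
  shows "vnorm X (x i j) \<le> mnorm X n x"
  using mnorm_submatrix_le[of 1 n x "\<lambda>_. i" "\<lambda>_. j"] assms by (simp add: vnorm_def inj_on_def)

text \<open>A matrix is the sum of its entries, each put into its place by a sandwich between a column and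
  a row of norm one.  So the matrix norms are bounded over families with bounded entries.\<close>

lemma mnorm_le_sum_entries:
  assumes n: "n > 0" and x: "x \<in> mats X n"
  shows "mnorm X n x \<le> (\<Sum>(a, b)\<in>{..<n}\<times>{..<n}. vnorm X (x a b))"
proof -
  have single: "mnorm X n (\<lambda>i j. if i = a \<and> j = b then y else \<zero>) \<le> vnorm X y"
    if y: "y \<in> carrier X" and ab: "a < n" "b < n" for a b y
  proof -
    let ?A = "\<lambda>i k. if i = a then 1 else (0::complex)" and ?B = "\<lambda>l j. if j = b then 1 else (0::complex)"
    have place: "mat_sandwich X 1 ?A (\<lambda>i j. y) ?B i j = (if i = a \<and> j = b then y else \<zero>)" for i j
    proof -
      have "{..<1::nat} \<times> {..<1::nat} = {(0, 0)}" by auto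
      then show ?thesis
        using y by (simp add: mat_sandwich_def)
    qed
    have "mnorm X n (\<lambda>i j. if i = a \<and> j = b then y else \<zero>) = mnorm X n (mat_sandwich X 1 ?A (\<lambda>i j. y) ?B)"
      by (intro mnorm_cong[OF n]) (rule place[symmetric])
    also have "\<dots> \<le> cmat_norm n 1 ?A * mnorm X 1 (\<lambda>i j. y) * cmat_norm 1 n ?B"
      by (rule mnorm_sandwich[OF n _ const_mats[OF y]]) simp
    also have "\<dots> \<le> 1 * mnorm X 1 (\<lambda>i j. y) * 1"
      using cmat_norm_select(2)[of "\<lambda>_. a" 1 n] cmat_norm_select(1)[of "\<lambda>_. b" 1 n] ab
        mnorm_nonneg[OF _ const_mats[OF y], of 1]
      by (intro mult_mono mult_nonneg_nonneg cmat_norm_nonneg) (auto simp: inj_on_def)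
    finally show ?thesis by (simp add: vnorm_def)
  qed
  have "mnorm X n (\<lambda>i j. if (i, j) \<in> S then x i j else \<zero>) \<le> (\<Sum>(a, b)\<in>S. vnorm X (x a b))"
    if "finite S" "S \<subseteq> {..<n}\<times>{..<n}" for S
    using that
  proof (induction S rule: finite_induct)
    case empty
    then show ?case by (simp add: mnorm_zero[OF n])
  next
    case (insert ab S)
    obtain a b where ab: "ab = (a, b)" by (cases ab)
    with insert have abn: "a < n" "b < n" by auto
    have "mnorm X n (\<lambda>i j. if (i, j) \<in> insert ab S then x i j else \<zero>)
        = mnorm X n (\<lambda>i j. (if i = a \<and> j = b then x a b else \<zero>) \<oplus> (if (i, j) \<in> S then x i j else \<zero>))"
      using x insert(2) ab by (intro mnorm_cong[OF n]) (auto simp: mats_def)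
    also have "\<dots> \<le> mnorm X n (\<lambda>i j. if i = a \<and> j = b then x a b else \<zero>)
        + mnorm X n (\<lambda>i j. if (i, j) \<in> S then x i j else \<zero>)"
      using x abn by (intro mnorm_triangle[OF n]) (auto simp: mats_def)
    also have "\<dots> \<le> vnorm X (x a b) + (\<Sum>(a, b)\<in>S. vnorm X (x a b))"
      using insert single[OF matsD[OF x abn] abn] by (intro add_mono) auto
    finally show ?case
      using insert(1,2) ab by simp
  qed
  from this[of "{..<n}\<times>{..<n}"]
  have "mnorm X n (\<lambda>i j. if (i, j) \<in> {..<n}\<times>{..<n} then x i j else \<zero>)
     \<le> (\<Sum>(a, b)\<in>{..<n}\<times>{..<n}. vnorm X (x a b))" by simp
  then show ?thesis
    using mnorm_cong[OF n, of x "\<lambda>i j. if (i, j) \<in> {..<n}\<times>{..<n} then x i j else \<zero>"] by simp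
qed

end

lemma operator_space_iff:
  "operator_space X \<longleftrightarrow> matnormed X \<and> Metric_space.mcomplete (carrier X) (op_dist X)"
proof
  assume X: "operator_space X"
  have "cmodule X" using X by (simp add: operator_space_def cmodule_def)
  moreover have "matrix_seminorm X (mnorm X)"
    using X by (simp add: operator_space_def matrix_seminorm_def)
  moreover have "x i j = \<zero>\<^bsub>X\<^esub>" if "n > 0" "x \<in> mats X n" "mnorm X n x = 0" "i < n" "j < n" for n x i j
    using X that by (simp add: operator_space_def)
  moreover have "Metric_space.mcomplete (carrier X) (op_dist X)"
    using X by (simp add: operator_space_def)
  ultimately show "matnormed X \<and> Metric_space.mcomplete (carrier X) (op_dist X)"
    by (intro conjI matnormed.intro matnormed_axioms.intro)
next
  assume X: "matnormed X \<and> Metric_space.mcomplete (carrier X) (op_dist X)"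
  then interpret matnormed X by blast
  show "operator_space X"
    using X seminorm mnorm_zero_iff cmodule_axioms[unfolded cmodule_def]
    unfolding operator_space_def matrix_seminorm_def by simp
qed

locale opspace =
  fixes X :: "'a opspace" (structure)
  assumes operator_space: "operator_space X"
begin

sublocale matnormed X
  using operator_space by (simp add: operator_space_iff)

lemma mcomplete: "met.mcomplete"
  using operator_space by (simp add: operator_space_iff op_dist_eq)

end

lemma linear_map_sandwich:
  assumes "cmodule X" "cmodule Y" "linear_map X Y T" "x \<in> mats X m"
  shows "T (mat_sandwich X m \<alpha> x \<beta> i j) = mat_sandwich Y m \<alpha> (\<lambda>k l. T (x k l)) \<beta> i j"
proof -
  interpret X: cmodule X by fact
  interpret Y: cmodule Y by fact
  note T = linear_mapD[OF assms(3)]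
  have "T (mat_sandwich X m \<alpha> x \<beta> i j)
    = finsum Y (\<lambda>kl. T ((\<lambda>(k, l). (\<alpha> i k * \<beta> l j) \<odot>\<^bsub>X\<^esub> x k l) kl)) ({..<m} \<times> {..<m})"
    unfolding mat_sandwich_def using assms(4)
    by (intro linear_map_finsum[OF assms(1-3)]) (auto simp: mats_def)
  also have "\<dots> = mat_sandwich Y m \<alpha> (\<lambda>k l. T (x k l)) \<beta> i j"
    unfolding mat_sandwich_def using assms(4)
    by (intro Y.finsum_cong') (auto simp: mats_def T)
  finally show ?thesis .
qed

lemma mat_diag_mats:
  assumes "cmodule X" "x \<in> mats X m" "y \<in> mats X n"
  shows "mat_diag X m n x y \<in> mats X (m + n)"
proof -
  interpret X: cmodule X by fact
  show ?thesis
    using assms(2,3) by (auto simp: mat_diag_def mats_def)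
qed

lemma mat_sandwich_mats:
  assumes "cmodule X" "x \<in> mats X m"
  shows "mat_sandwich X m \<alpha> x \<beta> \<in> mats X n"
proof -
  interpret X: cmodule X by fact
  show ?thesis
    using assms(2) by (auto simp: mat_sandwich_def mats_def intro!: X.finsum_closed)
qed


text \<open>Linear maps commute with the operations on matrices that occur in the axioms.\<close>

lemma matrix_seminorm_pullback:
  assumes Z: "cmodule Z" and X: "matnormed X" and T: "linear_map Z X T"
  shows "matrix_seminorm Z (\<lambda>n w. mnorm X n (\<lambda>i j. T (w i j)))"
proof -
  interpret X: matnormed X by fact
  interpret Z: cmodule Z by fact
  note T' = linear_mapD[OF T]
  have TM: "(\<lambda>i j. T (w i j)) \<in> mats X n" if "w \<in> mats Z n" for w n
    using that by (simp add: mats_def T')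
  show ?thesis
  proof (rule matrix_seminormI)
    fix n x y assume n: "(n::nat) > 0" and eq: "\<forall>i<n. \<forall>j<n. x i j = (y i j :: 'a)"
    show "mnorm X n (\<lambda>i j. T (x i j)) = mnorm X n (\<lambda>i j. T (y i j))"
      using eq by (intro X.mnorm_cong[OF n]) simp
  next
    fix n c x assume n: "n > 0" and x: "x \<in> mats Z n"
    have "mnorm X n (\<lambda>i j. T (c \<odot>\<^bsub>Z\<^esub> x i j)) = mnorm X n (\<lambda>i j. c \<odot>\<^bsub>X\<^esub> T (x i j))"
      using x by (intro X.mnorm_cong[OF n]) (simp add: mats_def T')
    then show "mnorm X n (\<lambda>i j. T (c \<odot>\<^bsub>Z\<^esub> x i j)) = cmod c * mnorm X n (\<lambda>i j. T (x i j))"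
      by (simp only: X.mnorm_smult[OF n TM[OF x]])
  next
    fix n x y assume n: "n > 0" and x: "x \<in> mats Z n" and y: "y \<in> mats Z n"
    have "mnorm X n (\<lambda>i j. T (x i j \<oplus>\<^bsub>Z\<^esub> y i j)) = mnorm X n (\<lambda>i j. T (x i j) \<oplus>\<^bsub>X\<^esub> T (y i j))"
      using x y by (intro X.mnorm_cong[OF n]) (simp add: mats_def T')
    then show "mnorm X n (\<lambda>i j. T (x i j \<oplus>\<^bsub>Z\<^esub> y i j)) \<le> mnorm X n (\<lambda>i j. T (x i j)) + mnorm X n (\<lambda>i j. T (y i j))"
      by (simp only: X.mnorm_triangle[OF n TM[OF x] TM[OF y]])
  next
    fix n m \<alpha> \<beta> x assume n: "(n::nat) > 0" and m: "m > 0" and x: "x \<in> mats Z m"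
    show "mnorm X n (\<lambda>i j. T (mat_sandwich Z m \<alpha> x \<beta> i j))
        \<le> cmat_norm n m \<alpha> * mnorm X m (\<lambda>i j. T (x i j)) * cmat_norm m n \<beta>"
      unfolding linear_map_sandwich[OF Z X.cmodule_axioms T x] by (rule X.mnorm_sandwich[OF n m TM[OF x]])
  next
    fix m n x y assume m: "m > 0" and n: "n > 0" and x: "x \<in> mats Z m" and y: "y \<in> mats Z n"
    have "(\<lambda>i j. T (mat_diag Z m n x y i j)) = mat_diag X m n (\<lambda>i j. T (x i j)) (\<lambda>i j. T (y i j))"
      by (auto simp: mat_diag_def fun_eq_iff T')
    then show "mnorm X (m + n) (\<lambda>i j. T (mat_diag Z m n x y i j))
        = max (mnorm X m (\<lambda>i j. T (x i j))) (mnorm X n (\<lambda>i j. T (y i j)))"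
      by (simp only: X.mnorm_diag[OF m n TM[OF x] TM[OF y]])
  qed
qed

text \<open>\<open>N\<close> is the pointwise supremum of the family \<open>\<M>\<close>; describing it by upper-bound properties covers
  the maximum in direct sums as well as suprema over real parameters.  Each axiom is an inequality
  between suprema.  The identity for block-diagonal matrices holds since suprema commute with maxima.\<close>

lemma matrix_seminorm_Sup:
  assumes Z: "cmodule Z" and ne: "\<M> \<noteq> {}" and sem: "\<And>M. M \<in> \<M> \<Longrightarrow> matrix_seminorm Z M"
    and cong: "\<And>n x y. \<lbrakk>n > 0; \<forall>i<n. \<forall>j<n. x i j = y i j\<rbrakk> \<Longrightarrow> N n x = N n y"
    and ge: "\<And>n M w. \<lbrakk>n > 0; w \<in> mats Z n; M \<in> \<M>\<rbrakk> \<Longrightarrow> M n w \<le> N n w"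
    and le: "\<And>n w b. \<lbrakk>n > 0; w \<in> mats Z n; \<And>M. M \<in> \<M> \<Longrightarrow> M n w \<le> b\<rbrakk> \<Longrightarrow> N n w \<le> b"
  shows "matrix_seminorm Z N"
proof -
  interpret Z: cmodule Z by fact
  note D = matrix_seminormD[OF sem]
  show ?thesis
  proof (rule matrix_seminormI[OF cong])
    fix n c x assume n: "n > 0" and x: "x \<in> mats Z n"
    then have cx: "(\<lambda>i j. c \<odot>\<^bsub>Z\<^esub> x i j) \<in> mats Z n" by (simp add: mats_def)
    show "N n (\<lambda>i j. c \<odot>\<^bsub>Z\<^esub> x i j) = cmod c * N n x"
    proof (rule antisym)
      show "N n (\<lambda>i j. c \<odot>\<^bsub>Z\<^esub> x i j) \<le> cmod c * N n x"
        by (rule le[OF n cx]) (simp only: D(2)[OF _ n x] ge[OF n x] mult_left_mono norm_ge_zero)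
      show "cmod c * N n x \<le> N n (\<lambda>i j. c \<odot>\<^bsub>Z\<^esub> x i j)"
      proof (cases "c = 0")
        case True
        obtain M where "M \<in> \<M>" using ne by blast
        then show ?thesis using ge[OF n cx] D(2)[OF _ n x, of M c] True by force
      next
        case False
        then have "N n x \<le> N n (\<lambda>i j. c \<odot>\<^bsub>Z\<^esub> x i j) / cmod c"
          using ge[OF n cx] by (intro le[OF n x]) (simp add: D(2)[OF _ n x] pos_le_divide_eq mult.commute)
        then show ?thesis using False by (simp add: pos_le_divide_eq mult.commute)
      qed
    qed
  next
    fix n x y assume n: "n > 0" and x: "x \<in> mats Z n" and y: "y \<in> mats Z n"
    show "N n (\<lambda>i j. x i j \<oplus>\<^bsub>Z\<^esub> y i j) \<le> N n x + N n y"
    proof (rule le[OF n])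
      show "(\<lambda>i j. x i j \<oplus>\<^bsub>Z\<^esub> y i j) \<in> mats Z n" using x y by (simp add: mats_def)
      show "M n (\<lambda>i j. x i j \<oplus>\<^bsub>Z\<^esub> y i j) \<le> N n x + N n y" if "M \<in> \<M>" for M
        using D(3)[OF that n x y] ge[OF n x that] ge[OF n y that] by linarith
    qed
  next
    fix n m \<alpha> \<beta> x assume n: "(n::nat) > 0" and m: "m > 0" and x: "x \<in> mats Z m"
    show "N n (mat_sandwich Z m \<alpha> x \<beta>) \<le> cmat_norm n m \<alpha> * N m x * cmat_norm m n \<beta>"
    proof (rule le[OF n mat_sandwich_mats[OF Z x]])
      fix M assume M: "M \<in> \<M>"
      have "cmat_norm n m \<alpha> * M m x * cmat_norm m n \<beta> \<le> cmat_norm n m \<alpha> * N m x * cmat_norm m n \<beta>"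
        by (intro mult_right_mono mult_left_mono cmat_norm_nonneg ge[OF m x M])
      then show "M n (mat_sandwich Z m \<alpha> x \<beta>) \<le> cmat_norm n m \<alpha> * N m x * cmat_norm m n \<beta>"
        using D(4)[OF M n m x] by (rule order_trans[rotated])
    qed
  next
    fix m n x y assume m: "m > 0" and n: "n > 0" and x: "x \<in> mats Z m" and y: "y \<in> mats Z n"
    have mn: "m + n > 0" using m by simp
    note d = mat_diag_mats[OF Z x y]
    have dM: "M (m + n) (mat_diag Z m n x y) = max (M m x) (M n y)" if "M \<in> \<M>" for M
      by (rule D(5)[OF that m n x y])
    show "N (m + n) (mat_diag Z m n x y) = max (N m x) (N n y)"
    proof (rule antisym)
      show "N (m + n) (mat_diag Z m n x y) \<le> max (N m x) (N n y)"
      proof (rule le[OF mn d])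
        show "M (m + n) (mat_diag Z m n x y) \<le> max (N m x) (N n y)" if "M \<in> \<M>" for M
          unfolding dM[OF that] by (intro max.mono ge m n x y that)
      qed
      have "max (M m x) (M n y) \<le> N (m + n) (mat_diag Z m n x y)" if "M \<in> \<M>" for M
        using ge[OF mn d that] unfolding dM[OF that] .
      then show "max (N m x) (N n y) \<le> N (m + n) (mat_diag Z m n x y)"
        by (intro max.boundedI le m n x y) simp_all
    qed
  qed
qed

section \<open>Metric quotients\<close>

text \<open>The norms of \<open>Y\<close> are the quotient norms along \<open>Q\<close>.  This covers coset spaces, with \<open>Q\<close> the coset
  map, and quotients that are realised on the range of a map.\<close>

definition metric_quotient :: "'a opspace \<Rightarrow> 'b opspace \<Rightarrow> ('a \<Rightarrow> 'b) \<Rightarrow> bool" where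
  "metric_quotient X Y Q \<longleftrightarrow> linear_map X Y Q \<and> Q ` carrier X = carrier Y \<and>
     (\<forall>n>0. \<forall>y. mnorm Y n y = Inf {mnorm X n x | x. x \<in> mats X n \<and> (\<forall>i<n. \<forall>j<n. Q (x i j) = y i j)})"

locale metric_quotient_map = opspace X for X :: "'a opspace" +
  fixes Y :: "'b opspace" and Q :: "'a \<Rightarrow> 'b"
  assumes quot: "metric_quotient X Y Q"
begin

lemma linear: "linear_map X Y Q"
  using quot by (simp add: metric_quotient_def)

lemmas Q = linear_mapD[OF linear]

lemma onto: "Q ` carrier X = carrier Y"
  using quot by (simp add: metric_quotient_def)

sublocale Y: cmodule Y
  using cmodule_image[OF cmodule_axioms linear onto] .

lemma mnorm_Inf:
  "n > 0 \<Longrightarrow> mnorm Y n y = Inf {mnorm X n x | x. x \<in> mats X n \<and> (\<forall>i<n. \<forall>j<n. Q (x i j) = y i j)}"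
  using quot by (simp add: metric_quotient_def)

lemma exists_lift:
  assumes "y \<in> mats Y n"
  obtains x where "x \<in> mats X n" "\<And>i j. \<lbrakk>i < n; j < n\<rbrakk> \<Longrightarrow> Q (x i j) = y i j"
proof
  let ?x = "\<lambda>i j. inv_into (carrier X) Q (y i j)"
  show "?x \<in> mats X n" "\<And>i j. \<lbrakk>i < n; j < n\<rbrakk> \<Longrightarrow> Q (?x i j) = y i j"
    using assms onto by (auto simp: mats_def inv_into_into f_inv_into_f)
qed

lemma mnorm_quotient_le:
  assumes n: "n > 0" and "x \<in> mats X n" "\<And>i j. \<lbrakk>i < n; j < n\<rbrakk> \<Longrightarrow> Q (x i j) = y i j"
  shows "mnorm Y n y \<le> mnorm X n x"
  unfolding mnorm_Inf[OF n]
proof (rule cInf_lower)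
  show "mnorm X n x \<in> {mnorm X n x | x. x \<in> mats X n \<and> (\<forall>i<n. \<forall>j<n. Q (x i j) = y i j)}"
    using assms by blast
  show "bdd_below {mnorm X n x | x. x \<in> mats X n \<and> (\<forall>i<n. \<forall>j<n. Q (x i j) = y i j)}"
    by (rule bdd_belowI[of _ 0]) (auto intro: mnorm_nonneg[OF n])
qed

lemma mnorm_quotient_ge:
  assumes n: "n > 0" and y: "y \<in> mats Y n"
    and "\<And>x. \<lbrakk>x \<in> mats X n; \<And>i j. \<lbrakk>i < n; j < n\<rbrakk> \<Longrightarrow> Q (x i j) = y i j\<rbrakk> \<Longrightarrow> b \<le> mnorm X n x"
  shows "b \<le> mnorm Y n y"
  unfolding mnorm_Inf[OF n]
proof (rule cInf_greatest)
  show "{mnorm X n x | x. x \<in> mats X n \<and> (\<forall>i<n. \<forall>j<n. Q (x i j) = y i j)} \<noteq> {}"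
    using exists_lift[OF y] by (smt (verit) Collect_empty_eq)
qed (use assms(3) in blast)

text \<open>The form in which maps out of quotients are bounded: an estimate is checked on all lifts.\<close>

lemma mnorm_quotient_ge_scaled:
  assumes n: "n > 0" and y: "y \<in> mats Y n" and C: "0 \<le> C"
    and le: "\<And>x. \<lbrakk>x \<in> mats X n; \<And>i j. \<lbrakk>i < n; j < n\<rbrakk> \<Longrightarrow> Q (x i j) = y i j\<rbrakk> \<Longrightarrow> b \<le> C * mnorm X n x"
  shows "b \<le> C * mnorm Y n y"
proof (cases "C = 0")
  case True
  obtain x where "x \<in> mats X n" "\<And>i j. \<lbrakk>i < n; j < n\<rbrakk> \<Longrightarrow> Q (x i j) = y i j"
    by (rule exists_lift[OF y]) blast
  then show ?thesis using le[of x] True by simp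
next
  case False
  with C have "0 < C" by simp
  then have "b / C \<le> mnorm Y n y"
    using le by (intro mnorm_quotient_ge[OF n y]) (simp add: pos_divide_le_eq mult.commute)
  then show ?thesis
    using \<open>0 < C\<close> by (simp add: pos_divide_le_eq mult.commute)
qed

lemma exists_lift_less:
  assumes n: "n > 0" and y: "y \<in> mats Y n" and b: "mnorm Y n y < b"
  obtains x where "x \<in> mats X n" "\<And>i j. \<lbrakk>i < n; j < n\<rbrakk> \<Longrightarrow> Q (x i j) = y i j" "mnorm X n x < b"
proof -
  have "\<exists>x. x \<in> mats X n \<and> (\<forall>i<n. \<forall>j<n. Q (x i j) = y i j) \<and> mnorm X n x < b"
  proof (rule ccontr)
    assume "\<not> ?thesis"
    then have "b \<le> mnorm Y n y"
      by (intro mnorm_quotient_ge[OF n y]) (meson not_le)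
    then show False using b by simp
  qed
  then show thesis using that by blast
qed

lemma mnorm_quotient_nonneg: "\<lbrakk>n > 0; y \<in> mats Y n\<rbrakk> \<Longrightarrow> 0 \<le> mnorm Y n y"
  by (rule mnorm_quotient_ge) (auto intro: mnorm_nonneg)

lemma mnorm_quotient_zero: "n > 0 \<Longrightarrow> (\<And>i j. \<lbrakk>i < n; j < n\<rbrakk> \<Longrightarrow> y i j = \<zero>\<^bsub>Y\<^esub>) \<Longrightarrow> mnorm Y n y = 0"
  using mnorm_quotient_le[of n "\<lambda>i j. \<zero>\<^bsub>X\<^esub>" y] mnorm_quotient_nonneg[of n y]
  by (simp add: mats_def Q mnorm_zero)

end

text \<open>The inequalities among Ruan's axioms hold for lifts and pass to the infimum.  For the
  block-diagonal identity, lifts of the blocks give one inequality, and the diagonal blocks of a lift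
  of the whole matrix give the other.  Closedness of the kernel yields definiteness: two lifts of a matrix of norm zero differ
  by kernel elements, and lifts of small norm exist, so every lift is approximated by kernel elements.\<close>

lemma operator_space_quotient:
  assumes X: "operator_space X" and quot: "metric_quotient X Y Q"
    and closed: "\<And>x. \<lbrakk>x \<in> carrier X;
      \<And>e. e > 0 \<Longrightarrow> \<exists>k\<in>carrier X. Q k = \<zero>\<^bsub>Y\<^esub> \<and> vnorm X (x \<ominus>\<^bsub>X\<^esub> k) < e\<rbrakk> \<Longrightarrow> Q x = \<zero>\<^bsub>Y\<^esub>"
  shows "operator_space Y"
proof -
  interpret metric_quotient_map X Y Q
    by unfold_locales (fact X, fact quot)
  have cong: "mnorm Y n x = mnorm Y n y" if "n > 0" "\<forall>i<n. \<forall>j<n. x i j = y i j" for n x y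
    using that(2) by (simp add: mnorm_Inf[OF that(1)])
  have zero: "y i j = \<zero>\<^bsub>Y\<^esub>" if n: "n > 0" and y: "y \<in> mats Y n" and 0: "mnorm Y n y = 0" and ij: "i < n" "j < n" for n y i j
    proof -
      obtain x where x: "x \<in> mats X n" "\<And>i j. \<lbrakk>i < n; j < n\<rbrakk> \<Longrightarrow> Q (x i j) = y i j"
        by (rule exists_lift[OF y]) blast
      have xij: "x i j \<in> carrier X" using x ij by (simp add: mats_def)
      have "Q (x i j) = \<zero>\<^bsub>Y\<^esub>"
      proof (rule closed[OF xij])
        fix e :: real assume "e > 0"
        then have "mnorm Y n y < e" using 0 by simp
        then obtain x' where x': "x' \<in> mats X n" "\<And>i j. \<lbrakk>i < n; j < n\<rbrakk> \<Longrightarrow> Q (x' i j) = y i j" "mnorm X n x' < e"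
          by (rule exists_lift_less[OF n y]) blast
        have x'ij: "x' i j \<in> carrier X" using x' ij by (simp add: mats_def)
        have "Q (x i j \<ominus>\<^bsub>X\<^esub> x' i j) = \<zero>\<^bsub>Y\<^esub>"
          using linear_map_diff[OF cmodule_axioms Y.cmodule_axioms linear xij x'ij] x(2)[OF ij] x'(2)[OF ij]
            y Y.diff_eq_zero_iff[of "y i j" "y i j"] ij by (simp add: mats_def)
        moreover have "x i j \<ominus>\<^bsub>X\<^esub> (x i j \<ominus>\<^bsub>X\<^esub> x' i j) = x' i j"
          using xij x'ij by (simp add: M.minus_eq M.minus_add M.minus_minus M.r_neg1 M.r_neg2)
        moreover have "vnorm X (x' i j) < e"
          using vnorm_entry_le[OF n x'(1) ij] x'(3) by simp
        ultimately show "\<exists>k\<in>carrier X. Q k = \<zero>\<^bsub>Y\<^esub> \<and> vnorm X (x i j \<ominus>\<^bsub>X\<^esub> k) < e"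
          using xij x'ij by (intro bexI[of _ "x i j \<ominus>\<^bsub>X\<^esub> x' i j"]) auto
      qed
      then show "y i j = \<zero>\<^bsub>Y\<^esub>" using x(2)[OF ij] by simp
    qed
  have smult_le: "mnorm Y n (\<lambda>i j. c \<odot>\<^bsub>Y\<^esub> y i j) \<le> cmod c * mnorm Y n y" if n: "n > 0" and y: "y \<in> mats Y n" for n c y
  proof (rule mnorm_quotient_ge_scaled[OF n y])
    fix x assume x: "x \<in> mats X n" "\<And>i j. \<lbrakk>i < n; j < n\<rbrakk> \<Longrightarrow> Q (x i j) = y i j"
    have "mnorm Y n (\<lambda>i j. c \<odot>\<^bsub>Y\<^esub> y i j) \<le> mnorm X n (\<lambda>i j. c \<odot>\<^bsub>X\<^esub> x i j)"
      using x by (intro mnorm_quotient_le[OF n]) (auto simp: mats_def Q)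
    then show "mnorm Y n (\<lambda>i j. c \<odot>\<^bsub>Y\<^esub> y i j) \<le> cmod c * mnorm X n x"
      by (simp add: mnorm_smult[OF n x(1)])
  qed simp
  have smult: "mnorm Y n (\<lambda>i j. c \<odot>\<^bsub>Y\<^esub> y i j) = cmod c * mnorm Y n y" if n: "n > 0" and y: "y \<in> mats Y n" for n c y
  proof (cases "c = 0")
    case True
    then show ?thesis
      using y by (simp add: mnorm_quotient_zero[OF n] mats_def)
  next
    case False
    have cy: "(\<lambda>i j. c \<odot>\<^bsub>Y\<^esub> y i j) \<in> mats Y n"
      using y by (simp add: mats_def)
    have "mnorm Y n y = mnorm Y n (\<lambda>i j. inverse c \<odot>\<^bsub>Y\<^esub> (c \<odot>\<^bsub>Y\<^esub> y i j))"
      using y False by (intro cong[OF n]) (simp add: mats_def Y.smult_mult[symmetric])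
    also have "\<dots> \<le> cmod (inverse c) * mnorm Y n (\<lambda>i j. c \<odot>\<^bsub>Y\<^esub> y i j)"
      by (rule smult_le[OF n cy])
    finally have "cmod c * mnorm Y n y \<le> cmod c * (cmod (inverse c) * mnorm Y n (\<lambda>i j. c \<odot>\<^bsub>Y\<^esub> y i j))"
      by (rule mult_left_mono) simp
    also have "\<dots> = mnorm Y n (\<lambda>i j. c \<odot>\<^bsub>Y\<^esub> y i j)"
      using False by (simp add: norm_inverse)
    finally show ?thesis
      using smult_le[OF n y, of c] by simp
  qed
  have triangle: "mnorm Y n (\<lambda>i j. y i j \<oplus>\<^bsub>Y\<^esub> z i j) \<le> mnorm Y n y + mnorm Y n z"
    if n: "n > 0" and y: "y \<in> mats Y n" and z: "z \<in> mats Y n" for n y z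
  proof -
    have "mnorm Y n (\<lambda>i j. y i j \<oplus>\<^bsub>Y\<^esub> z i j) - mnorm X n a \<le> mnorm Y n z"
      if a: "a \<in> mats X n" "\<And>i j. \<lbrakk>i < n; j < n\<rbrakk> \<Longrightarrow> Q (a i j) = y i j" for a
    proof (rule mnorm_quotient_ge[OF n z])
      fix b assume b: "b \<in> mats X n" "\<And>i j. \<lbrakk>i < n; j < n\<rbrakk> \<Longrightarrow> Q (b i j) = z i j"
      have "mnorm Y n (\<lambda>i j. y i j \<oplus>\<^bsub>Y\<^esub> z i j) \<le> mnorm X n (\<lambda>i j. a i j \<oplus>\<^bsub>X\<^esub> b i j)"
        using a b by (intro mnorm_quotient_le[OF n]) (auto simp: mats_def Q)
      then show "mnorm Y n (\<lambda>i j. y i j \<oplus>\<^bsub>Y\<^esub> z i j) - mnorm X n a \<le> mnorm X n b"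
        using mnorm_triangle[OF n a(1) b(1)] by simp
    qed
    then have "mnorm Y n (\<lambda>i j. y i j \<oplus>\<^bsub>Y\<^esub> z i j) - mnorm Y n z \<le> mnorm Y n y"
      by (intro mnorm_quotient_ge[OF n y]) (simp add: algebra_simps)
    then show ?thesis by simp
  qed
  have sandwich: "mnorm Y n (mat_sandwich Y m \<alpha> y \<beta>) \<le> cmat_norm n m \<alpha> * mnorm Y m y * cmat_norm m n \<beta>"
    if n: "n > 0" and m: "m > 0" and y: "y \<in> mats Y m" for n m \<alpha> \<beta> y
  proof -
    have "mnorm Y n (mat_sandwich Y m \<alpha> y \<beta>) \<le> (cmat_norm n m \<alpha> * cmat_norm m n \<beta>) * mnorm Y m y"
    proof (rule mnorm_quotient_ge_scaled[OF m y])
      fix x assume x: "x \<in> mats X m" "\<And>i j. \<lbrakk>i < m; j < m\<rbrakk> \<Longrightarrow> Q (x i j) = y i j"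
      have "mnorm Y n (mat_sandwich Y m \<alpha> y \<beta>) \<le> mnorm X n (mat_sandwich X m \<alpha> x \<beta>)"
      proof (rule mnorm_quotient_le[OF n])
        show "mat_sandwich X m \<alpha> x \<beta> \<in> mats X n"
          by (rule mat_sandwich_mats[OF cmodule_axioms x(1)])
        fix i j
        have "Q (mat_sandwich X m \<alpha> x \<beta> i j) = mat_sandwich Y m \<alpha> (\<lambda>k l. Q (x k l)) \<beta> i j"
          by (rule linear_map_sandwich[OF cmodule_axioms Y.cmodule_axioms linear x(1)])
        also have "\<dots> = mat_sandwich Y m \<alpha> y \<beta> i j"
          unfolding mat_sandwich_def using y x(2)
          by (intro Y.finsum_cong') (auto simp: mats_def)
        finally show "Q (mat_sandwich X m \<alpha> x \<beta> i j) = mat_sandwich Y m \<alpha> y \<beta> i j" .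
      qed
      also have "\<dots> \<le> cmat_norm n m \<alpha> * mnorm X m x * cmat_norm m n \<beta>"
        by (rule mnorm_sandwich[OF n m x(1)])
      finally show "mnorm Y n (mat_sandwich Y m \<alpha> y \<beta>) \<le> (cmat_norm n m \<alpha> * cmat_norm m n \<beta>) * mnorm X m x"
        by (simp add: ac_simps)
    qed (intro mult_nonneg_nonneg cmat_norm_nonneg)
    then show ?thesis by (simp add: ac_simps)
  qed
  have diag: "mnorm Y (m + n) (mat_diag Y m n y z) = max (mnorm Y m y) (mnorm Y n z)"
    if m: "m > 0" and n: "n > 0" and y: "y \<in> mats Y m" and z: "z \<in> mats Y n" for m n y z
  proof (rule antisym)
    have mn: "m + n > 0" using n by simp
    have d: "mat_diag Y m n y z \<in> mats Y (m + n)"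
      by (rule mat_diag_mats[OF Y.cmodule_axioms y z])
    show "mnorm Y (m + n) (mat_diag Y m n y z) \<le> max (mnorm Y m y) (mnorm Y n z)"
    proof (rule dense_ge)
      fix c assume "max (mnorm Y m y) (mnorm Y n z) < c"
      then have c: "mnorm Y m y < c" "mnorm Y n z < c" by auto
      obtain a where a: "a \<in> mats X m" "\<And>i j. \<lbrakk>i < m; j < m\<rbrakk> \<Longrightarrow> Q (a i j) = y i j" "mnorm X m a < c"
        by (rule exists_lift_less[OF m y c(1)]) blast
      obtain b where b: "b \<in> mats X n" "\<And>i j. \<lbrakk>i < n; j < n\<rbrakk> \<Longrightarrow> Q (b i j) = z i j" "mnorm X n b < c"
        by (rule exists_lift_less[OF n z c(2)]) blast
      have "mnorm Y (m + n) (mat_diag Y m n y z) \<le> mnorm X (m + n) (mat_diag X m n a b)"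
        using a b by (intro mnorm_quotient_le[OF mn] mat_diag_mats[OF cmodule_axioms])
          (auto simp: mat_diag_def Q)
      also have "\<dots> < c"
        using mnorm_diag[OF m n a(1) b(1)] a b by simp
      finally show "mnorm Y (m + n) (mat_diag Y m n y z) \<le> c" by simp
    qed
    have "mnorm Y m y \<le> mnorm Y (m + n) (mat_diag Y m n y z)"
    proof (rule mnorm_quotient_ge[OF mn d])
      fix x assume x: "x \<in> mats X (m + n)"
        "\<And>i j. \<lbrakk>i < m + n; j < m + n\<rbrakk> \<Longrightarrow> Q (x i j) = mat_diag Y m n y z i j"
      have "mnorm Y m y \<le> mnorm X m (\<lambda>i j. x i j)"
        using x by (intro mnorm_quotient_le[OF m]) (auto simp: mats_def mat_diag_def)
      also have "\<dots> \<le> mnorm X (m + n) x"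
        using mnorm_submatrix_le[OF m mn x(1), of "\<lambda>i. i" "\<lambda>i. i"] by simp
      finally show "mnorm Y m y \<le> mnorm X (m + n) x" .
    qed
    moreover have "mnorm Y n z \<le> mnorm Y (m + n) (mat_diag Y m n y z)"
    proof (rule mnorm_quotient_ge[OF mn d])
      fix x assume x: "x \<in> mats X (m + n)"
        "\<And>i j. \<lbrakk>i < m + n; j < m + n\<rbrakk> \<Longrightarrow> Q (x i j) = mat_diag Y m n y z i j"
      have "mnorm Y n z \<le> mnorm X n (\<lambda>i j. x (m + i) (m + j))"
        using x by (intro mnorm_quotient_le[OF n]) (auto simp: mats_def mat_diag_def)
      also have "\<dots> \<le> mnorm X (m + n) x"
        using mnorm_submatrix_le[OF n mn x(1), of "\<lambda>i. m + i" "\<lambda>i. m + i"] by simp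
      finally show "mnorm Y n z \<le> mnorm X (m + n) x" .
    qed
    ultimately show "max (mnorm Y m y) (mnorm Y n z) \<le> mnorm Y (m + n) (mat_diag Y m n y z)"
      by simp
  qed
  interpret nY: matnormed Y
    by (intro matnormed.intro matnormed_axioms.intro Y.cmodule_axioms matrix_seminormI cong smult triangle sandwich diag zero)
  have "Metric_space.mcomplete (carrier Y) (op_dist Y)"
    unfolding op_dist_def
  proof (rule mcomplete_image[OF cnormed_axioms nY.cnormed_axioms mcomplete linear])
    show "vnorm Y (Q a) \<le> 1 * vnorm X a" if "a \<in> carrier X" for a
      using mnorm_quotient_le[OF _ const_mats[OF that], of 1 "\<lambda>i j. Q a"] by (simp add: vnorm_def)
    show "\<exists>a\<in>carrier X. Q a = b \<and> vnorm X a \<le> 2 * vnorm Y b" if b: "b \<in> carrier Y" for b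
    proof (cases "b = \<zero>\<^bsub>Y\<^esub>")
      case True
      then show ?thesis using Q(2) by (intro bexI[of _ "\<zero>\<^bsub>X\<^esub>"]) auto
    next
      case False
      then have "vnorm Y b < 2 * vnorm Y b"
        using nY.N_nonneg[OF b] nY.N_zero_iff[OF b] by simp
      then have "mnorm Y 1 (\<lambda>i j. b) < 2 * vnorm Y b" by (simp add: vnorm_def)
      then obtain x where "x \<in> mats X 1" "\<And>i j. \<lbrakk>i < 1; j < 1\<rbrakk> \<Longrightarrow> Q (x i j) = b" "mnorm X 1 x < 2 * vnorm Y b"
        by (rule exists_lift_less[OF zero_less_one nY.const_mats[OF b]]) blast
      moreover have "mnorm X 1 x = vnorm X (x 0 0)"
        unfolding vnorm_def by (intro mnorm_cong) auto
      ultimately show ?thesis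
        by (intro bexI[of _ "x 0 0"]) (auto simp: mats_def)
    qed
  qed
  then show ?thesis
    using nY.matnormed_axioms by (simp add: operator_space_iff)
qed

section \<open>Quotients by submodules and on ranges\<close>

context cmodule
begin

lemma csubmoduleI:
  assumes "S \<subseteq> carrier M" "\<zero> \<in> S" "\<And>x y. \<lbrakk>x \<in> S; y \<in> S\<rbrakk> \<Longrightarrow> x \<oplus> y \<in> S"
    and "\<And>c x. x \<in> S \<Longrightarrow> c \<odot> x \<in> S"
  shows "submodule S complex_ring M"
proof (rule submoduleI)
  fix a assume "a \<in> S"
  then show "\<ominus> a \<in> S"
    using assms(1) assms(4)[of a "-1"] by (auto simp: smult_neg_1)
qed (use assms in auto)

lemma csubmoduleD:
  assumes "submodule S complex_ring M"
  shows "S \<subseteq> carrier M" "\<zero> \<in> S" "\<lbrakk>x \<in> S; y \<in> S\<rbrakk> \<Longrightarrow> x \<oplus> y \<in> S" "x \<in> S \<Longrightarrow> c \<odot> x \<in> S"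
proof -
  show *: "S \<subseteq> carrier M" "\<lbrakk>x \<in> S; y \<in> S\<rbrakk> \<Longrightarrow> x \<oplus> y \<in> S" "x \<in> S \<Longrightarrow> c \<odot> x \<in> S" for x y c
    using submoduleE[OF assms] by auto
  obtain x where "x \<in> S" using submoduleE(2)[OF assms] by auto
  then have "0 \<odot> x \<in> S" "x \<in> carrier M" using *(1) by (auto intro: *(3))
  then show "\<zero> \<in> S" by simp
qed

lemma csubmodule_abelian_subgroup:
  assumes "submodule S complex_ring M"
  shows "abelian_subgroup S M"
proof (rule abelian_subgroupI3)
  show "additive_subgroup S M"
    using submodule.axioms(1)[OF assms] by (rule additive_subgroupI)
qed (rule M.abelian_group_axioms)

lemma mem_coset_iff:
  assumes "submodule S complex_ring M" "x \<in> carrier M"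
  shows "y \<in> S +> x \<longleftrightarrow> y \<in> carrier M \<and> y \<ominus> x \<in> S"
proof -
  interpret abelian_subgroup S M by (rule csubmodule_abelian_subgroup[OF assms(1)])
  show ?thesis
    using a_rcos_module[OF assms(2), of y] a_elemrcos_carrier[OF assms(2), of y]
    by (auto simp: M.minus_eq)
qed

lemma coset_eq_iff:
  assumes "submodule S complex_ring M" "x \<in> carrier M" "y \<in> carrier M"
  shows "S +> x = S +> y \<longleftrightarrow> x \<ominus> y \<in> S"
proof -
  interpret abelian_subgroup S M by (rule csubmodule_abelian_subgroup[OF assms(1)])
  show ?thesis
    using a_repr_independence'[of x y] a_repr_independenceD[of x y] assms mem_coset_iff[OF assms(1,3), of x]
    by metis
qed

lemma coset_eq_self_iff:
  assumes "submodule S complex_ring M" "x \<in> carrier M"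
  shows "S +> x = S \<longleftrightarrow> x \<in> S"
proof -
  interpret abelian_subgroup S M by (rule csubmodule_abelian_subgroup[OF assms(1)])
  show ?thesis
    using a_rcos_self[OF assms(2)] a_rcos_const[of x] by auto
qed

end

lemma linear_map_coset:
  assumes X: "cmodule X" and S: "submodule S complex_ring X"
  shows "linear_map X (op_quotient X S) (\<lambda>x. S +>\<^bsub>X\<^esub> x)"
proof -
  interpret cmodule X by fact
  interpret S: abelian_subgroup S X by (rule csubmodule_abelian_subgroup[OF S])
  have smult: "(\<Union>y\<in>S +>\<^bsub>X\<^esub> x. S +>\<^bsub>X\<^esub> (c \<odot>\<^bsub>X\<^esub> y)) = S +>\<^bsub>X\<^esub> (c \<odot>\<^bsub>X\<^esub> x)"
    if x: "x \<in> carrier X" for c x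
  proof -
    have "S +>\<^bsub>X\<^esub> (c \<odot>\<^bsub>X\<^esub> y) = S +>\<^bsub>X\<^esub> (c \<odot>\<^bsub>X\<^esub> x)" if "y \<in> S +>\<^bsub>X\<^esub> x" for y
    proof -
      have y: "y \<in> carrier X" "y \<ominus>\<^bsub>X\<^esub> x \<in> S"
        using that mem_coset_iff[OF S x] by auto
      have "c \<odot>\<^bsub>X\<^esub> (y \<ominus>\<^bsub>X\<^esub> x) = c \<odot>\<^bsub>X\<^esub> y \<ominus>\<^bsub>X\<^esub> c \<odot>\<^bsub>X\<^esub> x"
        using x y(1) by (simp add: minus_conv_smult smult_distrib smult_mult[symmetric])
      then show ?thesis
        using csubmoduleD(4)[OF S y(2), of c] x y(1) by (simp add: coset_eq_iff[OF S])
    qed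
    moreover have "x \<in> S +>\<^bsub>X\<^esub> x"
      using x by (rule S.a_rcos_self)
    ultimately show ?thesis by blast
  qed
  show ?thesis
    unfolding linear_map_def op_quotient_def
    using csubmoduleD[OF S] smult S.a_rcos_sum coset_eq_self_iff[OF S]
    by (auto intro!: a_rcosetsI)
qed

lemma metric_quotient_op_quotient:
  assumes X: "cmodule X" and S: "submodule S complex_ring X"
  shows "metric_quotient X (op_quotient X S) (\<lambda>x. S +>\<^bsub>X\<^esub> x)"
  unfolding metric_quotient_def
proof (intro conjI allI impI linear_map_coset[OF X S])
  show "(\<lambda>x. S +>\<^bsub>X\<^esub> x) ` carrier X = carrier (op_quotient X S)"
    by (auto simp: op_quotient_def A_RCOSETS_def')
qed (simp add: op_quotient_def)

text \<open>The coset of \<open>x\<close> by the kernel is the fibre over \<open>\<Phi> x\<close>, so the infimum over representatives of a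
  coset is the infimum over preimages of a value.\<close>

lemma metric_quotient_on_range:
  fixes X :: "'a opspace" and W :: "(complex, 'b) module"
  assumes X: "cmodule X" and W: "cmodule W" and \<Phi>: "linear_map X W \<Phi>"
  shows "metric_quotient X (quotient_on_range X W \<Phi>) \<Phi>"
proof -
  interpret cmodule X by fact
  interpret W: cmodule W by fact
  note F = linear_mapD[OF \<Phi>]
  let ?S = "a_kernel X W \<Phi>"
  have S: "submodule ?S complex_ring X"
    by (rule csubmoduleI) (auto simp: a_kernel_def' F)
  have coset: "?S +>\<^bsub>X\<^esub> x = {x' \<in> carrier X. \<Phi> x' = y} \<longleftrightarrow> \<Phi> x = y" if x: "x \<in> carrier X" for x y
  proof -
    have "x' \<ominus>\<^bsub>X\<^esub> x \<in> ?S \<longleftrightarrow> \<Phi> x' = \<Phi> x" if "x' \<in> carrier X" for x'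
      using linear_map_diff[OF X W \<Phi> that x] x that W.diff_eq_zero_iff[OF F(1)[OF that] F(1)[OF x]]
      by (simp add: a_kernel_def')
    then have "x' \<in> ?S +>\<^bsub>X\<^esub> x \<longleftrightarrow> x' \<in> carrier X \<and> \<Phi> x' = \<Phi> x" for x'
      unfolding mem_coset_iff[OF S x] by blast
    then have *: "?S +>\<^bsub>X\<^esub> x = {x' \<in> carrier X. \<Phi> x' = \<Phi> x}" by blast
    show ?thesis
    proof
      assume "?S +>\<^bsub>X\<^esub> x = {x' \<in> carrier X. \<Phi> x' = y}"
      then have "x \<in> {x' \<in> carrier X. \<Phi> x' = y}" using * x by blast
      then show "\<Phi> x = y" by simp
    qed (use * in simp)
  qed
  have "{mnorm X n x | x. x \<in> mats X n \<and> (\<forall>i<n. \<forall>j<n. ?S +>\<^bsub>X\<^esub> x i j = {x \<in> carrier X. \<Phi> x = y i j})}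
      = {mnorm X n x | x. x \<in> mats X n \<and> (\<forall>i<n. \<forall>j<n. \<Phi> (x i j) = y i j)}" for n y
    by (intro Collect_cong ex_cong1 conj_cong refl) (simp add: coset mats_def)
  then show ?thesis
    using F unfolding metric_quotient_def linear_map_def quotient_on_range_def op_quotient_def
    by simp
qed

lemma submodule_kernel:
  assumes "cmodule X" "cmodule Y" "linear_map X Y T"
  shows "submodule (a_kernel X Y T) complex_ring X"
proof -
  interpret X: cmodule X by fact
  interpret Y: cmodule Y by fact
  show ?thesis
    by (rule X.csubmoduleI) (auto simp: a_kernel_def' linear_mapD[OF assms(3)])
qed

lemma image_kernel_coset:
  assumes X: "cmodule X" and Y: "cmodule Y" and T: "linear_map X Y T" and x: "x \<in> carrier X"
  shows "T ` (a_kernel X Y T +>\<^bsub>X\<^esub> x) = {T x}"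
proof -
  interpret X: cmodule X by fact
  interpret Y: cmodule Y by fact
  note T' = linear_mapD[OF T]
  note S = submodule_kernel[OF X Y T]
  have "T y = T x" if "y \<in> a_kernel X Y T +>\<^bsub>X\<^esub> x" for y
  proof -
    have y: "y \<in> carrier X" "T (y \<ominus>\<^bsub>X\<^esub> x) = \<zero>\<^bsub>Y\<^esub>"
      using that X.mem_coset_iff[OF S x, of y] by (auto simp: a_kernel_def')
    then show ?thesis
      using linear_map_diff[OF X Y T y(1) x] Y.diff_eq_zero_iff[OF T'(1)[OF y(1)] T'(1)[OF x]] by simp
  qed
  moreover have "x \<in> a_kernel X Y T +>\<^bsub>X\<^esub> x"
    using X.mem_coset_iff[OF S x, of x] x X.diff_eq_zero_iff[OF x x] X.csubmoduleD(2)[OF S] by simp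
  ultimately show ?thesis by blast
qed

section \<open>Direct sums\<close>

lemma op_sum_simps [simp]:
  "carrier (op_sum X Y) = carrier X \<times> carrier Y"
  "\<zero>\<^bsub>op_sum X Y\<^esub> = (\<zero>\<^bsub>X\<^esub>, \<zero>\<^bsub>Y\<^esub>)"
  "u \<oplus>\<^bsub>op_sum X Y\<^esub> v = (fst u \<oplus>\<^bsub>X\<^esub> fst v, snd u \<oplus>\<^bsub>Y\<^esub> snd v)"
  "c \<odot>\<^bsub>op_sum X Y\<^esub> u = (c \<odot>\<^bsub>X\<^esub> fst u, c \<odot>\<^bsub>Y\<^esub> snd u)"
  "mnorm (op_sum X Y) n w = max (mnorm X n (\<lambda>i j. fst (w i j))) (mnorm Y n (\<lambda>i j. snd (w i j)))"
  by (simp_all add: op_sum_def)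

lemma vnorm_op_sum: "vnorm (op_sum X Y) u = max (vnorm X (fst u)) (vnorm Y (snd u))"
  by (simp add: vnorm_def)

lemma cmodule_op_sum:
  assumes "cmodule X" "cmodule Y"
  shows "cmodule (op_sum X Y)"
proof -
  interpret X: cmodule X by fact
  interpret Y: cmodule Y by fact
  have "abelian_group (op_sum X Y)"
  proof (rule abelian_groupI)
    fix x assume x: "x \<in> carrier (op_sum X Y)"
    show "\<exists>y\<in>carrier (op_sum X Y). y \<oplus>\<^bsub>op_sum X Y\<^esub> x = \<zero>\<^bsub>op_sum X Y\<^esub>"
      using x by (intro bexI[of _ "(\<ominus>\<^bsub>X\<^esub> fst x, \<ominus>\<^bsub>Y\<^esub> snd x)"]) (auto simp: X.l_neg Y.l_neg)
  qed (auto simp: X.a_ac Y.a_ac)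
  then show ?thesis
    unfolding cmodule_def
    by (intro Module.moduleI cring_complex_ring)
      (auto simp: X.smult_add Y.smult_add X.smult_distrib Y.smult_distrib X.smult_mult Y.smult_mult)
qed

lemma linear_map_fst: "linear_map (op_sum X Y) X fst" and linear_map_snd: "linear_map (op_sum X Y) Y snd"
  by (auto simp: linear_map_def)

lemma operator_space_op_sum:
  assumes "operator_space X" "operator_space Y"
  shows "operator_space (op_sum X Y)"
proof -
  interpret X: opspace X by unfold_locales fact
  interpret Y: opspace Y by unfold_locales fact
  let ?Z = "op_sum X Y"
  interpret Z: cmodule ?Z
    by (rule cmodule_op_sum[OF X.cmodule_axioms Y.cmodule_axioms])
  have F: "(\<lambda>i j. fst (w i j)) \<in> mats X n" and S: "(\<lambda>i j. snd (w i j)) \<in> mats Y n" if "w \<in> mats ?Z n" for w n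
    using that by (force simp: mats_def)+
  interpret nZ: matnormed ?Z
  proof
    show "matrix_seminorm ?Z (mnorm ?Z)"
    proof (rule matrix_seminorm_Sup[OF Z.cmodule_axioms,
          of "{\<lambda>n w. mnorm X n (\<lambda>i j. fst (w i j)), \<lambda>n w. mnorm Y n (\<lambda>i j. snd (w i j))}"])
      fix M assume "M \<in> {\<lambda>n w. mnorm X n (\<lambda>i j. fst (w i j)), \<lambda>n w. mnorm Y n (\<lambda>i j. snd (w i j))}"
      then show "matrix_seminorm ?Z M"
        using matrix_seminorm_pullback[OF Z.cmodule_axioms X.matnormed_axioms linear_map_fst]
          matrix_seminorm_pullback[OF Z.cmodule_axioms Y.matnormed_axioms linear_map_snd] by blast
    next
      fix n x y assume n: "(n::nat) > 0" and eq: "\<forall>i<n. \<forall>j<n. x i j = (y i j :: 'a \<times> 'b)"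
      have "mnorm X n (\<lambda>i j. fst (x i j)) = mnorm X n (\<lambda>i j. fst (y i j))"
        "mnorm Y n (\<lambda>i j. snd (x i j)) = mnorm Y n (\<lambda>i j. snd (y i j))"
        using eq by (auto intro!: X.mnorm_cong[OF n] Y.mnorm_cong[OF n])
      then show "mnorm ?Z n x = mnorm ?Z n y" by simp
    qed auto
    fix n w i j assume n: "n > 0" and w: "w \<in> mats ?Z n" and 0: "mnorm ?Z n w = 0" and ij: "i < n" "j < n"
    have "mnorm X n (\<lambda>i j. fst (w i j)) = 0" "mnorm Y n (\<lambda>i j. snd (w i j)) = 0"
      using 0 X.mnorm_nonneg[OF n F[OF w]] Y.mnorm_nonneg[OF n S[OF w]] by (auto simp: max_def split: if_splits)
    then show "w i j = \<zero>\<^bsub>?Z\<^esub>"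
      using X.definite[OF n F[OF w] _ ij] Y.definite[OF n S[OF w] _ ij] by (simp add: prod_eq_iff)
  qed
  have "Metric_space.mcomplete (carrier ?Z) (op_dist ?Z)"
    unfolding op_dist_def
  proof (rule nZ.mcompleteI_fast)
    fix \<xi> assume \<xi>: "\<And>n. \<xi> n \<in> carrier ?Z" and fast: "\<And>n. vnorm ?Z (\<xi> (Suc n) \<ominus>\<^bsub>?Z\<^esub> \<xi> n) \<le> (1/2) ^ n"
    have \<xi>1: "fst (\<xi> n) \<in> carrier X" and \<xi>2: "snd (\<xi> n) \<in> carrier Y" for n
      using \<xi>[of n] by auto
    have d1: "fst (u \<ominus>\<^bsub>?Z\<^esub> v) = fst u \<ominus>\<^bsub>X\<^esub> fst v" and d2: "snd (u \<ominus>\<^bsub>?Z\<^esub> v) = snd u \<ominus>\<^bsub>Y\<^esub> snd v"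
      if "u \<in> carrier ?Z" "v \<in> carrier ?Z" for u v
      using linear_map_diff[OF Z.cmodule_axioms X.cmodule_axioms linear_map_fst that]
        linear_map_diff[OF Z.cmodule_axioms Y.cmodule_axioms linear_map_snd that] by auto
    have "vnorm X (fst (\<xi> (Suc n)) \<ominus>\<^bsub>X\<^esub> fst (\<xi> n)) \<le> 1 * (1/2) ^ n" for n
      using fast[of n] by (simp add: vnorm_op_sum d1[OF \<xi> \<xi>])
    from X.fast_Cauchy[of "\<lambda>n. fst (\<xi> n)", OF \<xi>1 this]
    obtain a where a: "a \<in> carrier X" "(\<lambda>n. vnorm X (fst (\<xi> n) \<ominus>\<^bsub>X\<^esub> a)) \<longlonglongrightarrow> 0"
      by (rule X.mcompleteD[of "\<lambda>n. fst (\<xi> n)", OF X.mcomplete \<xi>1])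
    have "vnorm Y (snd (\<xi> (Suc n)) \<ominus>\<^bsub>Y\<^esub> snd (\<xi> n)) \<le> 1 * (1/2) ^ n" for n
      using fast[of n] by (simp add: vnorm_op_sum d2[OF \<xi> \<xi>])
    from Y.fast_Cauchy[of "\<lambda>n. snd (\<xi> n)", OF \<xi>2 this]
    obtain b where b: "b \<in> carrier Y" "(\<lambda>n. vnorm Y (snd (\<xi> n) \<ominus>\<^bsub>Y\<^esub> b)) \<longlonglongrightarrow> 0"
      by (rule Y.mcompleteD[of "\<lambda>n. snd (\<xi> n)", OF Y.mcomplete \<xi>2])
    have ab: "(a, b) \<in> carrier ?Z" using a b by simp
    have "(\<lambda>n. max (vnorm X (fst (\<xi> n) \<ominus>\<^bsub>X\<^esub> a)) (vnorm Y (snd (\<xi> n) \<ominus>\<^bsub>Y\<^esub> b))) \<longlonglongrightarrow> max 0 0"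
      by (intro tendsto_max a b)
    then have "(\<lambda>n. vnorm ?Z (\<xi> n \<ominus>\<^bsub>?Z\<^esub> (a, b))) \<longlonglongrightarrow> 0"
      by (simp add: vnorm_op_sum d1[OF \<xi> ab] d2[OF \<xi> ab])
    then show "\<exists>l\<in>carrier ?Z. (\<lambda>n. vnorm ?Z (\<xi> n \<ominus>\<^bsub>?Z\<^esub> l)) \<longlonglongrightarrow> 0"
      using ab by blast
  qed
  then show ?thesis
    using nZ.matnormed_axioms by (simp add: operator_space_iff)
qed

section \<open>Complete isomorphisms and extension sequences\<close>

text \<open>The inverse of the induced map from \<open>X / ker q\<close> to \<open>Z\<close> is completely bounded exactly when matrices over
  \<open>Z\<close> have such lifts.\<close>

definition bounded_lifts :: "'a opspace \<Rightarrow> 'b opspace \<Rightarrow> ('a \<Rightarrow> 'b) \<Rightarrow> bool" where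
  "bounded_lifts X Z q \<longleftrightarrow> (\<exists>K. \<forall>n>0. \<forall>z\<in>mats Z n.
     \<exists>x\<in>mats X n. (\<forall>i<n. \<forall>j<n. q (x i j) = z i j) \<and> mnorm X n x \<le> K * mnorm Z n z)"

definition bounded_below :: "'a opspace \<Rightarrow> 'b opspace \<Rightarrow> ('a \<Rightarrow> 'b) \<Rightarrow> bool" where
  "bounded_below Y X i \<longleftrightarrow> (\<exists>C. \<forall>n>0. \<forall>y\<in>mats Y n. mnorm Y n y \<le> C * mnorm X n (\<lambda>k l. i (y k l)))"

lemma completely_boundedI:
  assumes "linear_map X Y T"
    and "\<And>n x. \<lbrakk>n > 0; x \<in> mats X n\<rbrakk> \<Longrightarrow> mnorm Y n (\<lambda>i j. T (x i j)) \<le> C * mnorm X n x"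
  shows "completely_bounded X Y T"
  using assms unfolding completely_bounded_def linear_map_def by blast

lemma completely_bounded_linear:
  assumes "cmodule X" "cmodule Y" "completely_bounded X Y T"
  shows "linear_map X Y T"
proof -
  interpret X: cmodule X by fact
  interpret Y: cmodule Y by fact
  have "T (0 \<odot>\<^bsub>X\<^esub> \<zero>\<^bsub>X\<^esub>) = 0 \<odot>\<^bsub>Y\<^esub> T \<zero>\<^bsub>X\<^esub>" "T \<zero>\<^bsub>X\<^esub> \<in> carrier Y"
    using assms(3) X.zero_closed unfolding completely_bounded_def by blast+
  then have "T \<zero>\<^bsub>X\<^esub> = \<zero>\<^bsub>Y\<^esub>" by simp
  then show ?thesis
    using assms(3) by (simp add: completely_bounded_def linear_map_def)
qed

lemma completely_boundedE:
  assumes "completely_bounded X Y T" "operator_space X"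
  obtains C where "C \<ge> 0" "\<And>n x. \<lbrakk>n > 0; x \<in> mats X n\<rbrakk> \<Longrightarrow> mnorm Y n (\<lambda>i j. T (x i j)) \<le> C * mnorm X n x"
proof -
  interpret opspace X by unfold_locales fact
  obtain C where C: "\<And>n x. \<lbrakk>n > 0; x \<in> mats X n\<rbrakk> \<Longrightarrow> mnorm Y n (\<lambda>i j. T (x i j)) \<le> C * mnorm X n x"
    using assms(1) unfolding completely_bounded_def by meson
  show ?thesis
  proof (rule that[of "\<bar>C\<bar>"])
    fix n x assume nx: "n > 0" "x \<in> mats X n"
    have "C * mnorm X n x \<le> \<bar>C\<bar> * mnorm X n x"
      using mnorm_nonneg[OF nx] by (intro mult_right_mono) auto
    then show "mnorm Y n (\<lambda>i j. T (x i j)) \<le> \<bar>C\<bar> * mnorm X n x"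
      using C[OF nx] by linarith
  qed simp
qed

text \<open>The first isomorphism theorem for complete isomorphisms: complete boundedness of \<open>q\<close> bounds the induced
  map, and the lifts bound its inverse.\<close>

lemma (in metric_quotient_map) factor_complete_iso:
  assumes Z: "operator_space Z" and q: "completely_bounded X Z q" and lifts: "bounded_lifts X Z q"
    and ker: "\<And>x. \<lbrakk>x \<in> carrier X; q x = \<zero>\<^bsub>Z\<^esub>\<rbrakk> \<Longrightarrow> Q x = \<zero>\<^bsub>Y\<^esub>"
    and T: "\<And>x. x \<in> carrier X \<Longrightarrow> T (Q x) = q x"
  shows "complete_iso Y Z T"
proof -
  interpret Z: opspace Z by unfold_locales fact
  have q_lin: "linear_map X Z q"
    by (rule completely_bounded_linear[OF cmodule_axioms Z.cmodule_axioms q])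
  note q' = linear_mapD[OF q_lin]
  have E: "\<exists>x\<in>carrier X. y = Q x" if "y \<in> carrier Y" for y
    using that onto by blast
  have T_lin: "linear_map Y Z T"
    unfolding linear_map_def
  proof (intro conjI ballI allI Pi_I)
    show "T \<zero>\<^bsub>Y\<^esub> = \<zero>\<^bsub>Z\<^esub>"
      using T[of "\<zero>\<^bsub>X\<^esub>"] Q(2) q'(2) by simp
    fix y assume "y \<in> carrier Y"
    then obtain a where a: "a \<in> carrier X" "y = Q a" using E by meson
    then show "T y \<in> carrier Z" by (simp add: T q')
    show "T (c \<odot>\<^bsub>Y\<^esub> y) = c \<odot>\<^bsub>Z\<^esub> T y" for c
      using a T[of "c \<odot>\<^bsub>X\<^esub> a"] by (simp add: T q' Q)
    fix z assume "z \<in> carrier Y"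
    then obtain b where b: "b \<in> carrier X" "z = Q b" using E by meson
    show "T (y \<oplus>\<^bsub>Y\<^esub> z) = T y \<oplus>\<^bsub>Z\<^esub> T z"
      using a b T[of "a \<oplus>\<^bsub>X\<^esub> b"] by (simp add: T q' Q)
  qed
  obtain C where C: "C \<ge> 0" "\<And>n x. \<lbrakk>n > 0; x \<in> mats X n\<rbrakk> \<Longrightarrow> mnorm Z n (\<lambda>i j. q (x i j)) \<le> C * mnorm X n x"
    by (rule completely_boundedE[OF q operator_space]) blast
  have T_cb: "completely_bounded Y Z T"
  proof (rule completely_boundedI[OF T_lin])
    fix n y assume n: "n > 0" and y: "y \<in> mats Y n"
    show "mnorm Z n (\<lambda>i j. T (y i j)) \<le> C * mnorm Y n y"
    proof (rule mnorm_quotient_ge_scaled[OF n y C(1)])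
      fix x assume x: "x \<in> mats X n" "\<And>i j. \<lbrakk>i < n; j < n\<rbrakk> \<Longrightarrow> Q (x i j) = y i j"
      have "T (y i j) = q (x i j)" if "i < n" "j < n" for i j
        using T[OF matsD[OF x(1) that]] x(2)[OF that] by simp
      then have "mnorm Z n (\<lambda>i j. T (y i j)) = mnorm Z n (\<lambda>i j. q (x i j))"
        by (intro Z.mnorm_cong[OF n])
      then show "mnorm Z n (\<lambda>i j. T (y i j)) \<le> C * mnorm X n x"
        using C(2)[OF n x(1)] by simp
    qed
  qed
  have inj: "inj_on T (carrier Y)"
  proof (rule inj_onI)
    fix y z assume "y \<in> carrier Y" "z \<in> carrier Y" and eq: "T y = T z"
    then obtain a b where ab: "a \<in> carrier X" "y = Q a" "b \<in> carrier X" "z = Q b" using E by meson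
    have "q a = q b"
      using eq T[OF ab(1)] T[OF ab(3)] ab(2,4) by simp
    then have "q a \<ominus>\<^bsub>Z\<^esub> q b = \<zero>\<^bsub>Z\<^esub>"
      using Z.diff_eq_zero_iff[OF q'(1)[OF ab(1)] q'(1)[OF ab(3)]] by blast
    then have "q (a \<ominus>\<^bsub>X\<^esub> b) = \<zero>\<^bsub>Z\<^esub>"
      using linear_map_diff[OF cmodule_axioms Z.cmodule_axioms q_lin ab(1,3)] by simp
    then have "Q (a \<ominus>\<^bsub>X\<^esub> b) = \<zero>\<^bsub>Y\<^esub>"
      by (rule ker[OF minus_in[OF ab(1,3)]])
    then have "Q a \<ominus>\<^bsub>Y\<^esub> Q b = \<zero>\<^bsub>Y\<^esub>"
      using linear_map_diff[OF cmodule_axioms Y.cmodule_axioms linear ab(1,3)] by simp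
    then show "y = z"
      using Y.diff_eq_zero_iff[OF Q(1)[OF ab(1)] Q(1)[OF ab(3)]] ab(2,4) by blast
  qed
  from lifts[unfolded bounded_lifts_def] obtain K where "\<forall>n>0. \<forall>z\<in>mats Z n.
     \<exists>x\<in>mats X n. (\<forall>i<n. \<forall>j<n. q (x i j) = z i j) \<and> mnorm X n x \<le> K * mnorm Z n z" ..
  then have K: "\<exists>x\<in>mats X n. (\<forall>i<n. \<forall>j<n. q (x i j) = z i j) \<and> mnorm X n x \<le> K * mnorm Z n z"
    if "n > 0" "z \<in> mats Z n" for n z
    using that by simp
  have surj: "T ` carrier Y = carrier Z"
  proof
    show "T ` carrier Y \<subseteq> carrier Z" using linear_mapD(1)[OF T_lin] by blast
    show "carrier Z \<subseteq> T ` carrier Y"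
    proof
      fix z assume "z \<in> carrier Z"
      then have "\<exists>x\<in>mats X 1. (\<forall>i<1. \<forall>j<1. q (x i j) = z) \<and> mnorm X 1 x \<le> K * mnorm Z 1 (\<lambda>i j. z)"
        by (intro K) (auto simp: mats_def)
      then obtain x where "x 0 0 \<in> carrier X" "q (x 0 0) = z" by (auto simp: mats_def)
      then show "z \<in> T ` carrier Y"
        using T[of "x 0 0"] by (intro image_eqI[of _ _ "Q (x 0 0)"] Q(1)) simp_all
    qed
  qed
  let ?S = "inv_into (carrier Y) T"
  have S: "?S z \<in> carrier Y" "T (?S z) = z" if "z \<in> carrier Z" for z
    using that surj by (auto simp: inv_into_into f_inv_into_f)
  have SQ: "?S (q x) = Q x" if "x \<in> carrier X" for x
    using inv_into_f_f[OF inj Q(1)[OF that]] T[OF that] by simp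
  note T' = linear_mapD[OF T_lin]
  have S_eq: "?S z = y" if "y \<in> carrier Y" "T y = z" for y z
    using inv_into_f_f[OF inj that(1)] that(2) by simp
  have S_lin: "linear_map Z Y ?S"
    unfolding linear_map_def
  proof (intro conjI ballI allI Pi_I)
    show "?S \<zero>\<^bsub>Z\<^esub> = \<zero>\<^bsub>Y\<^esub>"
      by (intro S_eq T'(2)) simp
    fix z c assume z: "z \<in> carrier Z"
    show "?S z \<in> carrier Y" by (rule S(1)[OF z])
    show "?S (c \<odot>\<^bsub>Z\<^esub> z) = c \<odot>\<^bsub>Y\<^esub> ?S z"
      using S[OF z] by (intro S_eq) (simp_all add: T')
    fix w assume w: "w \<in> carrier Z"
    show "?S (z \<oplus>\<^bsub>Z\<^esub> w) = ?S z \<oplus>\<^bsub>Y\<^esub> ?S w"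
      using S[OF z] S[OF w] by (intro S_eq) (simp_all add: T')
  qed
  have "completely_bounded Z Y ?S"
  proof (rule completely_boundedI[OF S_lin])
    fix n z assume n: "n > 0" and z: "z \<in> mats Z n"
    obtain x where x: "x \<in> mats X n" "\<forall>i<n. \<forall>j<n. q (x i j) = z i j" "mnorm X n x \<le> K * mnorm Z n z"
      using K[OF n z] by blast
    have "mnorm Y n (\<lambda>i j. ?S (z i j)) \<le> mnorm X n x"
    proof (rule mnorm_quotient_le[OF n x(1)])
      fix i j assume ij: "i < n" "j < n"
      show "Q (x i j) = ?S (z i j)"
        using SQ[OF matsD[OF x(1) ij]] x(2) ij by simp
    qed
    then show "mnorm Y n (\<lambda>i j. ?S (z i j)) \<le> K * mnorm Z n z"
      using x(3) by linarith
  qed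
  then show ?thesis
    using T_cb inj surj by (simp add: complete_iso_def bij_betw_def)
qed

text \<open>The two isomorphism conditions are reduced to inequalities between matrix norms: a lower bound for \<open>i\<close>,
  and lifts along \<open>q\<close>.\<close>

lemma extension_sequenceI:
  assumes Y: "operator_space Y" and X: "operator_space X" and Z: "operator_space Z"
    and i: "completely_bounded Y X i" and below: "bounded_below Y X i"
    and q: "completely_bounded X Z q" and lifts: "bounded_lifts X Z q"
    and exact: "i ` carrier Y = a_kernel X Z q"
  shows "extension_sequence Y X Z i q"
proof -
  interpret Y: opspace Y by unfold_locales fact
  interpret X: opspace X by unfold_locales fact
  interpret Z: opspace Z by unfold_locales fact
  have i_lin: "linear_map Y X i"
    by (rule completely_bounded_linear[OF Y.cmodule_axioms X.cmodule_axioms i])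
  have q_lin: "linear_map X Z q"
    by (rule completely_bounded_linear[OF X.cmodule_axioms Z.cmodule_axioms q])
  note i' = linear_mapD[OF i_lin] and q' = linear_mapD[OF q_lin]
  obtain C where C: "\<And>n y. \<lbrakk>n > 0; y \<in> mats Y n\<rbrakk> \<Longrightarrow> mnorm Y n y \<le> C * mnorm X n (\<lambda>k l. i (y k l))"
    using below unfolding bounded_below_def by blast
  have inj: "inj_on i (carrier Y)"
  proof (rule inj_onI)
    fix x y assume xy: "x \<in> carrier Y" "y \<in> carrier Y" "i x = i y"
    have "i (x \<ominus>\<^bsub>Y\<^esub> y) = \<zero>\<^bsub>X\<^esub>"
      using xy by (simp add: linear_map_diff[OF Y.cmodule_axioms X.cmodule_axioms i_lin] X.diff_eq_zero_iff i')
    then have "vnorm Y (x \<ominus>\<^bsub>Y\<^esub> y) \<le> 0"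
      using C[of 1 "\<lambda>k l. x \<ominus>\<^bsub>Y\<^esub> y"] xy X.mnorm_zero[of 1] by (simp add: vnorm_def mats_def)
    then have "vnorm Y (x \<ominus>\<^bsub>Y\<^esub> y) = 0"
      using Y.N_nonneg[of "x \<ominus>\<^bsub>Y\<^esub> y"] xy by simp
    then show "x = y"
      using xy by (simp add: Y.N_zero_iff Y.diff_eq_zero_iff)
  qed
  let ?i' = "inv_into (carrier Y) i"
  have sub: "completely_bounded Y (op_subspace X (i ` carrier Y)) i"
    using i unfolding completely_bounded_def op_subspace_def by (simp add: Pi_iff)
  have inv_lin: "linear_map (op_subspace X (i ` carrier Y)) Y ?i'"
  proof -
    have 1: "?i' (i y) = y" if "y \<in> carrier Y" for y
      using inv_into_f_f[OF inj that] .
    have "?i' (i x \<oplus>\<^bsub>X\<^esub> i y) = x \<oplus>\<^bsub>Y\<^esub> y" if "x \<in> carrier Y" "y \<in> carrier Y" for x y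
      using 1[of "x \<oplus>\<^bsub>Y\<^esub> y"] that by (simp add: i')
    moreover have "?i' (c \<odot>\<^bsub>X\<^esub> i x) = c \<odot>\<^bsub>Y\<^esub> x" if "x \<in> carrier Y" for c x
      using 1[of "c \<odot>\<^bsub>Y\<^esub> x"] that by (simp add: i')
    moreover have "?i' \<zero>\<^bsub>X\<^esub> = \<zero>\<^bsub>Y\<^esub>"
      using 1[of "\<zero>\<^bsub>Y\<^esub>"] by (simp add: i')
    ultimately show ?thesis
      unfolding linear_map_def op_subspace_def by (auto simp: 1)
  qed
  have inv_cb: "completely_bounded (op_subspace X (i ` carrier Y)) Y ?i'"
  proof (rule completely_boundedI[OF inv_lin])
    fix n x assume n: "n > 0" and "x \<in> mats (op_subspace X (i ` carrier Y)) n"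
    then have x: "x k l \<in> i ` carrier Y" if "k < n" "l < n" for k l
      using that by (simp add: mats_def op_subspace_def)
    have "mnorm Y n (\<lambda>k l. ?i' (x k l)) \<le> C * mnorm X n (\<lambda>k l. i (?i' (x k l)))"
      using x by (intro C[OF n]) (simp add: mats_def inv_into_into)
    also have "mnorm X n (\<lambda>k l. i (?i' (x k l))) = mnorm X n x"
      using x by (intro X.mnorm_cong[OF n]) (simp add: f_inv_into_f)
    finally show "mnorm Y n (\<lambda>k l. ?i' (x k l)) \<le> C * mnorm (op_subspace X (i ` carrier Y)) n x"
      by (simp add: op_subspace_def)
  qed
  have iso_i: "complete_iso Y (op_subspace X (i ` carrier Y)) i"
    using sub inv_cb inj by (simp add: complete_iso_def bij_betw_def op_subspace_def)
  let ?S = "a_kernel X Z q"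
  have S: "submodule ?S complex_ring X"
    by (rule submodule_kernel[OF X.cmodule_axioms Z.cmodule_axioms q_lin])
  interpret quot: metric_quotient_map X "op_quotient X ?S" "\<lambda>x. ?S +>\<^bsub>X\<^esub> x"
    by unfold_locales (rule metric_quotient_op_quotient[OF X.cmodule_axioms S])
  have iso_q: "complete_iso (op_quotient X ?S) Z (\<lambda>C. the_elem (q ` C))"
  proof (rule quot.factor_complete_iso[OF Z q lifts])
    fix x assume x: "x \<in> carrier X"
    show "?S +>\<^bsub>X\<^esub> x = \<zero>\<^bsub>op_quotient X ?S\<^esub>" if "q x = \<zero>\<^bsub>Z\<^esub>"
      using X.coset_eq_self_iff[OF S x] x that by (simp add: op_quotient_def a_kernel_def')
    show "the_elem (q ` (?S +>\<^bsub>X\<^esub> x)) = q x"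
      by (simp only: image_kernel_coset[OF X.cmodule_axioms Z.cmodule_axioms q_lin x] the_elem_eq)
  qed
  have onto: "q ` carrier X = carrier Z"
  proof
    show "q ` carrier X \<subseteq> carrier Z" using q'(1) by blast
    show "carrier Z \<subseteq> q ` carrier X"
    proof
      fix z assume "z \<in> carrier Z"
      then have "(\<lambda>i j. z) \<in> mats Z 1" by (simp add: mats_def)
      moreover have "\<exists>K. \<forall>z\<in>mats Z 1. \<exists>x\<in>mats X 1. (\<forall>i<1. \<forall>j<1. q (x i j) = z i j) \<and> mnorm X 1 x \<le> K * mnorm Z 1 z"
        using lifts zero_less_one unfolding bounded_lifts_def by metis
      ultimately obtain x where "x \<in> mats X 1" "\<forall>i<1. \<forall>j<1. q (x i j) = z"
        by (metis (no_types, lifting))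
      then have "x 0 0 \<in> carrier X" "q (x 0 0) = z" by (auto simp: mats_def)
      then show "z \<in> q ` carrier X" by blast
    qed
  qed
  show ?thesis
    using Y X Z i q inj exact onto iso_i iso_q by (simp add: extension_sequence_def)
qed

text \<open>The infimum in the quotient norm need not be attained; the constant 2 leaves room for a lift of every
  matrix of nonzero norm.\<close>

lemma (in metric_quotient_map) bounded_lifts_quotient:
  assumes "operator_space Y"
  shows "bounded_lifts X Y Q"
  unfolding bounded_lifts_def
proof (intro exI[of _ 2] allI impI ballI)
  interpret OY: opspace Y by unfold_locales fact
  fix n :: nat and y assume n: "n > 0" and y: "y \<in> mats Y n"
  show "\<exists>x\<in>mats X n. (\<forall>i<n. \<forall>j<n. Q (x i j) = y i j) \<and> mnorm X n x \<le> 2 * mnorm Y n y"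
  proof (cases "mnorm Y n y = 0")
    case True
    then have "\<forall>i<n. \<forall>j<n. y i j = \<zero>\<^bsub>Y\<^esub>"
      using OY.mnorm_zero_iff[OF n y] by simp
    then show ?thesis
      using Q(2) True by (intro bexI[of _ "\<lambda>i j. \<zero>\<^bsub>X\<^esub>"]) (auto simp: mnorm_zero[OF n] mats_def)
  next
    case False
    then have "mnorm Y n y < 2 * mnorm Y n y"
      using OY.mnorm_nonneg[OF n y] by simp
    then obtain x where "x \<in> mats X n" "\<And>i j. \<lbrakk>i < n; j < n\<rbrakk> \<Longrightarrow> Q (x i j) = y i j" "mnorm X n x < 2 * mnorm Y n y"
      by (rule exists_lift_less[OF n y]) blast
    then show ?thesis by (intro bexI[of _ x]) auto
  qed
qed

lemma completely_bounded_comp: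
  assumes X: "operator_space X" and Y: "operator_space Y"
    and S: "completely_bounded X Y S" and T: "completely_bounded Y Z T" and Z: "operator_space Z"
    and U: "\<And>x. x \<in> carrier X \<Longrightarrow> U x = T (S x)"
  shows "completely_bounded X Z U"
proof -
  interpret X: opspace X by unfold_locales fact
  interpret Y: opspace Y by unfold_locales fact
  interpret Z: opspace Z by unfold_locales fact
  note S' = linear_mapD[OF completely_bounded_linear[OF X.cmodule_axioms Y.cmodule_axioms S]]
  note T' = linear_mapD[OF completely_bounded_linear[OF Y.cmodule_axioms Z.cmodule_axioms T]]
  obtain C where C: "C \<ge> 0" "\<And>n x. \<lbrakk>n > 0; x \<in> mats X n\<rbrakk> \<Longrightarrow> mnorm Y n (\<lambda>i j. S (x i j)) \<le> C * mnorm X n x"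
    by (rule completely_boundedE[OF S X]) blast
  obtain D where D: "D \<ge> 0" "\<And>n x. \<lbrakk>n > 0; x \<in> mats Y n\<rbrakk> \<Longrightarrow> mnorm Z n (\<lambda>i j. T (x i j)) \<le> D * mnorm Y n x"
    by (rule completely_boundedE[OF T Y]) blast
  have lin: "linear_map X Z U"
    unfolding linear_map_def by (simp add: U S' T')
  show ?thesis
  proof (rule completely_boundedI[OF lin])
    fix n x assume n: "n > 0" and x: "x \<in> mats X n"
    have "mnorm Z n (\<lambda>i j. U (x i j)) = mnorm Z n (\<lambda>i j. T (S (x i j)))"
      by (intro Z.mnorm_cong[OF n] U X.matsD[OF x])
    also have "\<dots> \<le> D * mnorm Y n (\<lambda>i j. S (x i j))"
      using x by (intro D(2)[OF n]) (simp add: mats_def S')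
    also have "\<dots> \<le> D * (C * mnorm X n x)"
      by (intro mult_left_mono C(2)[OF n x] D(1))
    finally show "mnorm Z n (\<lambda>i j. U (x i j)) \<le> (D * C) * mnorm X n x"
      by (simp only: mult.assoc)
  qed
qed

text \<open>On the carriers \<open>i\<close> is \<open>T\<^sup>-\<^sup>1 \<circ> j\<close> and \<open>q\<close> is \<open>p \<circ> T\<close>, so all bounds for \<open>j\<close> and \<open>p\<close> carry over up to
  the completely bounded norms of \<open>T\<close> and its inverse.\<close>

lemma extension_sequence_pullback:
  assumes Y: "operator_space Y" and X': "operator_space X'" and X: "operator_space X" and Z: "operator_space Z"
    and T: "complete_iso X' X T"
    and j: "completely_bounded Y X j" and below: "bounded_below Y X j"
    and p: "completely_bounded X Z p" and lifts: "bounded_lifts X Z p"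
    and exact: "j ` carrier Y = a_kernel X Z p"
    and i: "\<And>y. y \<in> carrier Y \<Longrightarrow> i y \<in> carrier X'" "\<And>y. y \<in> carrier Y \<Longrightarrow> T (i y) = j y"
    and q: "\<And>c. c \<in> carrier X' \<Longrightarrow> q c = p (T c)"
  shows "extension_sequence Y X' Z i q"
proof -
  interpret Y: opspace Y by unfold_locales fact
  interpret X: opspace X by unfold_locales fact
  interpret X': opspace X' by unfold_locales fact
  let ?S = "inv_into (carrier X') T"
  have T_cb: "completely_bounded X' X T" and S_cb: "completely_bounded X X' ?S"
    and bij: "bij_betw T (carrier X') (carrier X)"
    using T by (auto simp: complete_iso_def)
  note T' = linear_mapD[OF completely_bounded_linear[OF X'.cmodule_axioms X.cmodule_axioms T_cb]]
  note j' = linear_mapD[OF completely_bounded_linear[OF Y.cmodule_axioms X.cmodule_axioms j]]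
  have inj: "inj_on T (carrier X')" using bij by (rule bij_betw_imp_inj_on)
  have TS: "T (?S x) = x" "?S x \<in> carrier X'" if "x \<in> carrier X" for x
    using bij that by (auto simp: bij_betw_def f_inv_into_f inv_into_into)
  have ST: "?S (T c) = c" if "c \<in> carrier X'" for c
    by (rule inv_into_f_f[OF inj that])
  have i_eq: "i y = ?S (j y)" if "y \<in> carrier Y" for y
    using ST[OF i(1)[OF that]] i(2)[OF that] by simp
  have i_cb: "completely_bounded Y X' i"
    by (rule completely_bounded_comp[OF Y X j S_cb X' i_eq])
  have q_cb: "completely_bounded X' Z q"
    by (rule completely_bounded_comp[OF X' X T_cb p Z q])
  obtain C where C: "C \<ge> 0" "\<And>n c. \<lbrakk>n > 0; c \<in> mats X' n\<rbrakk> \<Longrightarrow> mnorm X n (\<lambda>i j. T (c i j)) \<le> C * mnorm X' n c"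
    by (rule completely_boundedE[OF T_cb X']) blast
  from below[unfolded bounded_below_def] obtain D where
    "\<forall>n>0. \<forall>y\<in>mats Y n. mnorm Y n y \<le> D * mnorm X n (\<lambda>k l. j (y k l))" ..
  then have D: "mnorm Y n y \<le> D * mnorm X n (\<lambda>k l. j (y k l))" if "n > 0" "y \<in> mats Y n" for n y
    using that by simp
  have i_below: "bounded_below Y X' i"
    unfolding bounded_below_def
  proof (intro exI[of _ "\<bar>D\<bar> * C"] allI impI ballI)
    fix n :: nat and y assume n: "n > 0" and y: "y \<in> mats Y n"
    have iy: "(\<lambda>k l. i (y k l)) \<in> mats X' n"
      using y by (simp add: mats_def i)
    have eq: "mnorm X n (\<lambda>k l. j (y k l)) = mnorm X n (\<lambda>k l. T (i (y k l)))"
      by (intro X.mnorm_cong[OF n]) (simp add: i(2) Y.matsD[OF y])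
    have "mnorm Y n y \<le> D * mnorm X n (\<lambda>k l. j (y k l))"
      by (rule D[OF n y])
    also have "\<dots> \<le> \<bar>D\<bar> * mnorm X n (\<lambda>k l. j (y k l))"
      using y j' by (intro mult_right_mono X.mnorm_nonneg[OF n]) (auto simp: mats_def)
    also have "\<dots> \<le> \<bar>D\<bar> * (C * mnorm X' n (\<lambda>k l. i (y k l)))"
      unfolding eq by (intro mult_left_mono C(2)[OF n iy]) simp
    finally show "mnorm Y n y \<le> \<bar>D\<bar> * C * mnorm X' n (\<lambda>k l. i (y k l))"
      by (simp only: mult.assoc)
  qed
  obtain E where E: "E \<ge> 0" "\<And>n x. \<lbrakk>n > 0; x \<in> mats X n\<rbrakk> \<Longrightarrow> mnorm X' n (\<lambda>i j. ?S (x i j)) \<le> E * mnorm X n x"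
    by (rule completely_boundedE[OF S_cb X]) blast
  from lifts[unfolded bounded_lifts_def] obtain K where "\<forall>n>0. \<forall>z\<in>mats Z n.
     \<exists>x\<in>mats X n. (\<forall>i<n. \<forall>j<n. p (x i j) = z i j) \<and> mnorm X n x \<le> K * mnorm Z n z" ..
  then have K: "\<exists>x\<in>mats X n. (\<forall>i<n. \<forall>j<n. p (x i j) = z i j) \<and> mnorm X n x \<le> K * mnorm Z n z"
    if "n > 0" "z \<in> mats Z n" for n z
    using that by simp
  have q_lifts: "bounded_lifts X' Z q"
    unfolding bounded_lifts_def
  proof (intro exI[of _ "E * K"] allI impI ballI)
    fix n :: nat and z assume n: "n > 0" and z: "z \<in> mats Z n"
    obtain x where x: "x \<in> mats X n" "\<forall>i<n. \<forall>j<n. p (x i j) = z i j" "mnorm X n x \<le> K * mnorm Z n z"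
      using K[OF n z] by blast
    show "\<exists>c\<in>mats X' n. (\<forall>i<n. \<forall>j<n. q (c i j) = z i j) \<and> mnorm X' n c \<le> E * K * mnorm Z n z"
    proof (intro bexI[of _ "\<lambda>i j. ?S (x i j)"] conjI allI impI)
      show "(\<lambda>i j. ?S (x i j)) \<in> mats X' n"
        using x(1) by (simp add: mats_def TS)
      show "q (?S (x k l)) = z k l" if "k < n" "l < n" for k l
        using X.matsD[OF x(1) that] x(2) that by (simp add: q TS)
      have "mnorm X' n (\<lambda>i j. ?S (x i j)) \<le> E * (K * mnorm Z n z)"
        using E(2)[OF n x(1)] mult_left_mono[OF x(3) E(1)] by linarith
      then show "mnorm X' n (\<lambda>i j. ?S (x i j)) \<le> E * K * mnorm Z n z"
        by (simp only: mult.assoc)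
    qed
  qed
  have "i ` carrier Y = a_kernel X' Z q"
  proof
    show "i ` carrier Y \<subseteq> a_kernel X' Z q"
    proof (rule image_subsetI)
      fix y assume y: "y \<in> carrier Y"
      then have "j y \<in> a_kernel X Z p" using exact by blast
      then show "i y \<in> a_kernel X' Z q"
        using y i q by (simp add: a_kernel_def')
    qed
    show "a_kernel X' Z q \<subseteq> i ` carrier Y"
    proof
      fix c assume "c \<in> a_kernel X' Z q"
      then have c: "c \<in> carrier X'" "p (T c) = \<zero>\<^bsub>Z\<^esub>"
        using q by (auto simp: a_kernel_def')
      then have "T c \<in> j ` carrier Y"
        unfolding exact by (simp add: a_kernel_def' T')
      then obtain y where y: "y \<in> carrier Y" "T c = j y" by blast
      then have "i y = c" using i_eq[OF y(1)] ST[OF c(1)] by simp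
      then show "c \<in> i ` carrier Y" using y by blast
    qed
  qed
  then show ?thesis
    by (intro extension_sequenceI Y X' Z i_cb i_below q_cb q_lifts)
qed

text \<open>The norm of \<open>T x\<close> is at most a constant times the distance from \<open>x\<close> to the kernel.\<close>

lemma kernel_closed:
  assumes X: "operator_space X" and Y: "operator_space Y" and T: "completely_bounded X Y T"
    and x: "x \<in> carrier X"
    and approx: "\<And>e. e > 0 \<Longrightarrow> \<exists>k\<in>a_kernel X Y T. vnorm X (x \<ominus>\<^bsub>X\<^esub> k) < e"
  shows "x \<in> a_kernel X Y T"
proof -
  interpret X: opspace X by unfold_locales fact
  interpret Y: opspace Y by unfold_locales fact
  have lin: "linear_map X Y T"
    by (rule completely_bounded_linear[OF X.cmodule_axioms Y.cmodule_axioms T])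
  note T' = linear_mapD[OF lin]
  obtain C where C: "C \<ge> 0" "\<And>n x. \<lbrakk>n > 0; x \<in> mats X n\<rbrakk> \<Longrightarrow> mnorm Y n (\<lambda>i j. T (x i j)) \<le> C * mnorm X n x"
    by (rule completely_boundedE[OF T X]) blast
  have "vnorm Y (T x) \<le> 0 + e" if e: "e > 0" for e
  proof -
    have "e / (C + 1) > 0" using e C(1) by simp
    then obtain k where k: "k \<in> carrier X" "T k = \<zero>\<^bsub>Y\<^esub>" "vnorm X (x \<ominus>\<^bsub>X\<^esub> k) < e / (C + 1)"
      using approx[of "e / (C + 1)"] by (auto simp: a_kernel_def')
    have "T (x \<ominus>\<^bsub>X\<^esub> k) = T x"
      using linear_map_diff[OF X.cmodule_axioms Y.cmodule_axioms lin x k(1)] T'(1)[OF x] k(2)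
      by (simp add: Y.M.minus_eq)
    then have "vnorm Y (T x) \<le> C * vnorm X (x \<ominus>\<^bsub>X\<^esub> k)"
      using C(2)[of 1 "\<lambda>i j. x \<ominus>\<^bsub>X\<^esub> k"] x k(1) by (simp add: vnorm_def mats_def)
    also have "\<dots> \<le> (C + 1) * (e / (C + 1))"
      using k(3) C(1) X.N_nonneg[OF X.minus_in[OF x k(1)]] by (intro mult_mono) auto
    also have "\<dots> = e" using C(1) by simp
    finally show ?thesis by simp
  qed
  then have "vnorm Y (T x) \<le> 0" by (rule field_le_epsilon)
  then have "vnorm Y (T x) = 0" using Y.N_nonneg[OF T'(1)[OF x]] by simp
  then show ?thesis
    using x T'(1)[OF x] by (simp add: a_kernel_def' Y.N_zero_iff)
qed

lemma closure_of_kernel: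
  assumes X: "operator_space X" and Y: "operator_space Y" and T: "completely_bounded X Y T"
  shows "op_topology X closure_of (a_kernel X Y T) = a_kernel X Y T"
proof
  interpret X: opspace X by unfold_locales fact
  have sub: "a_kernel X Y T \<subseteq> carrier X" by (auto simp: a_kernel_def')
  show "op_topology X closure_of (a_kernel X Y T) \<subseteq> a_kernel X Y T"
  proof
    fix x assume "x \<in> op_topology X closure_of (a_kernel X Y T)"
    then have x: "x \<in> carrier X" and ball: "\<And>r. r > 0 \<Longrightarrow> \<exists>y\<in>a_kernel X Y T. y \<in> X.met.mball x r"
      unfolding X.op_topology_eq X.met.metric_closure_of by auto
    show "x \<in> a_kernel X Y T"
    proof (rule kernel_closed[OF X Y T x])
      fix e :: real assume "e > 0"
      then obtain k where "k \<in> a_kernel X Y T" "k \<in> X.met.mball x e" using ball by blast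
      then show "\<exists>k\<in>a_kernel X Y T. vnorm X (x \<ominus>\<^bsub>X\<^esub> k) < e"
        by (intro bexI[of _ k]) (auto simp: norm_dist_def)
    qed
  qed
  show "a_kernel X Y T \<subseteq> op_topology X closure_of (a_kernel X Y T)"
    using sub by (intro closure_of_subset) (simp add: X.op_topology_eq)
qed

lemma operator_space_quotient_kernel:
  assumes X: "operator_space X" and Y: "operator_space Y" and T: "completely_bounded X Y T"
  shows "operator_space (op_quotient X (a_kernel X Y T))"
proof -
  interpret X: opspace X by unfold_locales fact
  interpret Y: opspace Y by unfold_locales fact
  have S: "submodule (a_kernel X Y T) complex_ring X"
    by (rule submodule_kernel[OF X.cmodule_axioms Y.cmodule_axioms
          completely_bounded_linear[OF X.cmodule_axioms Y.cmodule_axioms T]])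
  have zero: "\<zero>\<^bsub>op_quotient X (a_kernel X Y T)\<^esub> = a_kernel X Y T" by (simp add: op_quotient_def)
  show ?thesis
  proof (rule operator_space_quotient[OF X metric_quotient_op_quotient[OF X.cmodule_axioms S]])
    fix x assume x: "x \<in> carrier X" and approx: "\<And>e. e > 0 \<Longrightarrow> \<exists>k\<in>carrier X.
        a_kernel X Y T +>\<^bsub>X\<^esub> k = \<zero>\<^bsub>op_quotient X (a_kernel X Y T)\<^esub> \<and> vnorm X (x \<ominus>\<^bsub>X\<^esub> k) < e"
    have "x \<in> a_kernel X Y T"
    proof (rule kernel_closed[OF X Y T x])
      fix e :: real assume "e > 0"
      then obtain k where "k \<in> carrier X" "a_kernel X Y T +>\<^bsub>X\<^esub> k = a_kernel X Y T" "vnorm X (x \<ominus>\<^bsub>X\<^esub> k) < e"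
        using approx unfolding zero by blast
      then show "\<exists>k\<in>a_kernel X Y T. vnorm X (x \<ominus>\<^bsub>X\<^esub> k) < e"
        using X.coset_eq_self_iff[OF S] by blast
    qed
    then show "a_kernel X Y T +>\<^bsub>X\<^esub> x = \<zero>\<^bsub>op_quotient X (a_kernel X Y T)\<^esub>"
      unfolding zero using X.coset_eq_self_iff[OF S x] by simp
  qed
qed

section \<open>Seminorms and minimal sublinear functionals\<close>

locale seminormed_subspace =
  fixes s :: "complex \<Rightarrow> 'v \<Rightarrow> 'v::ab_group_add" and V :: "'v set" and N :: "'v \<Rightarrow> real"
  assumes vs: "vector_space s"
    and V_0 [simp, intro]: "0 \<in> V"
    and V_add [simp, intro]: "\<lbrakk>x \<in> V; y \<in> V\<rbrakk> \<Longrightarrow> x + y \<in> V"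
    and V_s [simp, intro]: "x \<in> V \<Longrightarrow> s c x \<in> V"
    and N_add: "\<lbrakk>x \<in> V; y \<in> V\<rbrakk> \<Longrightarrow> N (x + y) \<le> N x + N y"
    and N_s: "x \<in> V \<Longrightarrow> N (s c x) = cmod c * N x"
begin

sublocale vector_space s by (rule vs)

lemma V_uminus [simp, intro]: "x \<in> V \<Longrightarrow> - x \<in> V"
  using V_s[of x "-1"] by simp

lemma V_diff [simp, intro]: "\<lbrakk>x \<in> V; y \<in> V\<rbrakk> \<Longrightarrow> x - y \<in> V"
  using V_add[of x "- y"] by simp

lemma N_0 [simp]: "N 0 = 0"
  using N_s[of 0 0] by simp

lemma N_minus: "x \<in> V \<Longrightarrow> N (- x) = N x"
  using N_s[of x "-1"] by simp

lemma N_ge_0: "x \<in> V \<Longrightarrow> 0 \<le> N x"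
  using N_add[of x "- x"] by (simp add: N_minus)

lemma N_minus_commute: "\<lbrakk>x \<in> V; y \<in> V\<rbrakk> \<Longrightarrow> N (x - y) = N (y - x)"
  using N_minus[of "x - y"] by simp

lemma N_diff3: "\<lbrakk>x \<in> V; y \<in> V; z \<in> V\<rbrakk> \<Longrightarrow> N (x - z) \<le> N (x - y) + N (y - z)"
  using N_add[of "x - y" "y - z"] by simp

lemma N_le_add_diff: "\<lbrakk>x \<in> V; y \<in> V\<rbrakk> \<Longrightarrow> N x \<le> N y + N (x - y)"
  using N_add[of y "x - y"] by simp

lemma N_abs_diff: "\<lbrakk>x \<in> V; y \<in> V\<rbrakk> \<Longrightarrow> \<bar>N x - N y\<bar> \<le> N (x - y)"
  using N_le_add_diff[of x y] N_le_add_diff[of y x] N_minus_commute[of x y] by linarith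

text \<open>The functionals take the value 0 off \<open>V\<close>, so that the pointwise order of functions compares them
  on \<open>V\<close> alone.\<close>

definition sublinear :: "('v \<Rightarrow> real) \<Rightarrow> bool" where
  "sublinear q \<longleftrightarrow>
     (\<forall>x\<in>V. \<forall>y\<in>V. q (x + y) \<le> q x + q y) \<and>
     (\<forall>t\<ge>0. \<forall>x\<in>V. q (s (of_real t) x) = t * q x) \<and> (\<forall>x. x \<notin> V \<longrightarrow> q x = 0)"

lemma sublinearD:
  assumes "sublinear q"
  shows "\<lbrakk>x \<in> V; y \<in> V\<rbrakk> \<Longrightarrow> q (x + y) \<le> q x + q y"
    and "\<lbrakk>0 \<le> t; x \<in> V\<rbrakk> \<Longrightarrow> q (s (of_real t) x) = t * q x"
    and "x \<notin> V \<Longrightarrow> q x = 0" and "q 0 = 0"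
proof -
  show "\<lbrakk>x \<in> V; y \<in> V\<rbrakk> \<Longrightarrow> q (x + y) \<le> q x + q y" "\<lbrakk>0 \<le> t; x \<in> V\<rbrakk> \<Longrightarrow> q (s (of_real t) x) = t * q x"
    "x \<notin> V \<Longrightarrow> q x = 0"
    using assms by (auto simp: sublinear_def)
  have "q (s (of_real 0) 0) = 0 * q 0"
    using assms V_0 unfolding sublinear_def by blast
  then show "q 0 = 0" by simp
qed

lemma sublinear_ge:
  assumes "sublinear q" "x \<in> V"
  shows "- q (- x) \<le> q x"
  using sublinearD(1)[OF assms(1,2), of "- x"] sublinearD(4)[OF assms(1)] assms(2) by simp

text \<open>Zorn's lemma.  The infimum of a chain is finite because \<open>q x \<ge> - q (- x) \<ge> - p (- x)\<close> for all members \<open>q\<close>, and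
  it is subadditive because two members of a chain dominate a common one.\<close>

lemma exists_minimal_sublinear:
  assumes p: "sublinear p"
  obtains q where "sublinear q" "q \<le> p" "\<And>r. \<lbrakk>sublinear r; r \<le> q\<rbrakk> \<Longrightarrow> r = q"
proof -
  define A where "A = {q. sublinear q \<and> q \<le> p}"
  have po: "partial_order_on A (relation_of (\<lambda>a b. b \<le> a) A)"
    unfolding partial_order_on_def preorder_on_def relation_of_def
    by (auto intro!: refl_onI transI antisymI)
  have "\<exists>m\<in>A. \<forall>a\<in>A. a \<le> m \<longrightarrow> a = m"
  proof (rule predicate_Zorn[OF po])
    fix C assume C: "C \<in> Chains (relation_of (\<lambda>a b. b \<le> a) A)"
    have CA: "sublinear q" "q \<le> p" if "q \<in> C" for q
      using C that unfolding Chains_def relation_of_def A_def by auto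
    have chain: "q \<le> r \<or> r \<le> q" if "q \<in> C" "r \<in> C" for q r
      using C that unfolding Chains_def relation_of_def by auto
    show "\<exists>u\<in>A. \<forall>a\<in>C. u \<le> a"
    proof (cases "C = {}")
      case True
      then show ?thesis using p by (auto simp: A_def)
    next
      case False
      define u where "u x = (INF q\<in>C. q x)" for x
      have bdd: "bdd_below ((\<lambda>q. q x) ` C)" for x
      proof (cases "x \<in> V")
        case True
        have "- p (- x) \<le> q x" if "q \<in> C" for q
          using sublinear_ge[OF CA(1)[OF that] True] CA(2)[OF that] by (smt (verit) le_funD)
        then show ?thesis by (rule bdd_belowI2)
      next
        case False
        then have "(0::real) \<le> q x" if "q \<in> C" for q
          using sublinearD(3)[OF CA(1)[OF that]] by simp
        then show ?thesis by (rule bdd_belowI2)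
      qed
      have u_le: "u x \<le> q x" if "q \<in> C" for q x
        unfolding u_def using that bdd by (rule cINF_lower[rotated])
      have u_ge: "b \<le> u x" if "\<And>q. q \<in> C \<Longrightarrow> b \<le> q x" for b x
        unfolding u_def using False that by (rule cINF_greatest)
      have "sublinear u"
        unfolding sublinear_def
      proof (intro conjI ballI allI impI)
        fix x y assume xy: "x \<in> V" "y \<in> V"
        have "u (x + y) \<le> q1 x + q2 y" if q: "q1 \<in> C" "q2 \<in> C" for q1 q2
        proof -
          obtain q where q: "q \<in> C" "q \<le> q1" "q \<le> q2"
            using chain[OF q] q by auto
          have "u (x + y) \<le> q (x + y)" using u_le q by simp
          also have "\<dots> \<le> q x + q y" by (rule sublinearD(1)[OF CA(1)[OF q(1)] xy])
          also have "\<dots> \<le> q1 x + q2 y" using q by (intro add_mono) (auto simp: le_fun_def)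
          finally show ?thesis .
        qed
        then have "u (x + y) - q1 x \<le> u y" if "q1 \<in> C" for q1
          using that by (intro u_ge) (smt (verit))
        then have "u (x + y) - u y \<le> u x"
          by (intro u_ge) (smt (verit))
        then show "u (x + y) \<le> u x + u y" by simp
      next
        fix t :: real and x assume t: "0 \<le> t" and x: "x \<in> V"
        have hom: "q (s (of_real t) x) = t * q x" if "q \<in> C" for q
          by (rule sublinearD(2)[OF CA(1)[OF that] t x])
        show "u (s (of_real t) x) = t * u x"
        proof (rule antisym)
          show "t * u x \<le> u (s (of_real t) x)"
            using u_le t by (intro u_ge) (simp add: hom mult_left_mono)
          show "u (s (of_real t) x) \<le> t * u x"
          proof (cases "t = 0")
            case True
            obtain q where "q \<in> C" using False by auto
            then show ?thesis using u_le[of q "s (of_real t) x"] hom[of q] True by simp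
          next
            case False
            with t have t: "0 < t" by simp
            have "u (s (of_real t) x) / t \<le> u x"
            proof (rule u_ge)
              fix q assume "q \<in> C"
              then show "u (s (of_real t) x) / t \<le> q x"
                using u_le[of q "s (of_real t) x"] hom[of q] t by (simp add: field_simps)
            qed
            then show ?thesis using t by (simp add: field_simps)
          qed
        qed
      next
        fix x assume "x \<notin> V"
        then have "q x = 0" if "q \<in> C" for q
          using sublinearD(3)[OF CA(1)[OF that]] by simp
        then have "u x = (INF q\<in>C. 0)"
          unfolding u_def by (intro INF_cong) auto
        then show "u x = 0" using False by simp
      qed
      moreover have "u \<le> p"
        using False CA(2) u_le by (meson all_not_in_conv le_funI le_funD order_trans)
      ultimately show ?thesis
        using u_le by (auto simp: A_def le_fun_def)
    qed
  qed
  then obtain m where "m \<in> A" "\<And>a. \<lbrakk>a \<in> A; a \<le> m\<rbrakk> \<Longrightarrow> a = m" by blast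
  then show ?thesis
    using that[of m] unfolding A_def by (blast intro: order_trans)
qed

text \<open>A sublinear functional below \<open>q\<close> whose value at \<open>y\<close> is at most \<open>q (y + x) - q x\<close>.  If \<open>q\<close> is minimal,
  both coincide, and \<open>q\<close> is additive.\<close>

definition lower_along :: "('v \<Rightarrow> real) \<Rightarrow> 'v \<Rightarrow> 'v \<Rightarrow> real" where
  "lower_along q x y =
     (if y \<in> V then INF t\<in>{0..}. q (y + s (of_real t) x) - t * q x else 0)"

lemma lower_along:
  assumes q: "sublinear q" and x: "x \<in> V"
  shows "sublinear (lower_along q x)"
    and "lower_along q x \<le> q"
    and "\<lbrakk>y \<in> V; 0 \<le> t\<rbrakk> \<Longrightarrow> lower_along q x y \<le> q (y + s (of_real t) x) - t * q x"
proof -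
  let ?D = "lower_along q x"
  have bdd: "bdd_below ((\<lambda>t. q (y + s (of_real t) x) - t * q x) ` {0..})" if y: "y \<in> V" for y
  proof (rule bdd_belowI2)
    fix t :: real assume t: "t \<in> {0..}"
    have "t * q x = q ((y + s (of_real t) x) + (- y))"
      using sublinearD(2)[OF q, of t x] t x by simp
    also have "\<dots> \<le> q (y + s (of_real t) x) + q (- y)"
      using x y by (intro sublinearD(1)[OF q]) auto
    finally show "- q (- y) \<le> q (y + s (of_real t) x) - t * q x" by simp
  qed
  have le: "?D y \<le> q (y + s (of_real t) x) - t * q x" if "y \<in> V" "0 \<le> t" for y t
    using that by (auto simp: lower_along_def intro!: cINF_lower bdd)
  have ge: "b \<le> ?D y" if "y \<in> V" "\<And>t. 0 \<le> t \<Longrightarrow> b \<le> q (y + s (of_real t) x) - t * q x" for b y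
    using that by (auto simp: lower_along_def intro!: cINF_greatest)
  show "\<lbrakk>y \<in> V; 0 \<le> t\<rbrakk> \<Longrightarrow> ?D y \<le> q (y + s (of_real t) x) - t * q x"
    by (rule le)
  show "?D \<le> q"
  proof (rule le_funI)
    fix y show "?D y \<le> q y"
      using le[of y 0] sublinearD(3)[OF q, of y] by (cases "y \<in> V") (auto simp: lower_along_def)
  qed
  show "sublinear ?D"
    unfolding sublinear_def
  proof (intro conjI ballI allI impI)
    fix y z assume yz: "y \<in> V" "z \<in> V"
    have *: "?D (y + z) \<le> (q (y + s (of_real t) x) - t * q x) + (q (z + s (of_real u) x) - u * q x)"
      if "0 \<le> t" "0 \<le> u" for t u
    proof -
      have "?D (y + z) \<le> q ((y + z) + s (of_real (t + u)) x) - (t + u) * q x"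
        using that yz by (intro le) auto
      also have "(y + z) + s (of_real (t + u)) x = (y + s (of_real t) x) + (z + s (of_real u) x)"
        by (simp add: scale_left_distrib algebra_simps)
      also have "q \<dots> \<le> q (y + s (of_real t) x) + q (z + s (of_real u) x)"
        using x yz by (intro sublinearD(1)[OF q]) auto
      finally show ?thesis by (simp add: algebra_simps)
    qed
    have "?D (y + z) - (q (y + s (of_real t) x) - t * q x) \<le> ?D z" if "0 \<le> t" for t
      using that yz *[OF that] by (intro ge) (auto simp: algebra_simps)
    then have "?D (y + z) - ?D z \<le> ?D y"
      using yz by (intro ge) (auto simp: algebra_simps)
    then show "?D (y + z) \<le> ?D y + ?D z" by simp
  next
    have pos: "?D (s (of_real r) y) \<le> r * ?D y" if r: "0 < r" and y: "y \<in> V" for r y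
    proof -
      have "?D (s (of_real r) y) / r \<le> ?D y"
      proof (rule ge[OF y])
        fix t :: real assume t: "0 \<le> t"
        have "?D (s (of_real r) y) \<le> q (s (of_real r) y + s (of_real (r * t)) x) - r * t * q x"
          using r t y by (intro le) auto
        also have "s (of_real r) y + s (of_real (r * t)) x = s (of_real r) (y + s (of_real t) x)"
          by (simp add: scale_right_distrib)
        also have "q \<dots> = r * q (y + s (of_real t) x)"
          using r x y by (intro sublinearD(2)[OF q]) auto
        also have "r * q (y + s (of_real t) x) - r * t * q x = (q (y + s (of_real t) x) - t * q x) * r"
          by (simp add: algebra_simps)
        finally show "?D (s (of_real r) y) / r \<le> q (y + s (of_real t) x) - t * q x"
          using r by (simp only: pos_divide_le_eq)
      qed
      then show ?thesis using r by (simp add: pos_divide_le_eq mult.commute)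
    qed
    fix r :: real and y assume r: "0 \<le> r" and y: "y \<in> V"
    show "?D (s (of_real r) y) = r * ?D y"
    proof (cases "r = 0")
      case True
      have "?D 0 \<le> 0" "0 \<le> ?D 0"
        using le[of 0 0] ge[of 0 0] sublinearD(2,4)[OF q] x by auto
      then show ?thesis using True by simp
    next
      case False
      with r have r: "0 < r" by simp
      have "?D (s (of_real (1 / r)) (s (of_real r) y)) \<le> 1 / r * ?D (s (of_real r) y)"
        using r y by (intro pos) auto
      moreover have "s (of_real (1 / r)) (s (of_real r) y) = y"
        using r by simp
      ultimately have "r * ?D y \<le> ?D (s (of_real r) y)"
        using r by (simp add: field_simps)
      then show ?thesis using pos[OF r y] by simp
    qed
  next
    fix y assume "y \<notin> V" then show "?D y = 0" by (simp add: lower_along_def)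
  qed
qed

lemma minimal_sublinear_linear:
  assumes q: "sublinear q" and min: "\<And>r. \<lbrakk>sublinear r; r \<le> q\<rbrakk> \<Longrightarrow> r = q"
    and "x \<in> V" "y \<in> V"
  shows "q (x + y) = q x + q y"
proof -
  have "lower_along q x = q"
    using lower_along[OF q \<open>x \<in> V\<close>] min by blast
  then have "q y \<le> q (y + x) - q x"
    using lower_along(3)[OF q \<open>x \<in> V\<close> \<open>y \<in> V\<close>, of 1] by simp
  then show ?thesis
    using sublinearD(1)[OF q assms(3,4)] by (simp add: add.commute)
qed

section \<open>The dual unit ball and norming functionals\<close>

definition dual_ball :: "('v \<Rightarrow> complex) set" where
  "dual_ball = {\<phi>. (\<forall>x\<in>V. \<forall>y\<in>V. \<phi> (x + y) = \<phi> x + \<phi> y) \<and>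
     (\<forall>c. \<forall>x\<in>V. \<phi> (s c x) = c * \<phi> x) \<and> (\<forall>x\<in>V. cmod (\<phi> x) \<le> N x)}"

lemma dual_ballD:
  assumes "\<phi> \<in> dual_ball"
  shows "\<lbrakk>x \<in> V; y \<in> V\<rbrakk> \<Longrightarrow> \<phi> (x + y) = \<phi> x + \<phi> y"
    and "x \<in> V \<Longrightarrow> \<phi> (s c x) = c * \<phi> x"
    and "x \<in> V \<Longrightarrow> cmod (\<phi> x) \<le> N x"
    and "\<phi> 0 = 0"
    and "\<lbrakk>x \<in> V; y \<in> V\<rbrakk> \<Longrightarrow> \<phi> (x - y) = \<phi> x - \<phi> y"
proof -
  show *: "\<lbrakk>x \<in> V; y \<in> V\<rbrakk> \<Longrightarrow> \<phi> (x + y) = \<phi> x + \<phi> y" "x \<in> V \<Longrightarrow> \<phi> (s c x) = c * \<phi> x"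
    "x \<in> V \<Longrightarrow> cmod (\<phi> x) \<le> N x" for x y c
    using assms by (auto simp: dual_ball_def)
  show "\<phi> 0 = 0" using *(2)[of 0 0] by simp
  show "\<phi> (x - y) = \<phi> x - \<phi> y" if "x \<in> V" "y \<in> V"
    using *(1)[of x "- y"] *(2)[of y "-1"] that by simp
qed

text \<open>The Hahn-Banach theorem.  Lowering the seminorm along \<open>x\<close> before passing to a minimal functional \<open>u\<close> forces
  \<open>u (- x) \<le> - N x\<close>, hence \<open>u x = N x\<close>.  The complex functional with real part \<open>u\<close> is bounded by \<open>N\<close> because
  multiplication by a unimodular scalar makes its value real.\<close>

theorem exists_norming_functional:
  assumes x: "x \<in> V"
  obtains \<phi> where "\<phi> \<in> dual_ball" "cmod (\<phi> x) = N x"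
proof -
  define p where "p y = (if y \<in> V then N y else 0)" for y
  have p: "sublinear p"
    by (auto simp: sublinear_def p_def N_add N_s)
  obtain u where u: "sublinear u" "u \<le> lower_along p x"
    and min: "\<And>r. \<lbrakk>sublinear r; r \<le> u\<rbrakk> \<Longrightarrow> r = u"
    by (rule exists_minimal_sublinear[OF lower_along(1)[OF p x]], rule that)
  have u_le: "u y \<le> N y" if "y \<in> V" for y
  proof -
    have "u y \<le> p y"
      using u(2) lower_along(2)[OF p x] by (meson le_funD order_trans)
    then show ?thesis using that by (simp add: p_def)
  qed
  have add: "u (y + z) = u y + u z" if "y \<in> V" "z \<in> V" for y z
    using minimal_sublinear_linear[OF u(1) min that] .
  have neg: "u (- y) = - u y" if "y \<in> V" for y
    using add[of y "- y"] that sublinearD(4)[OF u(1)] by simp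
  have real: "u (s (of_real t) y) = t * u y" if y: "y \<in> V" for t y
  proof (cases "0 \<le> t")
    case False
    then have "u (s (of_real (- t)) y) = - t * u y"
      using y by (intro sublinearD(2)[OF u(1)]) auto
    then show ?thesis using neg[of "s (of_real t) y"] y by simp
  qed (use sublinearD(2)[OF u(1)] y in auto)
  have cpx: "u (s c y) = Re c * u y + Im c * u (s \<i> y)" if y: "y \<in> V" for c y
  proof -
    have "s c y = s (of_real (Re c)) y + s (of_real (Im c)) (s \<i> y)"
      by (subst complex_eq[of c]) (simp add: scale_left_distrib mult.commute)
    then show ?thesis using y by (simp add: add real del: scale_scale)
  qed
  define \<phi> where "\<phi> y = Complex (u y) (- u (s \<i> y))" for y
  have hom: "\<phi> (s c y) = c * \<phi> y" if "y \<in> V" for c y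
    using cpx[OF that, of c] cpx[OF that, of "\<i> * c"]
    by (simp add: \<phi>_def complex_eq_iff algebra_simps)
  have bound: "cmod (\<phi> y) \<le> N y" if y: "y \<in> V" for y
  proof (cases "\<phi> y = 0")
    case True
    then show ?thesis using N_ge_0[OF y] by simp
  next
    case False
    define c where "c = cnj (\<phi> y) / cmod (\<phi> y)"
    have c: "cmod c = 1" "c * \<phi> y = cmod (\<phi> y)"
      using False by (auto simp: c_def norm_divide complex_norm_square[symmetric] mult.commute power2_eq_square)
    have "cmod (\<phi> y) = Re (\<phi> (s c y))"
      using c hom[OF y, of c] by simp
    also have "\<dots> \<le> N (s c y)"
      using y by (simp add: \<phi>_def u_le)
    finally show ?thesis using c N_s[OF y] by simp
  qed
  have "\<phi> (y + z) = \<phi> y + \<phi> z" if "y \<in> V" "z \<in> V" for y z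
    using that by (simp add: \<phi>_def complex_eq_iff add scale_right_distrib)
  then have "\<phi> \<in> dual_ball"
    unfolding dual_ball_def using hom bound by blast
  moreover have "N x \<le> cmod (\<phi> x)"
  proof -
    have "u (- x) \<le> p (- x + s (of_real 1) x) - 1 * p x"
      using le_funD[OF u(2), of "- x"] lower_along(3)[OF p x, of "- x" 1] x by simp
    then have "N x \<le> u x"
      using x neg[OF x] by (simp add: p_def)
    then show ?thesis
      using abs_Re_le_cmod[of "\<phi> x"] by (simp add: \<phi>_def)
  qed
  ultimately show ?thesis
    by (intro that[of \<phi>] antisym bound[OF x])
qed

lemma N_le_dualI:
  assumes "x \<in> V" "\<And>\<phi>. \<phi> \<in> dual_ball \<Longrightarrow> cmod (\<phi> x) \<le> B"
  shows "N x \<le> B"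
proof -
  obtain \<phi> where "\<phi> \<in> dual_ball" "cmod (\<phi> x) = N x"
    by (rule exists_norming_functional[OF assms(1)])
  then show ?thesis using assms(2) by force
qed

end

section \<open>Scalar functions on the strip\<close>

lemma interior_strip: "interior strip = {z. 0 < Re z \<and> Re z < 1}"
proof -
  have "strip = {z. inner 1 z \<ge> (0::real)} \<inter> {z. inner 1 z \<le> (1::real)}"
    by (auto simp: strip_def inner_complex_def)
  then have "interior strip = interior {z. inner 1 z \<ge> (0::real)} \<inter> interior {z::complex. inner 1 z \<le> (1::real)}"
    by (metis interior_Int)
  also have "\<dots> = {z. 0 < Re z \<and> Re z < 1}"
    by (subst interior_halfspace_ge, simp, subst interior_halfspace_le, simp) (auto simp: inner_complex_def)
  finally show ?thesis .
qed

lemma strip_boundary: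
  assumes "z \<in> strip" "z \<notin> interior strip"
  obtains t where "z = \<i> * of_real t" | t where "z = 1 + \<i> * of_real t"
proof -
  have "Re z = 0 \<or> Re z = 1"
    using assms unfolding interior_strip by (auto simp: strip_def)
  then show ?thesis
    using that by (metis complex_eq of_real_0 of_real_1 add_0)
qed

lemma boundary_in_strip [simp, intro]: "\<i> * of_real t \<in> strip" "1 + \<i> * of_real t \<in> strip"
  by (auto simp: strip_def)

text \<open>A Phragmen-Lindeloef argument: the factor \<open>exp (e (w\<^sup>2 - 1))\<close> has modulus at most 1 on the strip and
  decays as the imaginary part grows, so for a bounded function the ordinary maximum principle applies on
  a sufficiently high rectangle.  Then \<open>e\<close> tends to 0.\<close>

lemma strip_maximum_principle:
  assumes cont: "continuous_on strip h" and hol: "h holomorphic_on interior strip"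
    and bdd: "\<And>z. z \<in> strip \<Longrightarrow> cmod (h z) \<le> K"
    and left: "\<And>t. cmod (h (\<i> * of_real t)) \<le> B" and right: "\<And>t. cmod (h (1 + \<i> * of_real t)) \<le> B"
    and z: "z \<in> strip"
  shows "cmod (h z) \<le> B"
proof (cases "z \<in> interior strip")
  case False
  then show ?thesis using strip_boundary[OF z] left right by metis
next
  case zi: True
  have B0: "0 \<le> B" using left[of 0] norm_ge_zero order_trans by blast
  have K0: "0 \<le> K" using bdd[OF z] norm_ge_zero order_trans by blast
  have damped: "exp (- e * (1 + (Im z)\<^sup>2)) * cmod (h z) \<le> B" if e: "e > 0" for e :: real
  proof -
    define g where "g w = exp (of_real e * (w\<^sup>2 - 1)) * h w" for w
    have ng: "cmod (g w) = exp (e * ((Re w)\<^sup>2 - (Im w)\<^sup>2 - 1)) * cmod (h w)" for w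
      by (simp add: g_def norm_mult norm_exp power2_eq_square)
    have weight: "exp (e * ((Re w)\<^sup>2 - (Im w)\<^sup>2 - 1)) \<le> exp (- e * (Im w)\<^sup>2)" if "w \<in> strip" for w
    proof -
      have "(Re w)\<^sup>2 \<le> 1" using that by (simp add: strip_def power_le_one)
      then have "e * ((Re w)\<^sup>2 - (Im w)\<^sup>2 - 1) \<le> e * (- (Im w)\<^sup>2)"
        using e by (intro mult_left_mono) auto
      then show ?thesis by simp
    qed
    have decay: "((\<lambda>R. K * exp (- e * R\<^sup>2)) \<longlongrightarrow> 0) at_top"
      using e by real_asymp
    have bound: "cmod (g z) \<le> B'" if B': "B' > B" for B'
    proof -
      have "\<forall>\<^sub>F R in at_top. K * exp (- e * R\<^sup>2) < B'"
        using order_tendstoD(2)[OF decay] B' B0 by simp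
      then have "\<forall>\<^sub>F R in at_top. K * exp (- e * R\<^sup>2) < B' \<and> \<bar>Im z\<bar> < R"
        using eventually_gt_at_top[of "\<bar>Im z\<bar>"] by (rule eventually_conj)
      then obtain R where R: "K * exp (- e * R\<^sup>2) < B'" "\<bar>Im z\<bar> < R"
        by (auto simp: eventually_at_top_linorder)
      let ?S = "box (Complex 0 (-R)) (Complex 1 R)"
      have S: "?S \<subseteq> interior strip" "?S \<noteq> {}" "z \<in> ?S"
        using zi R by (auto simp: interior_strip in_box_complex_iff box_eq_empty Basis_complex_def)
      have clS: "closure ?S = cbox (Complex 0 (-R)) (Complex 1 R)"
        using S(2) by (rule closure_box)
      have clS': "closure ?S \<subseteq> strip"
        unfolding clS by (auto simp: strip_def in_cbox_complex_iff)
      have "continuous_on strip g"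
        unfolding g_def by (intro continuous_intros cont)
      then have g_cont: "continuous_on (closure ?S) g"
        by (rule continuous_on_subset[OF _ clS'])
      have "g holomorphic_on interior strip"
        unfolding g_def by (intro holomorphic_intros hol)
      then have g_hol: "g holomorphic_on interior ?S"
        using S(1) by (simp add: interior_open open_box holomorphic_on_subset)
      have g_frontier: "cmod (g w) \<le> B'" if w: "w \<in> frontier ?S" for w
      proof -
        have w': "w \<in> cbox (Complex 0 (-R)) (Complex 1 R)" "w \<notin> ?S"
          using w by (simp_all add: frontier_def clS interior_open open_box)
        then have ws: "w \<in> strip" using clS clS' by blast
        have "Re w = 0 \<or> Re w = 1 \<or> \<bar>Im w\<bar> = R"
          using w' by (auto simp: in_box_complex_iff in_cbox_complex_iff)
        then consider "Re w = 0 \<or> Re w = 1" | "\<bar>Im w\<bar> = R" by blast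
        then show ?thesis
        proof cases
          case 1
          then have "w \<notin> interior strip" by (auto simp: interior_strip)
          then have "cmod (h w) \<le> B"
            using strip_boundary[OF ws] left right by metis
          moreover have "exp (e * ((Re w)\<^sup>2 - (Im w)\<^sup>2 - 1)) \<le> 1"
            using weight[OF ws] e by (smt (verit) exp_le_one_iff mult_nonneg_nonneg zero_le_power2 mult_minus_left)
          ultimately have "cmod (g w) \<le> 1 * B"
            unfolding ng by (intro mult_mono) auto
          then show ?thesis using B' by simp
        next
          case 2
          then have "(Im w)\<^sup>2 = R\<^sup>2" by (metis power2_abs)
          then have "cmod (g w) \<le> exp (- e * R\<^sup>2) * K"
            unfolding ng using weight[OF ws] bdd[OF ws] by (intro mult_mono) auto
          then show ?thesis using R by (simp add: mult.commute)
        qed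
      qed
      show ?thesis
        by (rule maximum_modulus_frontier[OF g_hol g_cont bounded_box g_frontier S(3)])
    qed
    have "cmod (g z) \<le> B"
      by (rule dense_ge) (rule bound)
    moreover have "exp (- e * (1 + (Im z)\<^sup>2)) \<le> exp (e * ((Re z)\<^sup>2 - (Im z)\<^sup>2 - 1))"
      using e by (simp add: algebra_simps)
    ultimately show ?thesis
      unfolding ng by (meson mult_right_mono norm_ge_zero order_trans)
  qed
  have "((\<lambda>e. exp (- e * (1 + (Im z)\<^sup>2)) * cmod (h z)) \<longlongrightarrow> exp (- 0 * (1 + (Im z)\<^sup>2)) * cmod (h z)) (at_right 0)"
    by (intro tendsto_intros)
  moreover have "\<forall>\<^sub>F e in at_right 0. exp (- e * (1 + (Im z)\<^sup>2)) * cmod (h z) \<le> B"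
    using eventually_at_right_less by (rule eventually_mono) (rule damped)
  ultimately have "exp (- 0 * (1 + (Im z)\<^sup>2)) * cmod (h z) \<le> B"
    by (rule tendsto_upperbound) simp
  then show ?thesis by simp
qed

text \<open>The second-order Taylor bound makes difference quotients of a bounded holomorphic function
  converge at a rate that depends only on the bound and the radius.\<close>

lemma difference_quotient_bound:
  assumes hol: "h holomorphic_on ball z (2 * r)" and r: "r > 0"
    and bdd: "\<And>w. w \<in> ball z (2 * r) \<Longrightarrow> cmod (h w) \<le> K"
    and w: "w \<in> ball z (r/2)" "w \<noteq> z"
  shows "cmod ((h w - h z) / (w - z) - deriv h z) \<le> 8 * K / r\<^sup>2 * cmod (w - z)"
proof -
  have hd: "(h has_field_derivative deriv h x) (at x)"
    and hdd: "(deriv h has_field_derivative deriv (deriv h) x) (at x)" if "x \<in> ball z (2 * r)" for x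
    using holomorphic_derivI[OF hol open_ball that]
      holomorphic_derivI[OF holomorphic_deriv[OF hol open_ball] open_ball that] by blast+
  have d2: "cmod (deriv (deriv h) x) \<le> 8 * K / r\<^sup>2" if x: "x \<in> ball z (r/2)" for x
  proof -
    have sub: "cball x (r/2) \<subseteq> ball z (2 * r)"
    proof
      fix y assume "y \<in> cball x (r/2)"
      then have "dist z y < r/2 + r/2"
        using x dist_triangle[of z y x] by (simp add: dist_commute)
      then show "y \<in> ball z (2 * r)" using r by simp
    qed
    have "cmod ((deriv ^^ 2) h x) \<le> fact 2 * K / (r/2) ^ 2"
    proof (rule Cauchy_inequality)
      show "h holomorphic_on ball x (r/2)"
        using hol sub by (meson ball_subset_cball holomorphic_on_subset order_trans)
      show "continuous_on (cball x (r/2)) h"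
        using hol sub by (meson holomorphic_on_subset holomorphic_on_imp_continuous_on)
      show "cmod (h y) \<le> K" if "cmod (x - y) = r/2" for y
        using that sub by (intro bdd) (auto simp: dist_norm subset_iff)
    qed (use r in auto)
    then show ?thesis by (simp add: numeral_2_eq_2 power2_eq_square)
  qed
  define D where "D i = (deriv ^^ i) h" for i
  have "cmod (D 0 w - (\<Sum>i\<le>1. D i z * (w - z) ^ i / fact i)) \<le> 8 * K / r\<^sup>2 * cmod (w - z) ^ Suc 1 / fact 1"
  proof (rule complex_Taylor)
    show "convex (ball z (r/2))" by simp
    show "(D i has_field_derivative D (Suc i) x) (at x within ball z (r/2))"
      if "x \<in> ball z (r/2)" "i \<le> 1" for i x
    proof -
      have "x \<in> ball z (2 * r)" using that r by auto
      then have "(D i has_field_derivative D (Suc i) x) (at x)"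
        using hd[of x] hdd[of x] that by (cases i) (auto simp: D_def)
      then show ?thesis by (rule has_field_derivative_at_within)
    qed
    show "cmod (D (Suc 1) x) \<le> 8 * K / r\<^sup>2" if "x \<in> ball z (r/2)" for x
      using d2[OF that] by (simp add: D_def)
  qed (use w r in auto)
  then have *: "cmod (h w - h z - deriv h z * (w - z)) \<le> 8 * K / r\<^sup>2 * cmod (w - z) ^ 2"
    by (simp add: D_def power2_eq_square algebra_simps)
  have "(h w - h z) / (w - z) - deriv h z = (h w - h z - deriv h z * (w - z)) / (w - z)"
    using w by (simp add: divide_simps)
  then have "cmod ((h w - h z) / (w - z) - deriv h z) = cmod (h w - h z - deriv h z * (w - z)) / cmod (w - z)"
    by (simp add: norm_divide)
  also have "\<dots> \<le> 8 * K / r\<^sup>2 * cmod (w - z) ^ 2 / cmod (w - z)"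
    using * by (intro divide_right_mono) auto
  also have "\<dots> = 8 * K / r\<^sup>2 * cmod (w - z)"
    using w by (simp add: power2_eq_square)
  finally show ?thesis .
qed

text \<open>The bound away from the real axis keeps the quotient by \<open>u\<close> bounded outside a compact set; any
  positive constant would serve in place of 1/5.\<close>

definition disc_map :: "real \<Rightarrow> (complex \<Rightarrow> complex) \<Rightarrow> complex \<Rightarrow> bool" where
  "disc_map \<theta> u d \<longleftrightarrow>
     u holomorphic_on interior strip \<and> continuous_on strip u \<and> (\<forall>z\<in>strip. cmod (u z) \<le> 1) \<and>
     (\<forall>t. cmod (u (\<i> * of_real t)) = 1) \<and> (\<forall>t. cmod (u (1 + \<i> * of_real t)) = 1) \<and>
     (\<forall>z\<in>strip. u z = 0 \<longleftrightarrow> z = of_real \<theta>) \<and>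
     (u has_field_derivative d) (at (of_real \<theta>)) \<and> d \<noteq> 0 \<and>
     (\<forall>z\<in>strip. \<bar>Im z\<bar> > 1 \<longrightarrow> 1/5 \<le> cmod (u z))"

lemma disc_mapD:
  assumes "disc_map \<theta> u d"
  shows "u holomorphic_on interior strip" "continuous_on strip u"
    "\<And>z. z \<in> strip \<Longrightarrow> cmod (u z) \<le> 1"
    "\<And>t. cmod (u (\<i> * of_real t)) = 1" "\<And>t. cmod (u (1 + \<i> * of_real t)) = 1"
    "\<And>z. z \<in> strip \<Longrightarrow> u z = 0 \<longleftrightarrow> z = of_real \<theta>"
    "(u has_field_derivative d) (at (of_real \<theta>))" "d \<noteq> 0"
    "\<And>z. \<lbrakk>z \<in> strip; \<bar>Im z\<bar> > 1\<rbrakk> \<Longrightarrow> 1/5 \<le> cmod (u z)"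
  using assms unfolding disc_map_def by blast+

text \<open>The map \<open>z \<mapsto> exp (\<i> \<pi> z)\<close> sends the strip to the closed upper half plane without 0, and the
  Moebius map \<open>w \<mapsto> (w - a) / (w - cnj a)\<close> sends the half plane to the disc, the point \<open>a\<close> to 0 and
  the real line to the unit circle.\<close>

lemma exists_disc_map:
  assumes "0 < \<theta>" "\<theta> < 1"
  shows "\<exists>u d. disc_map \<theta> u d"
  unfolding disc_map_def
proof (intro exI conjI ballI allI impI)
  define E where "E z = exp (\<i> * of_real pi * z)" for z
  define a where "a = E (of_real \<theta>)"
  define u where "u z = (E z - a) / (E z - cnj a)" for z
  have E: "Re (E z) = exp (- pi * Im z) * cos (pi * Re z)" "Im (E z) = exp (- pi * Im z) * sin (pi * Re z)"
    "cmod (E z) = exp (- pi * Im z)" for z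
    by (simp_all add: E_def Re_exp Im_exp norm_exp)
  have ImE: "0 \<le> Im (E z)" if "z \<in> strip" for z
    using that unfolding E by (intro mult_nonneg_nonneg sin_ge_zero) (auto simp: strip_def mult_le_cancel_left1)
  have Ima: "0 < Im a"
    unfolding a_def E using assms by (intro mult_pos_pos sin_gt_zero) auto
  have na: "cmod a = 1"
    by (simp add: a_def E)
  have den: "E z - cnj a \<noteq> 0" if "z \<in> strip" for z
    using ImE[OF that] Ima by (auto simp: complex_eq_iff)
  have th: "of_real \<theta> \<in> strip" using assms by (auto simp: strip_def)
  have hE: "E holomorphic_on S" for S
    unfolding E_def by (intro holomorphic_intros)
  show "u holomorphic_on interior strip"
    unfolding u_def using den interior_subset[of strip] by (intro holomorphic_intros hE) auto
  show "continuous_on strip u"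
    unfolding u_def using den by (intro continuous_intros holomorphic_on_imp_continuous_on[OF hE]) auto
  have sq: "(cmod (E z - cnj a))\<^sup>2 - (cmod (E z - a))\<^sup>2 = 4 * Im (E z) * Im a" for z
    by (simp add: cmod_power2) (simp add: power2_eq_square algebra_simps)
  show "cmod (u z) \<le> 1" if "z \<in> strip" for z
  proof -
    have "(cmod (E z - a))\<^sup>2 \<le> (cmod (E z - cnj a))\<^sup>2"
      using sq[of z] ImE[OF that] Ima by (smt (verit) mult_nonneg_nonneg)
    then have "cmod (E z - a) \<le> cmod (E z - cnj a)"
      by (rule power2_le_imp_le) simp
    then show ?thesis
      using den[OF that] by (simp add: u_def norm_divide)
  qed
  have unit: "cmod (u z) = 1" if "z \<in> strip" "Im (E z) = 0" for z
  proof -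
    have "(cmod (E z - a))\<^sup>2 = (cmod (E z - cnj a))\<^sup>2"
      using sq[of z] that by simp
    then have "cmod (E z - a) = cmod (E z - cnj a)"
      by (simp add: power2_eq_iff_nonneg)
    then show ?thesis
      using den[OF that(1)] by (simp add: u_def norm_divide)
  qed
  show "cmod (u (\<i> * of_real t)) = 1" "cmod (u (1 + \<i> * of_real t)) = 1" for t
    by (auto intro!: unit simp: E)
  show "u z = 0 \<longleftrightarrow> z = of_real \<theta>" if z: "z \<in> strip" for z
  proof
    assume "u z = 0"
    then have eq: "E z = E (of_real \<theta>)"
      using den[OF z] by (simp add: u_def a_def)
    have "cmod (E z) = cmod (E (of_real \<theta>))"
      using eq by simp
    then have Im: "Im z = 0"
      by (simp add: E)
    have cos: "cos (pi * Re z) = cos (pi * \<theta>)"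
      using arg_cong[OF eq, of Re] Im by (simp add: E)
    have range: "0 \<le> pi * Re z" "pi * Re z \<le> pi" "0 \<le> pi * \<theta>" "pi * \<theta> \<le> pi"
      using z assms mult_left_mono[of "Re z" 1 pi] mult_left_mono[of \<theta> 1 pi]
      by (simp_all add: strip_def)
    have "pi * Re z = pi * \<theta>"
      by (rule cos_inj_pi[OF range cos])
    with Im show "z = of_real \<theta>"
      by (simp add: complex_eq_iff)
  qed (simp add: u_def a_def)
  have dE: "(E has_field_derivative \<i> * of_real pi * E z) (at z)" for z
    unfolding E_def by (auto intro!: derivative_eq_intros)
  have den': "a - cnj a \<noteq> 0"
    using den[OF th] by (simp add: a_def)
  show "(u has_field_derivative \<i> * of_real pi * a / (a - cnj a)) (at (of_real \<theta>))"
    unfolding u_def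
    by (rule derivative_eq_intros dE refl)+ (use den' in \<open>auto simp: a_def[symmetric] divide_simps\<close>)
  have "a \<noteq> 0" using na by auto
  then show "\<i> * of_real pi * a / (a - cnj a) \<noteq> 0"
    using den' by simp
  show "1/5 \<le> cmod (u z)" if z: "z \<in> strip" and Im: "\<bar>Im z\<bar> > 1" for z
  proof -
    have 2: "2 \<le> exp (pi * \<bar>Im z\<bar>)"
    proof -
      have "1 \<le> pi * \<bar>Im z\<bar>"
        using Im pi_gt3 by (smt (verit) mult_less_cancel_left2 mult_le_cancel_left1)
      then show ?thesis using exp_ge_add_one_self[of "pi * \<bar>Im z\<bar>"] by linarith
    qed
    \<comment> \<open>far up \<open>E z\<close> is close to 0, far down it is large; in both cases it stays away from \<open>a\<close>, which has
      modulus 1\<close>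
    have far: "1/2 \<le> cmod (E z - a)"
    proof (cases "Im z > 0")
      case True
      then have "cmod (E z) = 1 / exp (pi * \<bar>Im z\<bar>)"
        by (simp add: E exp_minus inverse_eq_divide)
      then have "cmod (E z) \<le> 1/2" using frac_le[OF _ order.refl _ 2, of 1] by simp
      then show ?thesis using norm_triangle_ineq2[of a "E z"] na by (simp add: norm_minus_commute)
    next
      case False
      then have "2 \<le> cmod (E z)" using 2 Im by (simp add: E)
      then show ?thesis using norm_triangle_ineq2[of "E z" a] na by simp
    qed
    have "cmod (E z - cnj a) \<le> cmod (E z - a) + cmod (a - cnj a)"
      using norm_triangle_ineq[of "E z - a" "a - cnj a"] by simp
    also have "cmod (a - cnj a) \<le> 2"
      using norm_triangle_ineq4[of a "cnj a"] na by simp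
    finally have "cmod (E z - cnj a) \<le> 5 * cmod (E z - a)"
      using far by simp
    then show ?thesis
      using den[OF z] by (simp add: u_def norm_divide field_simps)
  qed
qed

section \<open>Continuity with respect to a norm\<close>

lemma atin_top_of_set:
  assumes "z \<in> S"
  shows "atin (top_of_set S) z = at z within S"
proof (rule filter_eqI)
  fix P
  show "eventually P (atin (top_of_set S) z) \<longleftrightarrow> eventually P (at z within S)"
    unfolding atin_subtopology_within[OF assms] eventually_atin_within eventually_at_topological
    by (simp add: imp_conjL) blast
qed

lemma (in cnormed) continuous_map_iff:
  "continuous_map (top_of_set S) met.mtopology f \<longleftrightarrow>
     (\<forall>z\<in>S. f z \<in> carrier M) \<and> (\<forall>z\<in>S. ((\<lambda>w. N (f w \<ominus> f z)) \<longlongrightarrow> 0) (at z within S))"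
proof
  assume cont: "continuous_map (top_of_set S) met.mtopology f"
  have carr: "f z \<in> carrier M" if "z \<in> S" for z
    using continuous_map_image_subset_topspace[OF cont] that by auto
  show "(\<forall>z\<in>S. f z \<in> carrier M) \<and> (\<forall>z\<in>S. ((\<lambda>w. N (f w \<ominus> f z)) \<longlongrightarrow> 0) (at z within S))"
  proof (intro conjI ballI carr)
    fix z assume z: "z \<in> S"
    have "limitin met.mtopology f (f z) (at z within S)"
      using cont z by (simp add: continuous_map_atin atin_top_of_set)
    then have "((\<lambda>w. ndist (f w) (f z)) \<longlongrightarrow> 0) (at z within S)"
      by (simp add: met.limitin_metric_dist_null)
    moreover have "\<forall>\<^sub>F w in at z within S. ndist (f w) (f z) = N (f w \<ominus> f z)"
      using z by (auto simp: eventually_at_filter norm_dist_def carr)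
    ultimately show "((\<lambda>w. N (f w \<ominus> f z)) \<longlongrightarrow> 0) (at z within S)"
      by (rule Lim_transform_eventually)
  qed
next
  assume A: "(\<forall>z\<in>S. f z \<in> carrier M) \<and> (\<forall>z\<in>S. ((\<lambda>w. N (f w \<ominus> f z)) \<longlongrightarrow> 0) (at z within S))"
  have "limitin met.mtopology f (f z) (at z within S)" if z: "z \<in> S" for z
    unfolding met.limitin_metric_dist_null
  proof (intro conjI)
    show "f z \<in> carrier M" using A z by blast
    show "\<forall>\<^sub>F w in at z within S. f w \<in> carrier M"
      using A by (auto simp: eventually_at_filter)
    have "\<forall>\<^sub>F w in at z within S. N (f w \<ominus> f z) = ndist (f w) (f z)"
      using A z by (auto simp: eventually_at_filter norm_dist_def)
    moreover have "((\<lambda>w. N (f w \<ominus> f z)) \<longlongrightarrow> 0) (at z within S)"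
      using A z by blast
    ultimately show "((\<lambda>w. ndist (f w) (f z)) \<longlongrightarrow> 0) (at z within S)"
      by (rule Lim_transform_eventually[rotated])
  qed
  then show "continuous_map (top_of_set S) met.mtopology f"
    by (simp add: continuous_map_atin atin_top_of_set)
qed

context seminormed_subspace
begin

text \<open>Joint continuity of scalar multiplication, from \<open>c x - c\<^sub>0 x\<^sub>0 = c (x - x\<^sub>0) + (c - c\<^sub>0) x\<^sub>0\<close>.\<close>

lemma tendsto_scale:
  assumes "(c \<longlongrightarrow> c0) F" "((\<lambda>w. N (x w - x0)) \<longlongrightarrow> 0) F" and x: "\<And>w. x w \<in> V" "x0 \<in> V"
  shows "((\<lambda>w. N (s (c w) (x w) - s c0 x0)) \<longlongrightarrow> 0) F"
proof (rule Lim_null_comparison)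
  have "((\<lambda>w. cmod (c w) * N (x w - x0) + cmod (c w - c0) * N x0) \<longlongrightarrow> cmod c0 * 0 + cmod (c0 - c0) * N x0) F"
    by (intro tendsto_intros assms)
  then show "((\<lambda>w. cmod (c w) * N (x w - x0) + cmod (c w - c0) * N x0) \<longlongrightarrow> 0) F"
    by simp
  show "\<forall>\<^sub>F w in F. norm (N (s (c w) (x w) - s c0 x0)) \<le> cmod (c w) * N (x w - x0) + cmod (c w - c0) * N x0"
  proof (intro always_eventually allI)
    fix w
    have "s (c w) (x w) - s c0 x0 = s (c w) (x w - x0) + s (c w - c0) x0"
      by (simp add: scale_right_diff_distrib scale_left_diff_distrib)
    then have "N (s (c w) (x w) - s c0 x0) \<le> N (s (c w) (x w - x0)) + N (s (c w - c0) x0)"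
      using N_add[of "s (c w) (x w - x0)" "s (c w - c0) x0"] x by simp
    then show "norm (N (s (c w) (x w) - s c0 x0)) \<le> cmod (c w) * N (x w - x0) + cmod (c w - c0) * N x0"
      using x N_ge_0[of "s (c w) (x w) - s c0 x0"] by (simp add: N_s)
  qed
qed

lemma tendsto_plus:
  assumes "((\<lambda>w. N (x w - x0)) \<longlongrightarrow> 0) F" "((\<lambda>w. N (y w - y0)) \<longlongrightarrow> 0) F"
    and V: "\<And>w. x w \<in> V" "x0 \<in> V" "\<And>w. y w \<in> V" "y0 \<in> V"
  shows "((\<lambda>w. N ((x w + y w) - (x0 + y0))) \<longlongrightarrow> 0) F"
proof (rule Lim_null_comparison)
  show "((\<lambda>w. N (x w - x0) + N (y w - y0)) \<longlongrightarrow> 0) F"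
    using tendsto_add[OF assms(1,2)] by simp
  show "\<forall>\<^sub>F w in F. norm (N ((x w + y w) - (x0 + y0))) \<le> N (x w - x0) + N (y w - y0)"
  proof (intro always_eventually allI)
    fix w
    have eq: "(x w + y w) - (x0 + y0) = (x w - x0) + (y w - y0)" by simp
    show "norm (N ((x w + y w) - (x0 + y0))) \<le> N (x w - x0) + N (y w - y0)"
      unfolding eq using N_add[of "x w - x0" "y w - y0"] N_ge_0[of "(x w - x0) + (y w - y0)"] V by simp
  qed
qed

lemma tendsto_uniform_limit:
  assumes cont: "\<And>n. ((\<lambda>w. N (\<xi> n w - \<xi> n z)) \<longlongrightarrow> 0) F"
    and unif: "\<And>e. e > 0 \<Longrightarrow> \<exists>n. \<forall>w\<in>T. N (\<xi> n w - f w) \<le> e"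
    and T: "eventually (\<lambda>w. w \<in> T) F" "z \<in> T" and V: "\<And>n w. \<xi> n w \<in> V" "\<And>w. f w \<in> V"
  shows "((\<lambda>w. N (f w - f z)) \<longlongrightarrow> 0) F"
proof (rule tendstoI)
  fix e :: real assume "e > 0"
  then obtain n where n: "\<And>w. w \<in> T \<Longrightarrow> N (\<xi> n w - f w) \<le> e/4"
    using unif[of "e/4"] by auto
  have "\<forall>\<^sub>F w in F. N (\<xi> n w - \<xi> n z) < e/4"
    using order_tendstoD(2)[OF cont[of n], of "e/4"] \<open>e > 0\<close> by simp
  then show "\<forall>\<^sub>F w in F. dist (N (f w - f z)) 0 < e"
    using T(1)
  proof eventually_elim
    case (elim w)
    have "N (f w - f z) \<le> N (f w - \<xi> n w) + N (\<xi> n w - f z)"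
      using V by (intro N_diff3) auto
    also have "N (\<xi> n w - f z) \<le> N (\<xi> n w - \<xi> n z) + N (\<xi> n z - f z)"
      using V by (intro N_diff3) auto
    also have "N (f w - \<xi> n w) = N (\<xi> n w - f w)"
      using V by (intro N_minus_commute) auto
    finally have "N (f w - f z) < e"
      using elim n[of w] n[OF T(2)] \<open>e > 0\<close> by linarith
    then show ?case
      using N_ge_0[of "f w - f z"] V by simp
  qed
qed

end

section \<open>Compatible couples\<close>

locale embedded_space = opspace X
  for X :: "'v::{topological_ab_group_add, t2_space} opspace" +
  fixes s :: "complex \<Rightarrow> 'v \<Rightarrow> 'v"
  assumes tvs: "complex_tvs s" and emb: "embedded_in X s"
begin

lemma ops [simp]: "add X = (+)" "zero X = 0" "smult X = s"
  using emb by (auto simp: embedded_in_def)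

lemma vector_space: "vector_space s"
  using tvs by (simp add: complex_tvs_def)

sublocale sub: seminormed_subspace s "carrier X" "vnorm X"
proof (intro seminormed_subspace.intro vector_space)
  show "0 \<in> carrier X" using M.zero_closed by simp
  fix x y c assume x: "x \<in> carrier X"
  show "s c x \<in> carrier X" using smult_in[OF x, of c] by simp
  show "vnorm X (s c x) = cmod c * vnorm X x" using N_smult[OF x, of c] by simp
  assume y: "y \<in> carrier X"
  show "x + y \<in> carrier X" using M.a_closed[OF x y] by simp
  show "vnorm X (x + y) \<le> vnorm X x + vnorm X y" using N_triangle[OF x y] by simp
qed

lemma diff_eq: "\<lbrakk>x \<in> carrier X; y \<in> carrier X\<rbrakk> \<Longrightarrow> x \<ominus>\<^bsub>X\<^esub> y = x - y"
  by (simp add: minus_conv_smult)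

lemma continuous_map_op_topology:
  "continuous_map (top_of_set S) (op_topology X) f \<longleftrightarrow>
     (\<forall>z\<in>S. f z \<in> carrier X) \<and> (\<forall>z\<in>S. ((\<lambda>w. vnorm X (f w - f z)) \<longlongrightarrow> 0) (at z within S))"
proof -
  have "((\<lambda>w. vnorm X (f w \<ominus>\<^bsub>X\<^esub> f z)) \<longlongrightarrow> 0) (at z within S) \<longleftrightarrow>
      ((\<lambda>w. vnorm X (f w - f z)) \<longlongrightarrow> 0) (at z within S)"
    if "\<forall>z\<in>S. f z \<in> carrier X" "z \<in> S" for z
  proof (rule filterlim_cong[OF refl refl])
    show "\<forall>\<^sub>F w in at z within S. vnorm X (f w \<ominus>\<^bsub>X\<^esub> f z) = vnorm X (f w - f z)"
      using that by (auto simp: eventually_at_filter diff_eq)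
  qed
  then show ?thesis
    unfolding op_topology_eq continuous_map_iff by blast
qed

text \<open>Continuity of the embedding, in the form in which it makes the sum norm definite.\<close>

lemma tendsto_zero_ambient:
  assumes "\<And>n. a n \<in> carrier X" "(\<lambda>n. vnorm X (a n)) \<longlonglongrightarrow> 0"
  shows "a \<longlonglongrightarrow> 0"
proof -
  have "vnorm X (a n \<ominus>\<^bsub>X\<^esub> 0) = vnorm X (a n)" for n
    using diff_eq[OF assms(1) sub.V_0] by simp
  then have "limitin (op_topology X) a 0 sequentially"
    unfolding op_topology_eq limitin_iff[OF assms(1)] using assms(2) sub.V_0 by simp
  moreover have "continuous_map (op_topology X) euclidean (\<lambda>x. x)"
    using emb by (simp add: embedded_in_def)
  ultimately have "limitin euclidean ((\<lambda>x. x) \<circ> a) 0 sequentially"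
    by (rule continuous_map_limit[rotated])
  then show ?thesis by (simp add: o_def)
qed

end

locale couple =
  fixes s :: "complex \<Rightarrow> 'v \<Rightarrow> 'v::{topological_ab_group_add, t2_space}"
    and X0 X1 :: "'v opspace"
  assumes compat: "compatible_couple s X0 X1"
begin

sublocale X0: embedded_space X0 s
  using compat by unfold_locales (auto simp: compatible_couple_def)

sublocale X1: embedded_space X1 s
  using compat by unfold_locales (auto simp: compatible_couple_def)

abbreviation Sig :: "'v set" where "Sig \<equiv> sum_carrier X0 X1"

abbreviation sn :: "'v \<Rightarrow> real" where "sn \<equiv> sum_norm X0 X1"

lemma Sig_I: "\<lbrakk>a \<in> carrier X0; b \<in> carrier X1\<rbrakk> \<Longrightarrow> a + b \<in> Sig"
  by (auto simp: sum_carrier_def)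

lemma sn_le:
  assumes "a \<in> carrier X0" "b \<in> carrier X1"
  shows "sn (a + b) \<le> vnorm X0 a + vnorm X1 b"
  unfolding sum_norm_def
proof (rule cInf_lower)
  show "vnorm X0 a + vnorm X1 b
      \<in> {vnorm X0 a' + vnorm X1 b' | a' b'. a' \<in> carrier X0 \<and> b' \<in> carrier X1 \<and> a + b = a' + b'}"
    using assms by blast
  show "bdd_below {vnorm X0 a' + vnorm X1 b' | a' b'. a' \<in> carrier X0 \<and> b' \<in> carrier X1 \<and> a + b = a' + b'}"
    by (rule bdd_belowI[of _ 0]) (auto intro!: add_nonneg_nonneg X0.N_nonneg X1.N_nonneg)
qed

lemma sn_ge:
  assumes "x \<in> Sig"
    and "\<And>a b. \<lbrakk>a \<in> carrier X0; b \<in> carrier X1; x = a + b\<rbrakk> \<Longrightarrow> c \<le> vnorm X0 a + vnorm X1 b"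
  shows "c \<le> sn x"
  unfolding sum_norm_def using assms
  by (intro cInf_greatest) (auto simp: sum_carrier_def)

lemma sn_decompose:
  assumes "x \<in> Sig" "sn x < c"
  obtains a b where "a \<in> carrier X0" "b \<in> carrier X1" "x = a + b" "vnorm X0 a + vnorm X1 b < c"
  using sn_ge[OF assms(1), of c] assms(2) by (meson not_le)

lemma X0_Sig: "a \<in> carrier X0 \<Longrightarrow> a \<in> Sig" and X1_Sig: "b \<in> carrier X1 \<Longrightarrow> b \<in> Sig"
  using Sig_I[of a 0] Sig_I[of 0 b] by simp_all

lemma sn_le_X0: "a \<in> carrier X0 \<Longrightarrow> sn a \<le> vnorm X0 a" and sn_le_X1: "b \<in> carrier X1 \<Longrightarrow> sn b \<le> vnorm X1 b"
  using sn_le[of a 0] sn_le[of 0 b] X0.sub.N_0 X1.sub.N_0 by simp_all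

sublocale \<Sigma>: seminormed_subspace s Sig sn
proof (intro seminormed_subspace.intro X0.vector_space)
  show "0 \<in> Sig" using X0_Sig[of 0] by simp
  fix x y assume x: "x \<in> Sig" and y: "y \<in> Sig"
  show "x + y \<in> Sig"
  proof -
    obtain a b a' b' where "a \<in> carrier X0" "b \<in> carrier X1" "x = a + b" "a' \<in> carrier X0" "b' \<in> carrier X1" "y = a' + b'"
      using x y unfolding sum_carrier_def by blast
    then show ?thesis using Sig_I[of "a + a'" "b + b'"] by (simp add: algebra_simps)
  qed
  show "sn (x + y) \<le> sn x + sn y"
  proof (rule field_le_epsilon)
    fix e :: real assume "e > 0"
    obtain a b where ab: "a \<in> carrier X0" "b \<in> carrier X1" "x = a + b" "vnorm X0 a + vnorm X1 b < sn x + e/2"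
      by (rule sn_decompose[OF x, of "sn x + e/2"]) (use \<open>e > 0\<close> in auto)
    obtain a' b' where ab': "a' \<in> carrier X0" "b' \<in> carrier X1" "y = a' + b'" "vnorm X0 a' + vnorm X1 b' < sn y + e/2"
      by (rule sn_decompose[OF y, of "sn y + e/2"]) (use \<open>e > 0\<close> in auto)
    have eq: "x + y = (a + a') + (b + b')" using ab ab' by (simp add: algebra_simps)
    have "sn (x + y) \<le> vnorm X0 (a + a') + vnorm X1 (b + b')"
      unfolding eq using ab(1,2) ab'(1,2) by (intro sn_le) auto
    also have "\<dots> \<le> (vnorm X0 a + vnorm X0 a') + (vnorm X1 b + vnorm X1 b')"
      using ab ab' by (intro add_mono X0.sub.N_add X1.sub.N_add)
    finally show "sn (x + y) \<le> sn x + sn y + e"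
      using ab(4) ab'(4) by linarith
  qed
next
  have *: "s c x \<in> Sig \<and> sn (s c x) \<le> cmod c * sn x" if x: "x \<in> Sig" for c x
  proof
    obtain a b where "a \<in> carrier X0" "b \<in> carrier X1" "x = a + b"
      using x unfolding sum_carrier_def by blast
    then show "s c x \<in> Sig" using Sig_I[of "s c a" "s c b"] by (simp add: X0.sub.scale_right_distrib)
    have dec: "sn (s c x) \<le> cmod c * (vnorm X0 a + vnorm X1 b)"
      if "a \<in> carrier X0" "b \<in> carrier X1" "x = a + b" for a b
      using sn_le[of "s c a" "s c b"] that
      by (simp add: X0.sub.scale_right_distrib X0.sub.N_s X1.sub.N_s distrib_left)
    show "sn (s c x) \<le> cmod c * sn x"
    proof (cases "c = 0")
      case True
      have "sn 0 \<le> 0" using sn_le[of 0 0] X0.sub.N_0 X1.sub.N_0 by simp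
      then show ?thesis using True by simp
    next
      case False
      then have "sn (s c x) / cmod c \<le> sn x"
        using dec by (intro sn_ge[OF x]) (simp add: pos_divide_le_eq mult.commute)
      then show ?thesis using False by (simp add: pos_divide_le_eq mult.commute)
    qed
  qed
  fix x c assume x: "x \<in> Sig"
  show "s c x \<in> Sig" using *[OF x] by blast
  show "sn (s c x) = cmod c * sn x"
  proof (rule antisym)
    show "sn (s c x) \<le> cmod c * sn x" using *[OF x] by blast
    show "cmod c * sn x \<le> sn (s c x)"
    proof (cases "c = 0")
      case True
      have "0 \<le> sn 0"
        using X0_Sig[of 0] by (intro sn_ge) (auto intro!: add_nonneg_nonneg X0.N_nonneg X1.N_nonneg)
      then show ?thesis using True by simp
    next
      case False
      then have "x = s (inverse c) (s c x)" by simp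
      then have "sn x \<le> cmod (inverse c) * sn (s c x)"
        using *[of "s c x" "inverse c"] *[OF x, of c] by simp
      then have "cmod c * sn x \<le> cmod c * (cmod (inverse c) * sn (s c x))"
        by (rule mult_left_mono) simp
      also have "\<dots> = sn (s c x)" using False by (simp add: norm_inverse)
      finally show ?thesis .
    qed
  qed
qed

text \<open>If \<open>x = a n + b n\<close> with both norms tending to 0, then \<open>a n\<close> and \<open>b n\<close> tend to 0 in the ambient
  space, and so does the constant sequence \<open>x\<close>; limits there are unique.\<close>

lemma sn_zero_imp:
  assumes x: "x \<in> Sig" and 0: "sn x = 0"
  shows "x = 0"
proof -
  have "\<exists>a b. a \<in> carrier X0 \<and> b \<in> carrier X1 \<and> x = a + b \<and> vnorm X0 a + vnorm X1 b < inverse (of_nat (Suc n))" for n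
  proof -
    have "sn x < inverse (of_nat (Suc n))" using 0 by simp
    then show ?thesis by (rule sn_decompose[OF x]) blast
  qed
  then obtain a b where ab: "\<And>n. a n \<in> carrier X0" "\<And>n. b n \<in> carrier X1" "\<And>n. x = a n + b n"
    "\<And>n. vnorm X0 (a n) + vnorm X1 (b n) < inverse (of_nat (Suc n))"
    by metis
  have "(\<lambda>n. vnorm X0 (a n)) \<longlonglongrightarrow> 0"
  proof (rule Lim_null_comparison[OF _ LIMSEQ_inverse_real_of_nat], intro always_eventually allI)
    fix n show "norm (vnorm X0 (a n)) \<le> inverse (real (Suc n))"
      using ab(4)[of n] X0.N_nonneg[OF ab(1)[of n]] X1.N_nonneg[OF ab(2)[of n]] by simp
  qed
  moreover have "(\<lambda>n. vnorm X1 (b n)) \<longlonglongrightarrow> 0"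
  proof (rule Lim_null_comparison[OF _ LIMSEQ_inverse_real_of_nat], intro always_eventually allI)
    fix n show "norm (vnorm X1 (b n)) \<le> inverse (real (Suc n))"
      using ab(4)[of n] X0.N_nonneg[OF ab(1)[of n]] X1.N_nonneg[OF ab(2)[of n]] by simp
  qed
  ultimately have "(\<lambda>n. a n + b n) \<longlonglongrightarrow> 0 + 0"
    by (intro tendsto_add X0.tendsto_zero_ambient X1.tendsto_zero_ambient ab)
  then have "(\<lambda>n::nat. x) \<longlonglongrightarrow> 0"
    using ab(3) by simp
  then show ?thesis
    by (simp add: LIMSEQ_const_iff)
qed

lemma sn_eq_0_iff: "x \<in> Sig \<Longrightarrow> sn x = 0 \<longleftrightarrow> x = 0"
  using sn_zero_imp \<Sigma>.N_0 by blast

text \<open>The sum is the image of the direct sum under addition and inherits its module structure and its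
  completeness.\<close>

definition Sigma_space :: "(complex, 'v) module" where
  "Sigma_space = ambient s\<lparr>carrier := Sig\<rparr>"

lemma Sigma_space_simps [simp]:
  "carrier Sigma_space = Sig" "add Sigma_space = (+)" "zero Sigma_space = 0" "smult Sigma_space = s"
  by (simp_all add: Sigma_space_def ambient_def)

lemma linear_map_plus: "linear_map (op_sum X0 X1) Sigma_space (\<lambda>u. fst u + snd u)"
  by (auto simp: linear_map_def Sig_I algebra_simps X0.sub.scale_right_distrib)

lemma onto_Sigma: "(\<lambda>u. fst u + snd u) ` carrier (op_sum X0 X1) = carrier Sigma_space"
  by (force simp: sum_carrier_def)

sublocale \<Sigma>n: cnormed Sigma_space sn
proof (intro cnormed.intro cnormed_axioms.intro)
  show "cmodule Sigma_space"
    by (rule cmodule_image[OF cmodule_op_sum[OF X0.cmodule_axioms X1.cmodule_axioms] linear_map_plus onto_Sigma])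
qed (auto simp: sn_eq_0_iff \<Sigma>.N_s \<Sigma>.N_add)

lemma Sigma_diff: "\<lbrakk>x \<in> Sig; y \<in> Sig\<rbrakk> \<Longrightarrow> x \<ominus>\<^bsub>Sigma_space\<^esub> y = x - y"
  by (simp add: \<Sigma>n.minus_conv_smult)

lemma Sigma_mcomplete: "\<Sigma>n.met.mcomplete"
proof -
  interpret S: opspace "op_sum X0 X1"
    by unfold_locales (rule operator_space_op_sum[OF X0.operator_space X1.operator_space])
  show ?thesis
  proof (rule mcomplete_image[OF S.cnormed_axioms \<Sigma>n.cnormed_axioms S.mcomplete linear_map_plus])
    fix u assume "u \<in> carrier (op_sum X0 X1)"
    then have "fst u \<in> carrier X0" "snd u \<in> carrier X1" by auto
    then have "sn (fst u + snd u) \<le> vnorm X0 (fst u) + vnorm X1 (snd u)" by (rule sn_le)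
    then show "sn (fst u + snd u) \<le> 2 * vnorm (op_sum X0 X1) u"
      by (simp add: vnorm_op_sum)
  next
    fix x assume x: "x \<in> carrier Sigma_space"
    show "\<exists>u\<in>carrier (op_sum X0 X1). fst u + snd u = x \<and> vnorm (op_sum X0 X1) u \<le> 2 * sn x"
    proof (cases "x = 0")
      case True
      then show ?thesis
        by (intro bexI[of _ "(0, 0)"]) (auto simp: vnorm_op_sum)
    next
      case False
      then have "sn x < 2 * sn x"
        using x \<Sigma>.N_ge_0[of x] sn_eq_0_iff[of x] by simp
      moreover have "x \<in> Sig" using x by simp
      ultimately obtain a b where ab: "a \<in> carrier X0" "b \<in> carrier X1" "x = a + b" "vnorm X0 a + vnorm X1 b < 2 * sn x"
        by (metis sn_decompose)
      then show ?thesis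
        using X0.N_nonneg[OF ab(1)] X1.N_nonneg[OF ab(2)]
        by (intro bexI[of _ "(a, b)"]) (auto simp: vnorm_op_sum)
    qed
  qed
qed

lemma Sigma_complete:
  assumes "\<And>n. \<xi> n \<in> Sig" "\<And>e. e > 0 \<Longrightarrow> \<exists>n0. \<forall>m\<ge>n0. \<forall>n\<ge>n0. sn (\<xi> m - \<xi> n) < e"
  obtains l where "l \<in> Sig" "(\<lambda>n. sn (\<xi> n - l)) \<longlonglongrightarrow> 0"
proof (rule \<Sigma>n.mcompleteD[OF Sigma_mcomplete, of \<xi>])
  show "\<xi> n \<in> carrier Sigma_space" for n using assms by simp
  show "\<exists>n0. \<forall>m\<ge>n0. \<forall>n\<ge>n0. sn (\<xi> m \<ominus>\<^bsub>Sigma_space\<^esub> \<xi> n) < e" if "e > 0" for e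
    using assms(2)[OF that] by (simp add: Sigma_diff assms(1))
  fix l assume "l \<in> carrier Sigma_space" "(\<lambda>n. sn (\<xi> n \<ominus>\<^bsub>Sigma_space\<^esub> l)) \<longlonglongrightarrow> 0"
  then show thesis using that by (simp add: Sigma_diff assms(1))
qed

lemma sum_topology_eq: "sum_topology X0 X1 = \<Sigma>n.met.mtopology"
proof -
  have "norm_dist Sig (\<lambda>x y. x - y) sn = \<Sigma>n.ndist"
    by (auto simp: norm_dist_def fun_eq_iff Sigma_diff)
  then show ?thesis by (simp add: sum_topology_def)
qed

lemma continuous_map_sum_topology:
  "continuous_map (top_of_set S) (sum_topology X0 X1) f \<longleftrightarrow>
     (\<forall>z\<in>S. f z \<in> Sig) \<and> (\<forall>z\<in>S. ((\<lambda>w. sn (f w - f z)) \<longlongrightarrow> 0) (at z within S))"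
proof -
  have "((\<lambda>w. sn (f w \<ominus>\<^bsub>Sigma_space\<^esub> f z)) \<longlongrightarrow> 0) (at z within S) \<longleftrightarrow>
      ((\<lambda>w. sn (f w - f z)) \<longlongrightarrow> 0) (at z within S)"
    if "\<forall>z\<in>S. f z \<in> Sig" "z \<in> S" for z
  proof (rule filterlim_cong[OF refl refl])
    show "\<forall>\<^sub>F w in at z within S. sn (f w \<ominus>\<^bsub>Sigma_space\<^esub> f z) = sn (f w - f z)"
      using that by (auto simp: eventually_at_filter Sigma_diff)
  qed
  then show ?thesis
    unfolding sum_topology_eq \<Sigma>n.continuous_map_iff by (simp only: Sigma_space_simps) blast
qed

section \<open>Weak and strong holomorphy\<close>

lemma dual_separates:
  assumes "x \<in> Sig" "\<And>\<phi>. \<phi> \<in> \<Sigma>.dual_ball \<Longrightarrow> \<phi> x = 0"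
  shows "x = 0"
proof -
  have "sn x \<le> 0"
    using assms by (intro \<Sigma>.N_le_dualI) auto
  then show ?thesis
    using \<Sigma>.N_ge_0[OF assms(1)] sn_zero_imp[OF assms(1)] by simp
qed

lemma has_sum_deriv_imp_weak:
  assumes d: "has_sum_deriv s X0 X1 f L z" and f: "\<And>w. f w \<in> Sig" and \<phi>: "\<phi> \<in> \<Sigma>.dual_ball"
  shows "((\<lambda>w. \<phi> (f w)) has_field_derivative \<phi> L) (at z)"
proof -
  have L: "L \<in> Sig" and lim: "((\<lambda>w. sn (s (inverse (w - z)) (f w - f z) - L)) \<longlongrightarrow> 0) (at z)"
    using d by (auto simp: has_sum_deriv_def)
  have "((\<lambda>w. (\<phi> (f w) - \<phi> (f z)) / (w - z) - \<phi> L) \<longlongrightarrow> 0) (at z)"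
  proof (rule Lim_null_comparison[OF _ lim], intro always_eventually allI)
    fix w
    have "(\<phi> (f w) - \<phi> (f z)) / (w - z) - \<phi> L = \<phi> (s (inverse (w - z)) (f w - f z) - L)"
      using f L by (simp add: \<Sigma>.dual_ballD[OF \<phi>] divide_inverse mult.commute)
    then show "norm ((\<phi> (f w) - \<phi> (f z)) / (w - z) - \<phi> L) \<le> sn (s (inverse (w - z)) (f w - f z) - L)"
      using f L \<Sigma>.dual_ballD(3)[OF \<phi>, of "s (inverse (w - z)) (f w - f z) - L"] by simp
  qed
  then show ?thesis
    unfolding has_field_derivative_iff by (rule LIM_zero_cancel)
qed

lemma has_sum_deriv_unique:
  assumes "has_sum_deriv s X0 X1 f L z" "has_sum_deriv s X0 X1 f L' z" "\<And>w. f w \<in> Sig"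
  shows "L = L'"
proof -
  have L: "L \<in> Sig" "L' \<in> Sig" using assms by (auto simp: has_sum_deriv_def)
  have "\<phi> (L - L') = 0" if "\<phi> \<in> \<Sigma>.dual_ball" for \<phi>
    using DERIV_unique[OF has_sum_deriv_imp_weak[OF assms(1,3) that] has_sum_deriv_imp_weak[OF assms(2,3) that]]
      \<Sigma>.dual_ballD(5)[OF that L] by simp
  then have "L - L' = 0" using L by (intro dual_separates) auto
  then show ?thesis by simp
qed

text \<open>The bound \<open>difference_quotient_bound\<close> has the same constant for all functionals in the dual unit
  ball.  Taking the supremum over them, the difference quotients form a Cauchy family in the sum norm, and
  their limit is the derivative.\<close>

lemma weakly_holomorphic_imp_has_sum_deriv:
  assumes f: "\<And>w. f w \<in> Sig" and r: "r > 0"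
    and hol: "\<And>\<phi>. \<phi> \<in> \<Sigma>.dual_ball \<Longrightarrow> (\<lambda>w. \<phi> (f w)) holomorphic_on ball z (2 * r)"
    and bdd: "\<And>w. w \<in> ball z (2 * r) \<Longrightarrow> sn (f w) \<le> K"
  shows "\<exists>L. has_sum_deriv s X0 X1 f L z"
proof -
  define A where "A = 8 * K / r\<^sup>2"
  define D where "D w = s (inverse (w - z)) (f w - f z)" for w
  have D: "D w \<in> Sig" for w using f by (simp add: D_def)
  have D_close: "sn (D w - D w') \<le> A * (cmod (w - z) + cmod (w' - z))"
    if w: "w \<in> ball z (r/2)" "w \<noteq> z" "w' \<in> ball z (r/2)" "w' \<noteq> z" for w w'
  proof (rule \<Sigma>.N_le_dualI)
    show "D w - D w' \<in> Sig" using D by simp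
    fix \<phi> assume \<phi>: "\<phi> \<in> \<Sigma>.dual_ball"
    let ?h = "\<lambda>w. \<phi> (f w)"
    have hD: "\<phi> (D w) = (?h w - ?h z) / (w - z)" for w
      using f by (simp add: D_def \<Sigma>.dual_ballD[OF \<phi>] divide_inverse mult.commute)
    have bd: "cmod (?h w) \<le> K" if "w \<in> ball z (2 * r)" for w
      using \<Sigma>.dual_ballD(3)[OF \<phi> f] bdd[OF that] by (rule order_trans)
    have est: "cmod (\<phi> (D w) - deriv ?h z) \<le> A * cmod (w - z)" if "w \<in> ball z (r/2)" "w \<noteq> z" for w
      unfolding hD A_def by (rule difference_quotient_bound[OF hol[OF \<phi>] r bd that])
    have "cmod (\<phi> (D w - D w')) = cmod ((\<phi> (D w) - deriv ?h z) - (\<phi> (D w') - deriv ?h z))"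
      using D by (simp add: \<Sigma>.dual_ballD[OF \<phi>])
    also have "\<dots> \<le> cmod (\<phi> (D w) - deriv ?h z) + cmod (\<phi> (D w') - deriv ?h z)"
      by (rule norm_triangle_ineq4)
    also have "\<dots> \<le> A * (cmod (w - z) + cmod (w' - z))"
      using est[OF w(1,2)] est[OF w(3,4)] by (simp add: distrib_left)
    finally show "cmod (\<phi> (D w - D w')) \<le> A * (cmod (w - z) + cmod (w' - z))" .
  qed
  have K: "0 \<le> K" using bdd[of z] \<Sigma>.N_ge_0[OF f, of z] r by simp
  have A: "0 \<le> A" using K by (simp add: A_def)
  \<comment> \<open>a sequence of points tending to \<open>z\<close> along which completeness provides the candidate \<open>L\<close>\<close>
  define v where "v k = z + of_real (r / 4 * inverse (real (Suc k)))" for k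
  have vz: "cmod (v k - z) = r / 4 * inverse (real (Suc k))" for k
    using r by (simp add: v_def norm_mult norm_divide norm_inverse del: of_real_mult of_real_divide)
  have v: "v k \<in> ball z (r/2)" "v k \<noteq> z" for k
  proof -
    have "r / 4 * inverse (real (Suc k)) \<le> r / 4 * 1"
      using r by (intro mult_left_mono) (auto simp: inverse_le_1_iff)
    then have "cmod (v k - z) \<le> r / 4" unfolding vz by simp
    then show "v k \<in> ball z (r/2)" using r by (simp add: dist_norm norm_minus_commute[of z])
    show "v k \<noteq> z" using vz[of k] r by auto
  qed
  have v_lim: "(\<lambda>k. cmod (v k - z)) \<longlonglongrightarrow> 0"
    unfolding vz by (intro tendsto_mult_right_zero LIMSEQ_inverse_real_of_nat)
  have "\<exists>n0. \<forall>m\<ge>n0. \<forall>n\<ge>n0. sn (D (v m) - D (v n)) < e" if "e > 0" for e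
  proof -
    have "(\<lambda>k. A * (2 * cmod (v k - z))) \<longlonglongrightarrow> A * (2 * 0)"
      by (intro tendsto_intros v_lim)
    then have "\<forall>\<^sub>F k in sequentially. A * (2 * cmod (v k - z)) < e"
      using order_tendstoD(2)[of _ "A * (2 * 0)" sequentially e] that by simp
    then obtain n0 where n0: "A * (2 * cmod (v n0 - z)) < e"
      by (auto simp: eventually_sequentially)
    have mono: "cmod (v m - z) \<le> cmod (v n0 - z)" if "m \<ge> n0" for m
      unfolding vz using r that by (intro mult_left_mono le_imp_inverse_le) auto
    show ?thesis
    proof (intro exI allI impI)
      fix m n assume mn: "m \<ge> n0" "n \<ge> n0"
      have "sn (D (v m) - D (v n)) \<le> A * (cmod (v m - z) + cmod (v n - z))"
        by (rule D_close[OF v v])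
      also have "\<dots> \<le> A * (2 * cmod (v n0 - z))"
        using mono[OF mn(1)] mono[OF mn(2)] by (intro mult_left_mono A) linarith
      finally show "sn (D (v m) - D (v n)) < e" using n0 by simp
    qed
  qed
  then obtain L where L: "L \<in> Sig" "(\<lambda>k. sn (D (v k) - L)) \<longlonglongrightarrow> 0"
    by (rule Sigma_complete[OF D])
  have lim: "sn (D w - L) \<le> A * cmod (w - z)" if w: "w \<in> ball z (r/2)" "w \<noteq> z" for w
  proof (rule tendsto_lowerbound)
    have "(\<lambda>k. A * (cmod (w - z) + cmod (v k - z)) + sn (D (v k) - L)) \<longlonglongrightarrow> A * (cmod (w - z) + 0) + 0"
      by (intro tendsto_intros v_lim L)
    then show "(\<lambda>k. A * (cmod (w - z) + cmod (v k - z)) + sn (D (v k) - L)) \<longlonglongrightarrow> A * cmod (w - z)"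
      by simp
    show "\<forall>\<^sub>F k in sequentially. sn (D w - L) \<le> A * (cmod (w - z) + cmod (v k - z)) + sn (D (v k) - L)"
    proof (intro always_eventually allI)
      fix k
      have "sn (D w - L) \<le> sn (D w - D (v k)) + sn (D (v k) - L)"
        using D L by (intro \<Sigma>.N_diff3) auto
      then show "sn (D w - L) \<le> A * (cmod (w - z) + cmod (v k - z)) + sn (D (v k) - L)"
        using D_close[OF w v, of k] by linarith
    qed
  qed simp
  have "((\<lambda>w. sn (D w - L)) \<longlongrightarrow> 0) (at z)"
  proof (rule Lim_null_comparison)
    have "((\<lambda>w. A * cmod (w - z)) \<longlongrightarrow> A * cmod (z - z)) (at z)"
      by (intro tendsto_intros)
    then show "((\<lambda>w. A * cmod (w - z)) \<longlongrightarrow> 0) (at z)" by simp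
    have "\<forall>\<^sub>F w in at z. w \<in> ball z (r/2)"
      using r by (intro eventually_at_in_open') auto
    moreover have "\<forall>\<^sub>F w in at z. w \<noteq> z"
      by (simp add: eventually_at_filter)
    ultimately show "\<forall>\<^sub>F w in at z. norm (sn (D w - L)) \<le> A * cmod (w - z)"
    proof eventually_elim
      case (elim w)
      then show ?case
        using lim[of w] \<Sigma>.N_ge_0[of "D w - L"] D[of w] L(1) by simp
    qed
  qed
  then show ?thesis
    using L(1) unfolding has_sum_deriv_def D_def by blast
qed

end

section \<open>The Calderon space\<close>

text \<open>The two boundary lines of the strip enter symmetrically; \<open>side X p\<close> says that \<open>p\<close>
  parametrizes the line on which functions take their values in \<open>X\<close>.\<close>

definition (in couple) side :: "'v opspace \<Rightarrow> (real \<Rightarrow> complex) \<Rightarrow> bool" where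
  "side X p \<longleftrightarrow> X = X0 \<and> p = (\<lambda>t. \<i> * of_real t) \<or> X = X1 \<and> p = (\<lambda>t. 1 + \<i> * of_real t)"

locale boundary = couple s X0 X1 + X: embedded_space X s
  for s :: "complex \<Rightarrow> 'v \<Rightarrow> 'v::{topological_ab_group_add, t2_space}" and X0 X1 X :: "'v opspace" +
  fixes p :: "real \<Rightarrow> complex"
  assumes side: "side X p"
begin

lemma p_strip: "p t \<in> strip" and p_not_interior: "p t \<notin> interior strip"
  using side by (auto simp: side_def interior_strip)

lemma p_continuous: "continuous_on UNIV p"
  using side unfolding side_def by (elim disjE conjE; simp) (intro continuous_intros)+

lemma carrier_Sig: "a \<in> carrier X \<Longrightarrow> a \<in> Sig" and sn_le_vnorm: "a \<in> carrier X \<Longrightarrow> sn a \<le> vnorm X a"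
  using side X0_Sig X1_Sig sn_le_X0 sn_le_X1 by (auto simp: side_def)

lemma tendsto_p:
  fixes u :: "complex \<Rightarrow> complex"
  assumes "continuous_on strip u"
  shows "((\<lambda>t'. u (p t')) \<longlongrightarrow> u (p t)) (at t)"
proof -
  have "continuous_on UNIV (\<lambda>t. u (p t))"
    using p_strip by (intro continuous_on_compose2[OF assms p_continuous]) auto
  then show ?thesis by (simp add: continuous_on_def)
qed

end

context couple
begin

lemma side_left: "side X0 (\<lambda>t. \<i> * of_real t)" and side_right: "side X1 (\<lambda>t. 1 + \<i> * of_real t)"
  by (simp_all add: side_def)

lemma boundaryI:
  assumes "side X p"
  shows "boundary s X0 X1 X p"
proof -
  have "embedded_space X s"
    using assms X0.embedded_space_axioms X1.embedded_space_axioms by (auto simp: side_def)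
  then show ?thesis
    using assms by (intro boundary.intro boundary_axioms.intro couple_axioms)
qed

lemma dual_tendsto:
  assumes "((\<lambda>w. sn (f w - l)) \<longlongrightarrow> 0) F" "\<And>w. f w \<in> Sig" "l \<in> Sig" "\<phi> \<in> \<Sigma>.dual_ball"
  shows "((\<lambda>w. \<phi> (f w)) \<longlongrightarrow> \<phi> l) F"
proof (rule LIM_zero_cancel, rule Lim_null_comparison[OF _ assms(1)], intro always_eventually allI)
  fix w
  have "\<phi> (f w) - \<phi> l = \<phi> (f w - l)"
    using assms by (simp add: \<Sigma>.dual_ballD)
  then show "norm (\<phi> (f w) - \<phi> l) \<le> sn (f w - l)"
    using \<Sigma>.dual_ballD(3)[OF assms(4), of "f w - l"] assms(2,3) by simp
qed

abbreviation \<C> :: "(complex \<Rightarrow> 'v) set" where "\<C> \<equiv> calderon_carrier s X0 X1"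

text \<open>The definition with its topological conditions spelled out as limits, and the conditions on the two
  boundary lines stated once for both.\<close>

lemma calderon_carrier_iff:
  "f \<in> \<C> \<longleftrightarrow> (\<forall>z. z \<notin> strip \<longrightarrow> f z = 0) \<and>
     (\<forall>z\<in>strip. f z \<in> Sig \<and> ((\<lambda>w. sn (f w - f z)) \<longlongrightarrow> 0) (at z within strip)) \<and>
     bdd_above ((\<lambda>z. sn (f z)) ` strip) \<and> (\<forall>z\<in>interior strip. \<exists>L. has_sum_deriv s X0 X1 f L z) \<and>
     (\<forall>X p. side X p \<longrightarrow> (\<forall>t. f (p t) \<in> carrier X \<and> ((\<lambda>t'. vnorm X (f (p t') - f (p t))) \<longlongrightarrow> 0) (at t)) \<and>
        bdd_above (range (\<lambda>t. vnorm X (f (p t)))))"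
proof -
  have c: "continuous_map euclideanreal (op_topology X) g \<longleftrightarrow>
      (\<forall>t. g t \<in> carrier X \<and> ((\<lambda>t'. vnorm X (g t' - g t)) \<longlongrightarrow> 0) (at t))"
    if "embedded_space X s" for X and g :: "real \<Rightarrow> 'v"
    using embedded_space.continuous_map_op_topology[OF that, of UNIV g]
    by (simp only: subtopology_UNIV ball_UNIV all_conj_distrib)
  have all: "(\<forall>X p. side X p \<longrightarrow> P X p) \<longleftrightarrow> P X0 (\<lambda>t. \<i> * of_real t) \<and> P X1 (\<lambda>t. 1 + \<i> * of_real t)" for P
    by (auto simp: side_def)
  show ?thesis
    unfolding calderon_carrier_def mem_Collect_eq continuous_map_sum_topology all
      c[OF X0.embedded_space_axioms] c[OF X1.embedded_space_axioms]
    by (simp only: ball_conj_distrib conj_ac)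
qed

lemma calderonD:
  assumes "f \<in> \<C>"
  shows "z \<notin> strip \<Longrightarrow> f z = 0"
    and "f z \<in> Sig"
    and "z \<in> strip \<Longrightarrow> ((\<lambda>w. sn (f w - f z)) \<longlongrightarrow> 0) (at z within strip)"
    and "z \<in> interior strip \<Longrightarrow> \<exists>L. has_sum_deriv s X0 X1 f L z"
    and "side X p \<Longrightarrow> f (p t) \<in> carrier X"
    and "side X p \<Longrightarrow> ((\<lambda>t'. vnorm X (f (p t') - f (p t))) \<longlongrightarrow> 0) (at t)"
    and "side X p \<Longrightarrow> bdd_above (range (\<lambda>t. vnorm X (f (p t))))"
proof -
  note * = assms[unfolded calderon_carrier_iff]
  show off: "f z = 0" if "z \<notin> strip" for z using * that by simp
  show "f z \<in> Sig" using * off[of z] by (cases "z \<in> strip") auto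
qed (use assms[unfolded calderon_carrier_iff] in simp_all)

lemma calderon_bounds:
  assumes "f \<in> \<C>"
  obtains B where "\<And>z. z \<in> strip \<Longrightarrow> sn (f z) \<le> B" "\<And>X p t. side X p \<Longrightarrow> vnorm X (f (p t)) \<le> B"
proof -
  have "bdd_above ((\<lambda>z. sn (f z)) ` strip)" using assms[unfolded calderon_carrier_iff] by simp
  then obtain B where B: "\<And>z. z \<in> strip \<Longrightarrow> sn (f z) \<le> B" by (auto simp: bdd_above_def)
  obtain B0 where B0: "\<And>t. vnorm X0 (f (\<i> * of_real t)) \<le> B0"
    using calderonD(7)[OF assms side_left] by (auto simp: bdd_above_def)
  obtain B1 where B1: "\<And>t. vnorm X1 (f (1 + \<i> * of_real t)) \<le> B1"
    using calderonD(7)[OF assms side_right] by (auto simp: bdd_above_def)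
  show ?thesis
  proof (rule that[of "max B (max B0 B1)"])
    show "sn (f z) \<le> max B (max B0 B1)" if "z \<in> strip" for z
      by (rule max.coboundedI1[OF B[OF that]])
    show "vnorm X (f (p t)) \<le> max B (max B0 B1)" if "side X p" for X p t
      using that B0[of t] B1[of t] by (auto simp: side_def)
  qed
qed

lemma interior_strip_ball:
  assumes "z \<in> interior strip"
  obtains r where "r > 0" "cball z r \<subseteq> interior strip"
  using open_contains_cball[of "interior strip"] assms by auto

text \<open>Membership only has to be checked weakly: a bounded function all of whose compositions with
  functionals are holomorphic is differentiable in the sum norm.\<close>

lemma calderonI:
  assumes off: "\<And>z. z \<notin> strip \<Longrightarrow> f z = 0"
    and Sig: "\<And>z. z \<in> strip \<Longrightarrow> f z \<in> Sig"
    and cont: "\<And>z. z \<in> strip \<Longrightarrow> ((\<lambda>w. sn (f w - f z)) \<longlongrightarrow> 0) (at z within strip)"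
    and bdd: "\<And>z. z \<in> strip \<Longrightarrow> sn (f z) \<le> B"
    and hol: "\<And>\<phi>. \<phi> \<in> \<Sigma>.dual_ball \<Longrightarrow> (\<lambda>z. \<phi> (f z)) holomorphic_on interior strip"
    and side: "\<And>X p t. side X p \<Longrightarrow> f (p t) \<in> carrier X"
      "\<And>X p t. side X p \<Longrightarrow> ((\<lambda>t'. vnorm X (f (p t') - f (p t))) \<longlongrightarrow> 0) (at t)"
      "\<And>X p t. side X p \<Longrightarrow> vnorm X (f (p t)) \<le> B"
  shows "f \<in> \<C>"
proof -
  have Sig': "f w \<in> Sig" for w
    using off Sig by (cases "w \<in> strip") auto
  have deriv: "\<exists>L. has_sum_deriv s X0 X1 f L z" if z: "z \<in> interior strip" for z
  proof -
    obtain r where r: "r > 0" "cball z r \<subseteq> interior strip"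
      by (rule interior_strip_ball[OF z])
    have sub: "ball z (2 * (r/2)) \<subseteq> interior strip" using r by auto
    show ?thesis
    proof (rule weakly_holomorphic_imp_has_sum_deriv[where f = f and r = "r/2" and K = B])
      show "f w \<in> Sig" for w by (rule Sig')
      show "(\<lambda>w. \<phi> (f w)) holomorphic_on ball z (2 * (r/2))" if "\<phi> \<in> \<Sigma>.dual_ball" for \<phi>
        using hol[OF that] sub by (rule holomorphic_on_subset)
      show "sn (f w) \<le> B" if "w \<in> ball z (2 * (r/2))" for w
        using that sub interior_subset by (intro bdd) blast
    qed (use r in simp)
  qed
  have "bdd_above ((\<lambda>z. sn (f z)) ` strip)"
    by (rule bdd_aboveI2, erule bdd)
  moreover have "bdd_above (range (\<lambda>t. vnorm X (f (p t))))" if "side X p" for X p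
    by (rule bdd_aboveI2, rule side(3)[OF that])
  ultimately show ?thesis
    unfolding calderon_carrier_iff using off Sig cont deriv side(1,2) by simp
qed

lemma calderon_weakly_holomorphic:
  assumes f: "f \<in> \<C>" and \<phi>: "\<phi> \<in> \<Sigma>.dual_ball"
  shows "(\<lambda>z. \<phi> (f z)) holomorphic_on interior strip"
proof (rule holomorphic_onI)
  fix z assume "z \<in> interior strip"
  then obtain L where "has_sum_deriv s X0 X1 f L z"
    using calderonD(4)[OF f] by blast
  then have "((\<lambda>w. \<phi> (f w)) has_field_derivative \<phi> L) (at z)"
    by (rule has_sum_deriv_imp_weak[OF _ calderonD(2)[OF f] \<phi>])
  then show "(\<lambda>w. \<phi> (f w)) field_differentiable (at z within interior strip)"
    using field_differentiable_def field_differentiable_at_within by blast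
qed

text \<open>The scalar maximum principle, applied to \<open>\<phi> \<circ> f\<close> for all \<open>\<phi>\<close> in the dual unit ball.\<close>

lemma calderon_maximum_principle:
  assumes f: "f \<in> \<C>" and bd: "\<And>X p t. side X p \<Longrightarrow> vnorm X (f (p t)) \<le> B" and z: "z \<in> strip"
  shows "sn (f z) \<le> B"
proof (rule \<Sigma>.N_le_dualI[OF calderonD(2)[OF f]])
  fix \<phi> assume \<phi>: "\<phi> \<in> \<Sigma>.dual_ball"
  obtain K where K: "\<And>z. z \<in> strip \<Longrightarrow> sn (f z) \<le> K"
    by (rule calderon_bounds[OF f]) blast
  note le = \<Sigma>.dual_ballD(3)[OF \<phi> calderonD(2)[OF f]]
  have bd': "cmod (\<phi> (f (p t))) \<le> B" if "side X p" for X p t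
  proof -
    interpret B: boundary s X0 X1 X p by (rule boundaryI[OF that])
    show ?thesis
      using le B.sn_le_vnorm[OF calderonD(5)[OF f that]] bd[OF that] by (meson order_trans)
  qed
  show "cmod (\<phi> (f z)) \<le> B"
  proof (rule strip_maximum_principle[of "\<lambda>z. \<phi> (f z)" K])
    show "continuous_on strip (\<lambda>z. \<phi> (f z))"
      unfolding continuous_on_def
      by (intro ballI dual_tendsto calderonD(2,3)[OF f] \<phi>)
    show "(\<lambda>z. \<phi> (f z)) holomorphic_on interior strip"
      by (rule calderon_weakly_holomorphic[OF f \<phi>])
    show "cmod (\<phi> (f z)) \<le> K" if "z \<in> strip" for z
      using le K[OF that] by (rule order_trans)
  qed (rule bd'[OF side_left] bd'[OF side_right] z)+
qed

abbreviation \<F> :: "(complex \<Rightarrow> 'v) opspace" where "\<F> \<equiv> calderon s X0 X1"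

lemma calderon_simps [simp]:
  "carrier \<F> = \<C>" "zero \<F> = (\<lambda>z. 0)" "add \<F> = (\<lambda>f g z. f z + g z)" "smult \<F> = (\<lambda>c f z. s c (f z))"
  by (simp_all add: calderon_def)

text \<open>Multiplication by scalar functions is how the maps \<open>u / d\<close> and the constants act on the space.\<close>

lemma calderon_times:
  assumes f: "f \<in> \<C>" and cont: "continuous_on strip u" and hol: "u holomorphic_on interior strip"
    and bdd: "\<And>z. z \<in> strip \<Longrightarrow> cmod (u z) \<le> K"
  shows "(\<lambda>z. s (u z) (f z)) \<in> \<C>"
proof -
  note fD = calderonD[OF f]
  have "0 \<in> strip" by (simp add: strip_def)
  then have K: "0 \<le> K" using bdd[of 0] norm_ge_zero[of "u 0"] by linarith
  obtain B where B: "\<And>z. z \<in> strip \<Longrightarrow> sn (f z) \<le> B" "\<And>X p t. side X p \<Longrightarrow> vnorm X (f (p t)) \<le> B"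
    by (rule calderon_bounds[OF f]) blast
  show ?thesis
  proof (rule calderonI[of _ "K * B"])
    show "s (u z) (f z) = 0" if "z \<notin> strip" for z using fD(1)[OF that] by simp
    show "s (u z) (f z) \<in> Sig" for z using fD(2) by simp
    show "((\<lambda>w. sn (s (u w) (f w) - s (u z) (f z))) \<longlongrightarrow> 0) (at z within strip)" if "z \<in> strip" for z
      using cont that by (intro \<Sigma>.tendsto_scale fD) (auto simp: continuous_on_def)
    show "sn (s (u z) (f z)) \<le> K * B" if "z \<in> strip" for z
      unfolding \<Sigma>.N_s[OF fD(2)] by (intro mult_mono bdd B K \<Sigma>.N_ge_0 fD that)
    show "(\<lambda>z. \<phi> (s (u z) (f z))) holomorphic_on interior strip" if \<phi>: "\<phi> \<in> \<Sigma>.dual_ball" for \<phi>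
      unfolding \<Sigma>.dual_ballD(2)[OF \<phi> fD(2)]
      by (intro holomorphic_intros hol calderon_weakly_holomorphic[OF f \<phi>])
    fix X p t assume sd: "side X p"
    interpret B: boundary s X0 X1 X p by (rule boundaryI[OF sd])
    show "s (u (p t)) (f (p t)) \<in> carrier X"
      by (rule B.X.sub.V_s[OF fD(5)[OF sd]])
    show "((\<lambda>t'. vnorm X (s (u (p t')) (f (p t')) - s (u (p t)) (f (p t)))) \<longlongrightarrow> 0) (at t)"
      by (intro B.X.sub.tendsto_scale fD sd B.tendsto_p[OF cont])
    show "vnorm X (s (u (p t)) (f (p t))) \<le> K * B"
      unfolding B.X.sub.N_s[OF fD(5)[OF sd]] by (intro mult_mono bdd B K B.X.sub.N_ge_0 fD sd B.p_strip)
  qed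
qed

lemma calderon_smult: "f \<in> \<C> \<Longrightarrow> (\<lambda>z. s c (f z)) \<in> \<C>"
  using calderon_times[of f "\<lambda>_. c" "cmod c"] by simp

lemma calderon_add:
  assumes f: "f \<in> \<C>" and g: "g \<in> \<C>"
  shows "(\<lambda>z. f z + g z) \<in> \<C>"
proof -
  note fD = calderonD[OF f] and gD = calderonD[OF g]
  obtain B where B: "\<And>z. z \<in> strip \<Longrightarrow> sn (f z) \<le> B" "\<And>X p t. side X p \<Longrightarrow> vnorm X (f (p t)) \<le> B"
    by (rule calderon_bounds[OF f]) blast
  obtain B' where B': "\<And>z. z \<in> strip \<Longrightarrow> sn (g z) \<le> B'" "\<And>X p t. side X p \<Longrightarrow> vnorm X (g (p t)) \<le> B'"
    by (rule calderon_bounds[OF g]) blast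
  show ?thesis
  proof (rule calderonI[of _ "B + B'"])
    show "f z + g z = 0" if "z \<notin> strip" for z using fD(1)[OF that] gD(1)[OF that] by simp
    show "f z + g z \<in> Sig" for z using fD(2) gD(2) by simp
    show "((\<lambda>w. sn (f w + g w - (f z + g z))) \<longlongrightarrow> 0) (at z within strip)" if "z \<in> strip" for z
      using that by (intro \<Sigma>.tendsto_plus fD gD)
    show "sn (f z + g z) \<le> B + B'" if "z \<in> strip" for z
      using \<Sigma>.N_add[OF fD(2) gD(2), of z z] B(1)[OF that] B'(1)[OF that] by linarith
    show "(\<lambda>z. \<phi> (f z + g z)) holomorphic_on interior strip" if \<phi>: "\<phi> \<in> \<Sigma>.dual_ball" for \<phi>
      unfolding \<Sigma>.dual_ballD(1)[OF \<phi> fD(2) gD(2)]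
      by (intro holomorphic_intros calderon_weakly_holomorphic[OF f \<phi>] calderon_weakly_holomorphic[OF g \<phi>])
    fix X p t assume sd: "side X p"
    interpret B: boundary s X0 X1 X p by (rule boundaryI[OF sd])
    show "f (p t) + g (p t) \<in> carrier X"
      by (intro B.X.sub.V_add fD gD sd)
    show "((\<lambda>t'. vnorm X (f (p t') + g (p t') - (f (p t) + g (p t)))) \<longlongrightarrow> 0) (at t)"
      by (intro B.X.sub.tendsto_plus fD gD sd)
    show "vnorm X (f (p t) + g (p t)) \<le> B + B'"
      using B.X.sub.N_add[OF fD(5)[OF sd] gD(5)[OF sd], of t t] B(2)[OF sd, of t] B'(2)[OF sd, of t] by linarith
  qed
qed

lemma calderon_zero: "(\<lambda>z. 0) \<in> \<C>"
proof (rule calderonI[of _ 0])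
  fix X p t assume sd: "side X p"
  interpret B: boundary s X0 X1 X p by (rule boundaryI[OF sd])
  show "0 \<in> carrier X" "((\<lambda>t'. vnorm X (0 - 0)) \<longlongrightarrow> 0) (at t)" "vnorm X 0 \<le> 0"
    using B.X.sub.V_0 by (simp_all add: B.X.sub.N_0)
qed (simp_all add: \<Sigma>.N_0)

sublocale F: cmodule \<F>
proof -
  have "abelian_group \<F>"
  proof (rule abelian_groupI)
    fix f assume f: "f \<in> carrier \<F>"
    show "\<exists>g\<in>carrier \<F>. g \<oplus>\<^bsub>\<F>\<^esub> f = \<zero>\<^bsub>\<F>\<^esub>"
      using f calderon_smult[of f "-1"] by (intro bexI[of _ "\<lambda>z. s (-1) (f z)"]) auto
  qed (auto simp: calderon_add calderon_zero algebra_simps)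
  then show "cmodule \<F>"
    unfolding cmodule_def
    by (intro Module.moduleI cring_complex_ring)
      (auto simp: calderon_smult X0.sub.scale_left_distrib X0.sub.scale_right_distrib)
qed

lemma F_diff: "\<lbrakk>f \<in> carrier \<F>; g \<in> carrier \<F>\<rbrakk> \<Longrightarrow> f \<ominus>\<^bsub>\<F>\<^esub> g = (\<lambda>z. f z - g z)"
  by (simp add: F.minus_conv_smult del: calderon_simps(1))

section \<open>The matrix norms of the Calderon space\<close>

text \<open>The norm is the supremum of the pullbacks of the norms of \<open>X0\<close> and \<open>X1\<close> along the evaluations
  at boundary points.\<close>

lemma linear_map_boundary:
  assumes "side X p"
  shows "linear_map \<F> X (\<lambda>f. f (p t))"
proof -
  interpret B: boundary s X0 X1 X p by (rule boundaryI[OF assms])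
  show ?thesis by (simp add: linear_map_def calderonD(5) assms)
qed

lemma mats_boundary: "\<lbrakk>side X p; f \<in> mats \<F> n\<rbrakk> \<Longrightarrow> (\<lambda>i j. f i j (p t)) \<in> mats X n"
  by (simp add: mats_def calderonD(5))

text \<open>The entries are bounded on each boundary line, hence the supremum that defines the norm is finite.\<close>

lemma mnorm_F_ge:
  assumes sd: "side X p" and n: "n > 0" and f: "f \<in> mats \<F> n"
  shows "mnorm X n (\<lambda>i j. f i j (p t)) \<le> mnorm \<F> n f"
proof -
  interpret B: boundary s X0 X1 X p by (rule boundaryI[OF sd])
  have fc: "f a b \<in> \<C>" if "a < n" "b < n" for a b
    using f that by (simp add: mats_def)
  have "bdd_above (range (\<lambda>t. mnorm X n (\<lambda>i j. f i j (p t))))"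
  proof (rule bdd_aboveI2)
    fix t
    have "mnorm X n (\<lambda>i j. f i j (p t)) \<le> (\<Sum>(a, b)\<in>{..<n}\<times>{..<n}. vnorm X (f a b (p t)))"
      by (rule B.X.mnorm_le_sum_entries[OF n mats_boundary[OF sd f]])
    also have "\<dots> \<le> (\<Sum>(a, b)\<in>{..<n}\<times>{..<n}. SUP t. vnorm X (f a b (p t)))"
      by (intro sum_mono) (auto intro!: cSUP_upper calderonD(7) sd fc)
    finally show "mnorm X n (\<lambda>i j. f i j (p t)) \<le> (\<Sum>(a, b)\<in>{..<n}\<times>{..<n}. SUP t. vnorm X (f a b (p t)))" .
  qed
  then have "mnorm X n (\<lambda>i j. f i j (p t)) \<le> (SUP t. mnorm X n (\<lambda>i j. f i j (p t)))"
    by (intro cSUP_upper) simp_all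
  then show ?thesis
    using sd by (auto simp: calderon_def side_def intro: max.coboundedI1 max.coboundedI2)
qed

lemma mnorm_F_leI:
  assumes "\<And>X p t. side X p \<Longrightarrow> mnorm X n (\<lambda>i j. f i j (p t)) \<le> B"
  shows "mnorm \<F> n f \<le> B"
  using assms[OF side_left] assms[OF side_right] by (auto simp: calderon_def intro!: cSUP_least)

lemma vnorm_F_ge:
  assumes "side X p" "f \<in> carrier \<F>"
  shows "vnorm X (f (p t)) \<le> vnorm \<F> f"
  using mnorm_F_ge[OF assms(1), of 1 "\<lambda>i j. f" t] assms(2) by (simp add: vnorm_def mats_def)

lemma vnorm_F_leI:
  assumes "\<And>X p t. side X p \<Longrightarrow> vnorm X (f (p t)) \<le> B"
  shows "vnorm \<F> f \<le> B"
  unfolding vnorm_def by (rule mnorm_F_leI) (use assms in \<open>simp add: vnorm_def\<close>)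

text \<open>This makes convergence in \<open>\<F>\<close> imply uniform convergence on the strip, and the norm of \<open>\<F>\<close> definite.\<close>

lemma sn_le_vnorm_F:
  assumes "f \<in> carrier \<F>"
  shows "sn (f z) \<le> vnorm \<F> f"
proof (cases "z \<in> strip")
  case True
  then show ?thesis
    using assms by (intro calderon_maximum_principle vnorm_F_ge) simp_all
next
  case False
  have "0 \<le> vnorm X0 (f (\<i> * of_real 0))"
    using assms calderonD(5)[OF _ side_left, of f 0] by (intro X0.N_nonneg) simp
  then show ?thesis
    using False vnorm_F_ge[OF side_left assms, of 0] calderonD(1)[of f z] assms by (simp add: \<Sigma>.N_0)
qed

sublocale Fm: matnormed \<F>
proof
  let ?M = "{\<lambda>n f. mnorm X n (\<lambda>i j. f i j (p t)) | X p t. side X p}"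
  show "matrix_seminorm \<F> (mnorm \<F>)"
  proof (rule matrix_seminorm_Sup[OF F.cmodule_axioms, of ?M])
    show "?M \<noteq> {}" using side_left by blast
    show "matrix_seminorm \<F> M" if "M \<in> ?M" for M
    proof -
      obtain X p t where sd: "side X p" and M: "M = (\<lambda>n f. mnorm X n (\<lambda>i j. f i j (p t)))"
        using \<open>M \<in> ?M\<close> by blast
      interpret B: boundary s X0 X1 X p by (rule boundaryI[OF sd])
      show ?thesis
        unfolding M by (rule matrix_seminorm_pullback[OF F.cmodule_axioms B.X.matnormed_axioms linear_map_boundary[OF sd]])
    qed
    show "mnorm \<F> n x = mnorm \<F> n y" if n: "n > 0" and eq: "\<forall>i<n. \<forall>j<n. x i j = y i j" for n x y
    proof -
      have "mnorm X0 n (\<lambda>i j. x i j z) = mnorm X0 n (\<lambda>i j. y i j z)"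
        "mnorm X1 n (\<lambda>i j. x i j z) = mnorm X1 n (\<lambda>i j. y i j z)" for z
        using eq by (auto intro!: X0.mnorm_cong[OF n] X1.mnorm_cong[OF n])
      then show ?thesis by (simp add: calderon_def)
    qed
    show "M n f \<le> mnorm \<F> n f" if "n > 0" "f \<in> mats \<F> n" "M \<in> ?M" for n M f
      using that mnorm_F_ge by blast
    show "mnorm \<F> n f \<le> b" if "\<And>M. M \<in> ?M \<Longrightarrow> M n f \<le> b" for n f b
    proof (rule mnorm_F_leI)
      fix X p t assume "side X p"
      then have "(\<lambda>n f. mnorm X n (\<lambda>i j. f i j (p t))) \<in> ?M" by blast
      then show "mnorm X n (\<lambda>i j. f i j (p t)) \<le> b" by (rule that)
    qed
  qed
  fix n f i j assume n: "n > 0" and f: "f \<in> mats \<F> n" and 0: "mnorm \<F> n f = 0" and ij: "i < n" "j < n"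
  have fij: "f i j \<in> carrier \<F>" using f ij by (simp add: mats_def)
  have "vnorm \<F> (f i j) \<le> 0"
  proof (rule vnorm_F_leI)
    fix X p t assume sd: "side X p"
    interpret B: boundary s X0 X1 X p by (rule boundaryI[OF sd])
    show "vnorm X (f i j (p t)) \<le> 0"
      using B.X.vnorm_entry_le[OF n mats_boundary[OF sd f] ij, of t] mnorm_F_ge[OF sd n f, of t] 0 by linarith
  qed
  then have "sn (f i j z) \<le> 0" for z
    using sn_le_vnorm_F[OF fij, of z] by linarith
  then have "f i j z = 0" for z
    using \<Sigma>.N_ge_0[of "f i j z"] calderonD(2)[of "f i j" z] fij
    by (intro sn_zero_imp antisym) simp_all
  then show "f i j = \<zero>\<^bsub>\<F>\<^esub>" by auto
qed

section \<open>Completeness of the Calderon space\<close>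

text \<open>A Cauchy sequence converges uniformly on the strip in the sum norm and uniformly on each boundary line
  in the smaller norm.  Continuity and the bounds pass to the limit, and so does weak holomorphy, which is
  enough by \<open>calderonI\<close>.\<close>

lemma calderon_mcomplete: "Fm.met.mcomplete"
proof (rule Fm.mcompleteI_fast)
  fix \<xi> assume \<xi>: "\<And>n. \<xi> n \<in> carrier \<F>" and fast: "\<And>n. vnorm \<F> (\<xi> (Suc n) \<ominus>\<^bsub>\<F>\<^esub> \<xi> n) \<le> (1/2) ^ n"
  have \<xi>c: "\<xi> n \<in> \<C>" for n using \<xi> by simp
  note D = calderonD[OF \<xi>c]
  define G where "G m n = vnorm \<F> (\<xi> m \<ominus>\<^bsub>\<F>\<^esub> \<xi> n)" for m n
  have Cauchy: "\<exists>n0. \<forall>m\<ge>n0. \<forall>n\<ge>n0. G m n < e" if "e > 0" for e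
    unfolding G_def using Fm.fast_Cauchy[of \<xi> 1 e] \<xi> fast that by simp
  have dc: "\<xi> m \<ominus>\<^bsub>\<F>\<^esub> \<xi> n \<in> carrier \<F>" for m n
    by (rule F.minus_in[OF \<xi> \<xi>])
  have dz: "(\<xi> m \<ominus>\<^bsub>\<F>\<^esub> \<xi> n) z = \<xi> m z - \<xi> n z" for m n z
    by (simp only: F_diff[OF \<xi> \<xi>])
  have G: "sn (\<xi> m z - \<xi> n z) \<le> G m n" for m n z
    using sn_le_vnorm_F[OF dc, of m n z] unfolding dz G_def .
  have GX: "vnorm X (\<xi> m (p t) - \<xi> n (p t)) \<le> G m n" if "side X p" for X p m n t
    using vnorm_F_ge[OF that dc, of m n t] unfolding dz G_def .
  have "\<exists>l. l \<in> Sig \<and> (\<lambda>n. sn (\<xi> n z - l)) \<longlonglongrightarrow> 0" for z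
  proof (rule Sigma_complete[of "\<lambda>n. \<xi> n z"])
    show "\<xi> n z \<in> Sig" for n by (rule D)
    show "\<exists>n0. \<forall>m\<ge>n0. \<forall>n\<ge>n0. sn (\<xi> m z - \<xi> n z) < e" if "e > 0" for e
      using Cauchy[OF that] G by (meson le_less_trans)
  qed blast
  then obtain f where f: "\<And>z. f z \<in> Sig" "\<And>z. (\<lambda>n. sn (\<xi> n z - f z)) \<longlonglongrightarrow> 0"
    by metis
  have limit_unique: "f z = l" if "l \<in> Sig" "(\<lambda>n. sn (\<xi> n z - l)) \<longlonglongrightarrow> 0" for z l
  proof -
    have "(\<lambda>n. sn (\<xi> n z - f z) + sn (\<xi> n z - l)) \<longlonglongrightarrow> 0"
      using tendsto_add[OF f(2) that(2)] by simp
    moreover have "sn (f z - l) \<le> sn (\<xi> n z - f z) + sn (\<xi> n z - l)" for n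
      using \<Sigma>.N_diff3[OF f(1) D(2) that(1), of z n z] \<Sigma>.N_minus_commute[OF f(1) D(2), of z n z] by simp
    ultimately have "sn (f z - l) \<le> 0"
      by (intro LIMSEQ_le_const[of _ 0]) auto
    then have "f z - l = 0"
      using f(1)[of z] that(1) \<Sigma>.N_ge_0[of "f z - l"] by (intro sn_zero_imp antisym) auto
    then show ?thesis by simp
  qed
  \<comment> \<open>on the boundary the limit in the smaller space agrees with the limit in the sum\<close>
  have fX: "f (p t) \<in> carrier X \<and> (\<lambda>n. vnorm X (\<xi> n (p t) - f (p t))) \<longlonglongrightarrow> 0" if sd: "side X p" for X p t
  proof -
    interpret B: boundary s X0 X1 X p by (rule boundaryI[OF sd])
    note D5 = D(5)[OF sd]
    have Cauchy': "\<exists>n0. \<forall>m\<ge>n0. \<forall>n\<ge>n0. vnorm X (\<xi> m (p t) \<ominus>\<^bsub>X\<^esub> \<xi> n (p t)) < e" if "e > 0" for e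
      using Cauchy[OF that] GX[OF sd] unfolding B.X.diff_eq[OF D5 D5] by (meson le_less_trans)
    obtain l where l: "l \<in> carrier X" "(\<lambda>n. vnorm X (\<xi> n (p t) \<ominus>\<^bsub>X\<^esub> l)) \<longlonglongrightarrow> 0"
      by (rule B.X.mcompleteD[OF B.X.mcomplete D5 Cauchy'])
    note l' = l(2)[unfolded B.X.diff_eq[OF D5 l(1)]]
    have "(\<lambda>n. sn (\<xi> n (p t) - l)) \<longlonglongrightarrow> 0"
    proof (rule tendsto_null_le_mult[OF _ _ l', of _ 1])
      fix n
      have "\<xi> n (p t) - l \<in> carrier X" using D5 l(1) by (rule B.X.sub.V_diff)
      then show "sn (\<xi> n (p t) - l) \<le> 1 * vnorm X (\<xi> n (p t) - l)" "0 \<le> sn (\<xi> n (p t) - l)"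
        using B.sn_le_vnorm \<Sigma>.N_ge_0[OF B.carrier_Sig] by simp_all
    qed
    then have "f (p t) = l"
      by (rule limit_unique[OF B.carrier_Sig[OF l(1)]])
    then show ?thesis using l(1) l' by simp
  qed
  note fXc = conjunct1[OF fX] and fXl = conjunct2[OF fX]
  \<comment> \<open>letting one index of the Cauchy estimate tend to infinity gives uniform convergence\<close>
  define U where "U e n \<longleftrightarrow> (\<forall>z. sn (\<xi> n z - f z) \<le> e) \<and>
      (\<forall>X p t. side X p \<longrightarrow> vnorm X (\<xi> n (p t) - f (p t)) \<le> e)" for e n
  have UD: "sn (\<xi> n z - f z) \<le> e" "side X p \<Longrightarrow> vnorm X (\<xi> n (p t) - f (p t)) \<le> e" if "U e n" for e n z X p t
    using that by (auto simp: U_def)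
  have unif: "\<exists>n0. \<forall>n\<ge>n0. U e n" if e: "e > 0" for e
  proof -
    obtain n0 where n0: "\<And>m n. \<lbrakk>m \<ge> n0; n \<ge> n0\<rbrakk> \<Longrightarrow> G m n < e"
      using Cauchy[OF e] by blast
    have ev: "\<forall>\<^sub>F m in sequentially. m \<ge> n0" by (rule eventually_ge_at_top)
    show ?thesis
      unfolding U_def
    proof (intro exI allI impI conjI)
      fix n assume n: "n \<ge> n0"
      fix z
      show "sn (\<xi> n z - f z) \<le> e"
      proof (rule tendsto_lowerbound)
        show "(\<lambda>m. e + sn (\<xi> m z - f z)) \<longlonglongrightarrow> e"
          using tendsto_add[OF tendsto_const f(2)] by simp
        show "\<forall>\<^sub>F m in sequentially. sn (\<xi> n z - f z) \<le> e + sn (\<xi> m z - f z)"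
          using ev
        proof eventually_elim
          case (elim m)
          then show ?case
            using \<Sigma>.N_diff3[OF D(2) D(2) f(1), of n z z m z] G[of n z m] n0[OF n elim] by linarith
        qed
      qed simp
    next
      fix n X p t assume n: "n \<ge> n0" and sd: "side X p"
      interpret B: boundary s X0 X1 X p by (rule boundaryI[OF sd])
      show "vnorm X (\<xi> n (p t) - f (p t)) \<le> e"
      proof (rule tendsto_lowerbound)
        show "(\<lambda>m. e + vnorm X (\<xi> m (p t) - f (p t))) \<longlonglongrightarrow> e"
          using tendsto_add[OF tendsto_const fXl[OF sd]] by simp
        show "\<forall>\<^sub>F m in sequentially. vnorm X (\<xi> n (p t) - f (p t)) \<le> e + vnorm X (\<xi> m (p t) - f (p t))"
          using ev
        proof eventually_elim
          case (elim m)
          then show ?case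
            using B.X.sub.N_diff3[OF D(5)[OF sd] D(5)[OF sd] fXc[OF sd], of n t t m t]
              GX[OF sd, of n t m] n0[OF n elim] by linarith
        qed
      qed simp
    qed
  qed
  obtain n1 where "U 1 n1"
    using unif[OF zero_less_one] order_refl by blast
  note n1 = UD[OF this]
  have fF: "f \<in> \<C>"
  proof (rule calderonI[of f "vnorm \<F> (\<xi> n1) + 1"])
    show "f z = 0" if "z \<notin> strip" for z
      using that by (intro limit_unique) (simp_all add: D(1) \<Sigma>.N_0)
    show "f z \<in> Sig" for z by (rule f)
    show "((\<lambda>w. sn (f w - f z)) \<longlongrightarrow> 0) (at z within strip)" if z: "z \<in> strip" for z
    proof (rule \<Sigma>.tendsto_uniform_limit[where \<xi> = \<xi> and T = UNIV])
      show "((\<lambda>w. sn (\<xi> n w - \<xi> n z)) \<longlongrightarrow> 0) (at z within strip)" for n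
        by (rule D(3)[OF z])
      show "\<exists>n. \<forall>w\<in>UNIV. sn (\<xi> n w - f w) \<le> e" if "e > 0" for e
        using unif[OF that] UD(1) by (meson order_refl)
    qed (use f D(2) in auto)
    show "sn (f z) \<le> vnorm \<F> (\<xi> n1) + 1" for z
      using \<Sigma>.N_le_add_diff[OF f(1) D(2), of z n1 z] \<Sigma>.N_minus_commute[OF f(1) D(2), of z n1 z]
        n1(1)[of z] sn_le_vnorm_F[OF \<xi>, of n1 z] by linarith
    show "(\<lambda>z. \<phi> (f z)) holomorphic_on interior strip" if \<phi>: "\<phi> \<in> \<Sigma>.dual_ball" for \<phi>
    proof (rule holomorphic_uniform_sequence)
      show "open (interior strip)" by (rule open_interior)
      show "(\<lambda>z. \<phi> (\<xi> n z)) holomorphic_on interior strip" for n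
        by (rule calderon_weakly_holomorphic[OF \<xi>c \<phi>])
      fix z assume "z \<in> interior strip"
      then obtain r where r: "r > 0" "cball z r \<subseteq> interior strip"
        by (rule interior_strip_ball)
      have "uniform_limit (cball z r) (\<lambda>n z. \<phi> (\<xi> n z)) (\<lambda>z. \<phi> (f z)) sequentially"
      proof (rule uniform_limitI)
        fix e :: real assume e: "e > 0"
        obtain n0 where n0: "\<And>n z. n \<ge> n0 \<Longrightarrow> sn (\<xi> n z - f z) \<le> e/2"
          using unif[OF half_gt_zero[OF e]] UD(1) by meson
        show "\<forall>\<^sub>F n in sequentially. \<forall>z\<in>cball z r. dist (\<phi> (\<xi> n z)) (\<phi> (f z)) < e"
          unfolding eventually_sequentially
        proof (intro exI allI impI ballI)
          fix n w assume n: "n \<ge> n0"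
          have "dist (\<phi> (\<xi> n w)) (\<phi> (f w)) = cmod (\<phi> (\<xi> n w - f w))"
            using \<Sigma>.dual_ballD(5)[OF \<phi> D(2) f(1), of n w w] by (simp add: dist_norm)
          also have "\<dots> \<le> sn (\<xi> n w - f w)"
            by (rule \<Sigma>.dual_ballD(3)[OF \<phi> \<Sigma>.V_diff[OF D(2) f(1)]])
          finally show "dist (\<phi> (\<xi> n w)) (\<phi> (f w)) < e"
            using n0[OF n, of w] e by linarith
        qed
      qed
      then show "\<exists>d. 0 < d \<and> cball z d \<subseteq> interior strip \<and>
          uniform_limit (cball z d) (\<lambda>n z. \<phi> (\<xi> n z)) (\<lambda>z. \<phi> (f z)) sequentially"
        using r by blast
    qed
    fix X p t assume sd: "side X p"
    interpret B: boundary s X0 X1 X p by (rule boundaryI[OF sd])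
    show "f (p t) \<in> carrier X" by (rule fXc[OF sd])
    show "((\<lambda>t'. vnorm X (f (p t') - f (p t))) \<longlongrightarrow> 0) (at t)"
    proof (rule B.X.sub.tendsto_uniform_limit[where \<xi> = "\<lambda>n t. \<xi> n (p t)" and T = UNIV and f = "\<lambda>t. f (p t)"])
      show "\<exists>n. \<forall>t\<in>UNIV. vnorm X (\<xi> n (p t) - f (p t)) \<le> e" if "e > 0" for e
        using unif[OF that] UD(2)[OF _ sd] by (meson order_refl)
    qed (rule D(6)[OF sd], simp_all add: fXc[OF sd] D(5)[OF sd])
    show "vnorm X (f (p t)) \<le> vnorm \<F> (\<xi> n1) + 1"
      using B.X.sub.N_le_add_diff[OF fXc[OF sd] D(5)[OF sd], of t n1 t]
        B.X.sub.N_minus_commute[OF fXc[OF sd] D(5)[OF sd], of t n1 t]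
        n1(2)[OF sd, of t] vnorm_F_ge[OF sd \<xi>, of n1 t] by linarith
  qed
  have fF': "f \<in> carrier \<F>" using fF by simp
  have "(\<lambda>n. vnorm \<F> (\<xi> n \<ominus>\<^bsub>\<F>\<^esub> f)) \<longlonglongrightarrow> 0"
  proof (rule LIMSEQ_I)
    fix e :: real assume e: "e > 0"
    obtain n0 where n0: "\<And>n. n \<ge> n0 \<Longrightarrow> U (e/2) n"
      using unif[OF half_gt_zero[OF e]] by blast
    show "\<exists>n0. \<forall>n\<ge>n0. norm (vnorm \<F> (\<xi> n \<ominus>\<^bsub>\<F>\<^esub> f) - 0) < e"
    proof (intro exI allI impI)
      fix n assume "n \<ge> n0"
      then have "vnorm \<F> (\<xi> n \<ominus>\<^bsub>\<F>\<^esub> f) \<le> e/2"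
        unfolding F_diff[OF \<xi> fF'] by (intro vnorm_F_leI UD n0)
      then show "norm (vnorm \<F> (\<xi> n \<ominus>\<^bsub>\<F>\<^esub> f) - 0) < e"
        using e Fm.N_nonneg[OF F.minus_in[OF \<xi> fF'], of n] by simp
    qed
  qed
  then show "\<exists>l\<in>carrier \<F>. (\<lambda>n. vnorm \<F> (\<xi> n \<ominus>\<^bsub>\<F>\<^esub> l)) \<longlonglongrightarrow> 0"
    using fF' by blast
qed

theorem operator_space_calderon: "operator_space \<F>"
  using Fm.matnormed_axioms calderon_mcomplete by (simp add: operator_space_iff op_dist_def)

sublocale FO: opspace \<F>
  by unfold_locales (rule operator_space_calderon)

end

section \<open>Evaluation and derivative at a point\<close>

locale interpolation = couple s X0 X1
  for s :: "complex \<Rightarrow> 'v \<Rightarrow> 'v::{topological_ab_group_add, t2_space}" and X0 X1 :: "'v opspace" +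
  fixes \<theta> :: real
  assumes \<theta>_pos: "0 < \<theta>" and \<theta>_less: "\<theta> < 1"
begin

abbreviation th :: complex where "th \<equiv> of_real \<theta>"

lemma th_interior: "th \<in> interior strip"
  using \<theta>_pos \<theta>_less by (simp add: interior_strip)

lemma th_strip: "th \<in> strip"
  using th_interior interior_subset by blast

abbreviation d\<theta> :: "(complex \<Rightarrow> 'v) \<Rightarrow> 'v" where "d\<theta> \<equiv> deriv_at s X0 X1 \<theta>"

lemma has_sum_deriv_d\<theta>:
  assumes "f \<in> \<C>"
  shows "has_sum_deriv s X0 X1 f (d\<theta> f) th"
  unfolding deriv_at_def sum_deriv_def
proof (rule theI')
  obtain L where L: "has_sum_deriv s X0 X1 f L th"
    using calderonD(4)[OF assms th_interior] by blast
  show "\<exists>!L. has_sum_deriv s X0 X1 f L th"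
    using L has_sum_deriv_unique[OF _ L calderonD(2)[OF assms]] by blast
qed

lemma d\<theta>_Sig: "f \<in> \<C> \<Longrightarrow> d\<theta> f \<in> Sig"
  using has_sum_deriv_d\<theta> by (auto simp: has_sum_deriv_def)

lemma d\<theta>_weak:
  assumes "f \<in> \<C>" "\<phi> \<in> \<Sigma>.dual_ball"
  shows "((\<lambda>z. \<phi> (f z)) has_field_derivative \<phi> (d\<theta> f)) (at th)"
  by (rule has_sum_deriv_imp_weak[OF has_sum_deriv_d\<theta>[OF assms(1)] calderonD(2)[OF assms(1)] assms(2)])

text \<open>Functionals separate points, so a derivative can be computed weakly.\<close>

lemma d\<theta>_eqI:
  assumes f: "f \<in> \<C>" and L: "L \<in> Sig"
    and weak: "\<And>\<phi>. \<phi> \<in> \<Sigma>.dual_ball \<Longrightarrow> ((\<lambda>z. \<phi> (f z)) has_field_derivative \<phi> L) (at th)"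
  shows "d\<theta> f = L"
proof -
  have "d\<theta> f - L = 0"
  proof (rule dual_separates)
    show "d\<theta> f - L \<in> Sig" by (rule \<Sigma>.V_diff[OF d\<theta>_Sig[OF f] L])
    fix \<phi> assume \<phi>: "\<phi> \<in> \<Sigma>.dual_ball"
    show "\<phi> (d\<theta> f - L) = 0"
      using DERIV_unique[OF d\<theta>_weak[OF f \<phi>] weak[OF \<phi>]] \<Sigma>.dual_ballD(5)[OF \<phi> d\<theta>_Sig[OF f] L] by simp
  qed
  then show ?thesis by simp
qed

lemma d\<theta>_add:
  assumes f: "f \<in> \<C>" and g: "g \<in> \<C>"
  shows "d\<theta> (\<lambda>z. f z + g z) = d\<theta> f + d\<theta> g"
proof (rule d\<theta>_eqI[OF calderon_add[OF f g]])
  show "d\<theta> f + d\<theta> g \<in> Sig" by (rule \<Sigma>.V_add[OF d\<theta>_Sig[OF f] d\<theta>_Sig[OF g]])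
  fix \<phi> assume \<phi>: "\<phi> \<in> \<Sigma>.dual_ball"
  show "((\<lambda>z. \<phi> (f z + g z)) has_field_derivative \<phi> (d\<theta> f + d\<theta> g)) (at th)"
    unfolding \<Sigma>.dual_ballD(1)[OF \<phi> calderonD(2)[OF f] calderonD(2)[OF g]]
      \<Sigma>.dual_ballD(1)[OF \<phi> d\<theta>_Sig[OF f] d\<theta>_Sig[OF g]]
    by (rule DERIV_add[OF d\<theta>_weak[OF f \<phi>] d\<theta>_weak[OF g \<phi>]])
qed

text \<open>After composition with a functional this is the scalar product rule.\<close>

lemma d\<theta>_times:
  assumes f: "f \<in> \<C>" and uf: "(\<lambda>z. s (u z) (f z)) \<in> \<C>"
    and u: "(u has_field_derivative d) (at th)"
  shows "d\<theta> (\<lambda>z. s (u z) (f z)) = s d (f th) + s (u th) (d\<theta> f)"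
proof (rule d\<theta>_eqI[OF uf])
  have S: "s d (f th) \<in> Sig" "s (u th) (d\<theta> f) \<in> Sig"
    using calderonD(2)[OF f] d\<theta>_Sig[OF f] by auto
  then show "s d (f th) + s (u th) (d\<theta> f) \<in> Sig" by (rule \<Sigma>.V_add)
  fix \<phi> assume \<phi>: "\<phi> \<in> \<Sigma>.dual_ball"
  show "((\<lambda>z. \<phi> (s (u z) (f z))) has_field_derivative \<phi> (s d (f th) + s (u th) (d\<theta> f))) (at th)"
    unfolding \<Sigma>.dual_ballD(1)[OF \<phi> S] \<Sigma>.dual_ballD(2)[OF \<phi> calderonD(2)[OF f]]
      \<Sigma>.dual_ballD(2)[OF \<phi> d\<theta>_Sig[OF f]]
    using DERIV_mult[OF u d\<theta>_weak[OF f \<phi>]] by (simp add: algebra_simps)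
qed

lemma d\<theta>_smult:
  assumes f: "f \<in> \<C>"
  shows "d\<theta> (\<lambda>z. s c (f z)) = s c (d\<theta> f)"
  using d\<theta>_times[OF f calderon_smult[OF f] DERIV_const] by simp

lemma d\<theta>_zero: "d\<theta> (\<lambda>z. 0) = 0"
  using d\<theta>_smult[OF calderon_zero, of 0] by simp

text \<open>By Cauchy's inequality on a disc around \<open>\<theta>\<close> inside the strip, applied to \<open>\<phi> \<circ> f\<close>.\<close>

lemma d\<theta>_bound:
  obtains C where "C \<ge> 0" "\<And>f. f \<in> carrier \<F> \<Longrightarrow> sn (d\<theta> f) \<le> C * vnorm \<F> f"
proof -
  obtain r where r: "r > 0" "cball th r \<subseteq> interior strip"
    by (rule interior_strip_ball[OF th_interior])
  show ?thesis
  proof (rule that[of "1 / r"])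
    fix f assume f: "f \<in> carrier \<F>"
    then have fc: "f \<in> \<C>" by simp
    show "sn (d\<theta> f) \<le> 1 / r * vnorm \<F> f"
    proof (rule \<Sigma>.N_le_dualI[OF d\<theta>_Sig[OF fc]])
      fix \<phi> assume \<phi>: "\<phi> \<in> \<Sigma>.dual_ball"
      let ?h = "\<lambda>z. \<phi> (f z)"
      have hol: "?h holomorphic_on cball th r"
        using calderon_weakly_holomorphic[OF fc \<phi>] r(2) by (rule holomorphic_on_subset)
      have "cmod ((deriv ^^ 1) ?h th) \<le> fact 1 * vnorm \<F> f / r ^ 1"
      proof (rule Cauchy_inequality)
        show "?h holomorphic_on ball th r" using hol ball_subset_cball by (rule holomorphic_on_subset)
        show "continuous_on (cball th r) ?h" using hol by (rule holomorphic_on_imp_continuous_on)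
        show "cmod (?h z) \<le> vnorm \<F> f" for z
          using \<Sigma>.dual_ballD(3)[OF \<phi> calderonD(2)[OF fc], of z] sn_le_vnorm_F[OF f, of z] by (rule order_trans)
      qed (rule r(1))
      moreover have "deriv ?h th = \<phi> (d\<theta> f)"
        by (rule DERIV_imp_deriv[OF d\<theta>_weak[OF fc \<phi>]])
      ultimately show "cmod (\<phi> (d\<theta> f)) \<le> 1 / r * vnorm \<F> f" by simp
    qed
  qed (use r in simp)
qed

lemma disc_map_boundary:
  assumes "disc_map \<theta> u d" "side X p"
  shows "cmod (u (p t)) = 1"
  using assms disc_mapD(4,5)[OF assms(1)] by (auto simp: side_def)

text \<open>The singularity of \<open>f / u\<close> at \<open>\<theta>\<close> is removable, the value there being \<open>f' \<theta> / d\<close>, the limit of the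
  difference quotients of \<open>f\<close> divided by those of \<open>u\<close>.  The quotient is bounded on the compact part of the
  strip by continuity and elsewhere because \<open>u\<close> is bounded below.\<close>

lemma calderon_divide:
  assumes f: "f \<in> \<C>" and f0: "f th = 0" and u: "disc_map \<theta> u d"
  obtains g where "g \<in> \<C>" "\<And>z. z \<in> strip \<Longrightarrow> f z = s (u z) (g z)"
proof -
  note fD = calderonD[OF f]
  note hol = disc_mapD(1)[OF u] and cont = disc_mapD(2)[OF u] and zero = disc_mapD(6)[OF u]
    and d = disc_mapD(7,8)[OF u] and far = disc_mapD(9)[OF u] and unit = disc_map_boundary[OF u]
  define g where "g z = (if z = th then s (inverse d) (d\<theta> f) else s (inverse (u z)) (f z))" for z
  have gS: "g z \<in> Sig" for z
    using fD(2) d\<theta>_Sig[OF f] by (simp add: g_def)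
  have fg: "f z = s (u z) (g z)" if "z \<in> strip" for z
    using zero[OF that] f0 by (auto simp: g_def)
  have g_th: "((\<lambda>w. sn (g w - g th)) \<longlongrightarrow> 0) (at th)"
  proof -
    have "((\<lambda>w. (u w - u th) / (w - th)) \<longlongrightarrow> d) (at th)"
      using d(1) by (simp add: has_field_derivative_iff)
    then have c: "((\<lambda>w. inverse ((u w - u th) / (w - th))) \<longlongrightarrow> inverse d) (at th)"
      using d(2) by (rule tendsto_inverse)
    have x: "((\<lambda>w. sn (s (inverse (w - th)) (f w - f th) - d\<theta> f)) \<longlongrightarrow> 0) (at th)"
      using has_sum_deriv_d\<theta>[OF f] by (simp add: has_sum_deriv_def)
    have "((\<lambda>w. sn (s (inverse ((u w - u th) / (w - th))) (s (inverse (w - th)) (f w - f th)) - s (inverse d) (d\<theta> f))) \<longlongrightarrow> 0) (at th)"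
      using fD(2) by (intro \<Sigma>.tendsto_scale[OF c x] d\<theta>_Sig[OF f]) auto
    moreover have "\<forall>\<^sub>F w in at th. sn (s (inverse ((u w - u th) / (w - th))) (s (inverse (w - th)) (f w - f th)) - s (inverse d) (d\<theta> f))
        = sn (g w - g th)"
    proof -
      have "s (inverse ((u w - u th) / (w - th))) (s (inverse (w - th)) (f w - f th)) = g w" if "w \<noteq> th" for w
      proof -
        have "inverse ((u w - u th) / (w - th)) * inverse (w - th) = inverse (u w)"
          using that zero[OF th_strip] by (simp add: field_simps)
        then show ?thesis using that by (simp add: g_def f0)
      qed
      then show ?thesis
        by (auto simp: eventually_at_filter g_def)
    qed
    ultimately show ?thesis by (rule Lim_transform_eventually)
  qed
  have g_cont: "((\<lambda>w. sn (g w - g z)) \<longlongrightarrow> 0) (at z within strip)" if z: "z \<in> strip" for z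
  proof (cases "z = th")
    case True
    then show ?thesis using g_th by (auto intro: tendsto_within_subset)
  next
    case False
    have "((\<lambda>w. inverse (u w)) \<longlongrightarrow> inverse (u z)) (at z within strip)"
      using cont z zero[OF z] False by (intro tendsto_inverse) (auto simp: continuous_on_def)
    then have "((\<lambda>w. sn (s (inverse (u w)) (f w) - s (inverse (u z)) (f z))) \<longlongrightarrow> 0) (at z within strip)"
      by (intro \<Sigma>.tendsto_scale fD z)
    moreover have "\<forall>\<^sub>F w in at z within strip. sn (s (inverse (u w)) (f w) - s (inverse (u z)) (f z)) = sn (g w - g z)"
      unfolding eventually_at_topological
      by (intro exI[of _ "- {th}"]) (use False in \<open>auto simp: g_def\<close>)
    ultimately show ?thesis by (rule Lim_transform_eventually)
  qed
  have "\<exists>B. \<forall>z\<in>strip. sn (g z) \<le> B"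
  proof -
    obtain Bf where Bf: "\<And>z. z \<in> strip \<Longrightarrow> sn (f z) \<le> Bf"
      by (rule calderon_bounds[OF f]) blast
    let ?K = "cbox (Complex 0 (-1)) (Complex 1 1)"
    have K_iff: "z \<in> ?K \<longleftrightarrow> z \<in> strip \<and> \<bar>Im z\<bar> \<le> 1" for z
      unfolding in_cbox_complex_iff strip_def mem_Collect_eq abs_le_iff complex.sel atLeastAtMost_iff by linarith
    have K: "?K \<subseteq> strip"
      by (rule subsetI) (simp only: K_iff)
    have "continuous_on strip (\<lambda>z. sn (g z))"
      unfolding continuous_on_def
    proof (rule ballI, rule LIM_zero_cancel)
      fix z assume z: "z \<in> strip"
      show "((\<lambda>w. sn (g w) - sn (g z)) \<longlongrightarrow> 0) (at z within strip)"
      proof (rule Lim_null_comparison[OF _ g_cont[OF z]], intro always_eventually allI)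
        show "norm (sn (g w) - sn (g z)) \<le> sn (g w - g z)" for w
          unfolding real_norm_def by (rule \<Sigma>.N_abs_diff[OF gS gS])
      qed
    qed
    then have "compact ((\<lambda>z. sn (g z)) ` ?K)"
      by (intro compact_continuous_image[OF continuous_on_subset[OF _ K]] compact_cbox)
    then have "bdd_above ((\<lambda>z. sn (g z)) ` ?K)"
      by (intro bounded_imp_bdd_above compact_imp_bounded)
    then obtain B1 where B1: "\<And>z. z \<in> ?K \<Longrightarrow> sn (g z) \<le> B1"
      by (auto simp: bdd_above_def)
    have "sn (g z) \<le> max B1 (5 * Bf)" if z: "z \<in> strip" for z
    proof (cases "\<bar>Im z\<bar> > 1")
      case True
      then have "z \<noteq> th" by auto
      then have "sn (g z) = inverse (cmod (u z)) * sn (f z)"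
        using fD(2) by (simp add: g_def \<Sigma>.N_s norm_inverse)
      also have "\<dots> \<le> 5 * Bf"
      proof (intro mult_mono Bf z \<Sigma>.N_ge_0 fD(2))
        show "inverse (cmod (u z)) \<le> 5"
          using le_imp_inverse_le[OF far[OF z True]] by simp
      qed simp
      finally show ?thesis by simp
    next
      case False
      then have "z \<in> ?K" unfolding K_iff using z by simp
      then show ?thesis using B1[of z] by simp
    qed
    then show ?thesis by blast
  qed
  then obtain B where B: "\<And>z. z \<in> strip \<Longrightarrow> sn (g z) \<le> B" by blast
  obtain B' where B': "\<And>X p t. side X p \<Longrightarrow> vnorm X (f (p t)) \<le> B'"
    by (rule calderon_bounds[OF f]) blast
  have "g \<in> \<C>"
  proof (rule calderonI[of g "max B B'"])
    show "g z = 0" if "z \<notin> strip" for z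
      using that th_strip fD(1)[OF that] by (auto simp: g_def)
    show "g z \<in> Sig" for z by (rule gS)
    show "((\<lambda>w. sn (g w - g z)) \<longlongrightarrow> 0) (at z within strip)" if "z \<in> strip" for z
      by (rule g_cont[OF that])
    show "sn (g z) \<le> max B B'" if "z \<in> strip" for z
      by (rule max.coboundedI1[OF B[OF that]])
    show "(\<lambda>z. \<phi> (g z)) holomorphic_on interior strip" if \<phi>: "\<phi> \<in> \<Sigma>.dual_ball" for \<phi>
    proof (rule no_isolated_singularity'[where K = "{th}"])
      fix z assume "z \<in> {th}"
      then have z: "z = th" by simp
      have "((\<lambda>w. \<phi> (g w)) \<longlongrightarrow> \<phi> (g th)) (at th)"
        by (rule dual_tendsto[OF g_th gS gS \<phi>])
      then show "((\<lambda>w. \<phi> (g w)) \<longlongrightarrow> \<phi> (g z)) (at z within interior strip)"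
        unfolding z by (rule tendsto_within_subset) simp
    next
      have "(\<lambda>z. inverse (u z) * \<phi> (f z)) holomorphic_on interior strip - {th}"
      proof (intro holomorphic_intros)
        show "u holomorphic_on interior strip - {th}"
          using hol by (rule holomorphic_on_subset) blast
        show "(\<lambda>z. \<phi> (f z)) holomorphic_on interior strip - {th}"
          using calderon_weakly_holomorphic[OF f \<phi>] by (rule holomorphic_on_subset) blast
        fix z assume "z \<in> interior strip - {th}"
        then show "u z \<noteq> 0" using zero[of z] interior_subset by blast
      qed
      then show "(\<lambda>z. \<phi> (g z)) holomorphic_on interior strip - {th}"
        by (rule holomorphic_transform) (simp add: g_def \<Sigma>.dual_ballD(2)[OF \<phi> fD(2)])
    qed simp_all
    fix X p t assume sd: "side X p"
    interpret B: boundary s X0 X1 X p by (rule boundaryI[OF sd])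
    have g_p: "g (p t) = s (inverse (u (p t))) (f (p t))" for t
      using B.p_not_interior[of t] th_interior by (auto simp: g_def)
    have u_p: "u (p t) \<noteq> 0" for t
      using unit[OF sd, of t] by auto
    show "g (p t) \<in> carrier X"
      unfolding g_p by (rule B.X.sub.V_s[OF fD(5)[OF sd]])
    show "((\<lambda>t'. vnorm X (g (p t') - g (p t))) \<longlongrightarrow> 0) (at t)"
      unfolding g_p by (intro B.X.sub.tendsto_scale fD sd tendsto_inverse B.tendsto_p[OF cont] u_p)
    show "vnorm X (g (p t)) \<le> max B B'"
      unfolding g_p B.X.sub.N_s[OF fD(5)[OF sd]] using B'[OF sd, of t] by (simp add: norm_inverse unit[OF sd])
  qed
  then show ?thesis using fg by (rule that)
qed


section \<open>Lifting through evaluation and derivative\<close>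

text \<open>The norm of \<open>\<F>\<close> only sees the boundary lines, where \<open>u\<close> acts as scalars of modulus \<open>c\<close>.\<close>

lemma mnorm_F_times_const:
  assumes n: "n > 0" and f: "f \<in> mats \<F> n" and g: "g \<in> mats \<F> n"
    and fg: "\<And>i j z. \<lbrakk>i < n; j < n; z \<in> strip\<rbrakk> \<Longrightarrow> f i j z = s (u z) (g i j z)"
    and c: "\<And>X p t. side X p \<Longrightarrow> cmod (u (p t)) = c"
  shows "mnorm \<F> n f \<le> c * mnorm \<F> n g" and "c * mnorm \<F> n g \<le> mnorm \<F> n f"
proof -
  have c0: "0 \<le> c" using c[OF side_left, of 0] norm_ge_zero by metis
  have eq: "mnorm X n (\<lambda>i j. f i j (p t)) = c * mnorm X n (\<lambda>i j. g i j (p t))" if sd: "side X p" for X p t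
  proof -
    interpret B: boundary s X0 X1 X p by (rule boundaryI[OF sd])
    have "mnorm X n (\<lambda>i j. f i j (p t)) = mnorm X n (\<lambda>i j. u (p t) \<odot>\<^bsub>X\<^esub> g i j (p t))"
      using fg B.p_strip by (intro B.X.mnorm_cong[OF n]) simp
    then show ?thesis
      by (simp only: B.X.mnorm_smult[OF n mats_boundary[OF sd g]] c[OF sd])
  qed
  show "mnorm \<F> n f \<le> c * mnorm \<F> n g"
    by (rule mnorm_F_leI) (simp only: eq mnorm_F_ge[OF _ n g] mult_left_mono c0)
  show "c * mnorm \<F> n g \<le> mnorm \<F> n f"
  proof (cases "c = 0")
    case True
    then show ?thesis using Fm.mnorm_nonneg[OF n f] by simp
  next
    case False
    then have "mnorm \<F> n g \<le> mnorm \<F> n f / c"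
      using c0 mnorm_F_ge[OF _ n f] by (intro mnorm_F_leI) (simp add: eq pos_le_divide_eq mult.commute)
    then show ?thesis using c0 False by (simp add: pos_le_divide_eq mult.commute)
  qed
qed

text \<open>The lift is \<open>h = (u / d) g\<close>.\<close>

lemma derivative_lift:
  obtains C where "C \<ge> 0" "\<And>n g. \<lbrakk>n > 0; g \<in> mats \<F> n\<rbrakk> \<Longrightarrow>
    \<exists>h\<in>mats \<F> n. (\<forall>i<n. \<forall>j<n. h i j th = 0 \<and> d\<theta> (h i j) = g i j th) \<and> mnorm \<F> n h \<le> C * mnorm \<F> n g"
proof -
  obtain u d where ud: "disc_map \<theta> u d"
    using exists_disc_map[OF \<theta>_pos \<theta>_less] by blast
  note u = disc_mapD[OF ud]
  show ?thesis
  proof (rule that[of "1 / cmod d"])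
    fix n :: nat and g assume n: "n > 0" and g: "g \<in> mats \<F> n"
    let ?v = "\<lambda>z. u z / d"
    let ?h = "\<lambda>i j z. s (?v z) (g i j z)"
    have gc: "g i j \<in> \<C>" if "i < n" "j < n" for i j
      using g that by (simp add: mats_def)
    have hc: "?h i j \<in> \<C>" if "i < n" "j < n" for i j
    proof (rule calderon_times[OF gc[OF that]])
      show "continuous_on strip ?v" using u(2,8) by (intro continuous_intros) auto
      show "?v holomorphic_on interior strip" using u(1,8) by (intro holomorphic_intros) auto
      show "cmod (?v z) \<le> 1 / cmod d" if "z \<in> strip" for z
        using u(3)[OF that] by (simp add: norm_divide divide_right_mono)
    qed
    then have h: "?h \<in> mats \<F> n" by (simp add: mats_def)
    have v: "(?v has_field_derivative 1) (at th)"
      using DERIV_cdivide[OF u(7), of d] u(8) by simp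
    have "?v th = 0" using u(6)[OF th_strip] by simp
    then have "?h i j th = 0 \<and> d\<theta> (?h i j) = g i j th" if "i < n" "j < n" for i j
      using d\<theta>_times[OF gc[OF that] hc[OF that] v] by simp
    moreover have "mnorm \<F> n ?h \<le> 1 / cmod d * mnorm \<F> n g"
      by (rule mnorm_F_times_const(1)[OF n h g, of ?v]) (simp_all add: norm_divide disc_map_boundary[OF ud])
    ultimately show "\<exists>h\<in>mats \<F> n. (\<forall>i<n. \<forall>j<n. h i j th = 0 \<and> d\<theta> (h i j) = g i j th) \<and> mnorm \<F> n h \<le> 1 / cmod d * mnorm \<F> n g"
      using h by (intro bexI[of _ ?h]) simp_all
  qed simp
qed

text \<open>The lift is \<open>(d / u) f\<close>, which exists by \<open>calderon_divide\<close>; the product rule for \<open>f = u g\<close> at the zero of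
  \<open>u\<close> gives \<open>f' \<theta> = d g \<theta>\<close>.\<close>

lemma kernel_lift:
  obtains C where "C \<ge> 0" "\<And>n f. \<lbrakk>n > 0; f \<in> mats \<F> n; \<And>i j. \<lbrakk>i < n; j < n\<rbrakk> \<Longrightarrow> f i j th = 0\<rbrakk> \<Longrightarrow>
    \<exists>g\<in>mats \<F> n. (\<forall>i<n. \<forall>j<n. g i j th = d\<theta> (f i j)) \<and> mnorm \<F> n g \<le> C * mnorm \<F> n f"
proof -
  obtain u d where ud: "disc_map \<theta> u d"
    using exists_disc_map[OF \<theta>_pos \<theta>_less] by blast
  note u = disc_mapD[OF ud]
  show ?thesis
  proof (rule that[of "cmod d"])
    fix n :: nat and f assume n: "n > 0" and f: "f \<in> mats \<F> n"
      and f0: "\<And>i j. \<lbrakk>i < n; j < n\<rbrakk> \<Longrightarrow> f i j th = 0"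
    have fc: "f i j \<in> \<C>" if "i < n" "j < n" for i j
      using f that by (simp add: mats_def)
    have "\<exists>g. g \<in> \<C> \<and> (\<forall>z\<in>strip. f i j z = s (u z) (g z))" if "i < n" "j < n" for i j
      by (rule calderon_divide[OF fc[OF that] f0[OF that] ud]) blast+
    then obtain g where g: "\<And>i j. \<lbrakk>i < n; j < n\<rbrakk> \<Longrightarrow> g i j \<in> \<C>"
      "\<And>i j z. \<lbrakk>i < n; j < n; z \<in> strip\<rbrakk> \<Longrightarrow> f i j z = s (u z) (g i j z)"
      by metis
    have gm: "g \<in> mats \<F> n" using g(1) by (simp add: mats_def)
    have fg: "f i j = (\<lambda>z. s (u z) (g i j z))" if "i < n" "j < n" for i j
    proof
      fix z show "f i j z = s (u z) (g i j z)"
        using g(2)[OF that, of z] calderonD(1)[OF fc[OF that], of z] calderonD(1)[OF g(1)[OF that], of z]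
        by (cases "z \<in> strip") simp_all
    qed
    have dg: "d\<theta> (f i j) = s d (g i j th)" if "i < n" "j < n" for i j
      using d\<theta>_times[OF g(1)[OF that] _ u(7)] fc[OF that] u(6)[OF th_strip] unfolding fg[OF that] by simp
    have "1 * mnorm \<F> n g \<le> mnorm \<F> n f"
      by (rule mnorm_F_times_const(2)[where u = u, OF n f gm]) (simp_all add: g(2) disc_map_boundary[OF ud])
    then have "mnorm \<F> n (\<lambda>i j. d \<odot>\<^bsub>\<F>\<^esub> g i j) \<le> cmod d * mnorm \<F> n f"
      using Fm.mnorm_smult[OF n gm, of d] by (simp add: mult_left_mono)
    moreover have "(\<lambda>i j. d \<odot>\<^bsub>\<F>\<^esub> g i j) \<in> mats \<F> n"
      using g(1) by (simp add: mats_def calderon_smult)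
    ultimately show "\<exists>g\<in>mats \<F> n. (\<forall>i<n. \<forall>j<n. g i j th = d\<theta> (f i j)) \<and> mnorm \<F> n g \<le> cmod d * mnorm \<F> n f"
      by (intro bexI[of _ "\<lambda>i j. d \<odot>\<^bsub>\<F>\<^esub> g i j"]) (simp_all add: dg)
  qed simp
qed

section \<open>The interpolation space and the space of jets\<close>

abbreviation E :: "'v opspace" where "E \<equiv> interp s X0 X1 \<theta>"

abbreviation dE :: "('v \<times> 'v) opspace" where "dE \<equiv> dinterp s X0 X1 \<theta>"

abbreviation jet :: "(complex \<Rightarrow> 'v) \<Rightarrow> 'v \<times> 'v" where
  "jet f \<equiv> (eval_at \<theta> f, deriv_at s X0 X1 \<theta> f)"

lemma E_simps [simp]:
  "carrier E = eval_at \<theta> ` \<C>" "zero E = 0" "add E = (+)" "smult E = s"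
  by (simp_all add: interp_def quotient_on_range_def ambient_def)

lemma dE_simps [simp]:
  "carrier dE = jet ` \<C>" "zero dE = (0, 0)" "add dE = (+)"
  "smult dE = (\<lambda>c u. (s c (fst u), s c (snd u)))"
  by (simp_all add: dinterp_def quotient_on_range_def ambient_def zero_prod_def)

lemma cmodule_ambient:
  fixes s' :: "complex \<Rightarrow> 'w \<Rightarrow> 'w::ab_group_add"
  assumes "vector_space s'"
  shows "cmodule (ambient s')"
proof -
  interpret V: vector_space s' by fact
  have "abelian_group (ambient s')"
  proof (rule abelian_groupI)
    fix x assume "x \<in> carrier (ambient s')"
    show "\<exists>y\<in>carrier (ambient s'). y \<oplus>\<^bsub>ambient s'\<^esub> x = \<zero>\<^bsub>ambient s'\<^esub>"
      by (intro bexI[of _ "- x"]) (simp_all add: ambient_def)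
  qed (simp_all add: ambient_def algebra_simps)
  then show ?thesis
    unfolding cmodule_def
    by (intro Module.moduleI cring_complex_ring)
      (simp_all add: ambient_def V.scale_left_distrib V.scale_right_distrib)
qed

lemma vector_space_pair: "vector_space (\<lambda>c u. (s c (fst u), s c (snd u)))"
  by unfold_locales (simp_all add: prod_eq_iff X0.sub.scale_left_distrib X0.sub.scale_right_distrib)

lemma linear_map_eval: "linear_map \<F> (ambient s) (eval_at \<theta>)"
  by (simp add: linear_map_def ambient_def eval_at_def)

lemma linear_map_jet: "linear_map \<F> (ambient (\<lambda>c u. (s c (fst u), s c (snd u)))) jet"
  by (simp add: linear_map_def ambient_def eval_at_def d\<theta>_add d\<theta>_smult d\<theta>_zero zero_prod_def)

sublocale QE: metric_quotient_map \<F> E "eval_at \<theta>"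
  by unfold_locales
    (simp only: interp_def metric_quotient_on_range[OF F.cmodule_axioms cmodule_ambient[OF X0.vector_space] linear_map_eval])

sublocale QD: metric_quotient_map \<F> dE jet
  by unfold_locales
    (simp only: dinterp_def metric_quotient_on_range[OF F.cmodule_axioms cmodule_ambient[OF vector_space_pair] linear_map_jet])

lemma sn_small_imp_zero:
  assumes "x \<in> Sig" "\<And>e. e > 0 \<Longrightarrow> sn x \<le> C * e" "C \<ge> 0"
  shows "x = 0"
proof -
  have "sn x \<le> 0 + e" if e: "e > 0" for e
  proof -
    have "sn x \<le> C * (e / (C + 1))"
      using e assms(3) by (intro assms(2)) simp
    also have "\<dots> \<le> (C + 1) * (e / (C + 1))"
      using e assms(3) by (intro mult_right_mono) simp_all
    also have "\<dots> = e" using assms(3) by simp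
    finally show ?thesis by simp
  qed
  then have "sn x \<le> 0" by (rule field_le_epsilon)
  then show ?thesis
    using \<Sigma>.N_ge_0[OF assms(1)] by (intro sn_zero_imp[OF assms(1)]) simp
qed

text \<open>\<open>sn_le_vnorm_F\<close> bounds \<open>f \<theta> = (f - k) \<theta>\<close> by the distance of \<open>f\<close> from \<open>k\<close>.\<close>

lemma approx_kernel_eval:
  assumes f: "f \<in> carrier \<F>"
    and approx: "\<And>e. e > 0 \<Longrightarrow> \<exists>k\<in>carrier \<F>. k th = 0 \<and> vnorm \<F> (f \<ominus>\<^bsub>\<F>\<^esub> k) < e"
  shows "f th = 0"
proof (rule sn_small_imp_zero[where C = 1])
  show "f th \<in> Sig" using f by (simp add: calderonD)
  fix e :: real assume "e > 0"
  then obtain k where k: "k \<in> carrier \<F>" "k th = 0" "vnorm \<F> (f \<ominus>\<^bsub>\<F>\<^esub> k) < e"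
    using approx by blast
  have "(f \<ominus>\<^bsub>\<F>\<^esub> k) th = f th"
    using k(2) by (simp add: F_diff[OF f k(1)])
  then show "sn (f th) \<le> 1 * e"
    using sn_le_vnorm_F[OF F.minus_in[OF f k(1)], of th] k(3) by simp
qed simp

lemma operator_space_E: "operator_space E"
proof (rule operator_space_quotient[OF operator_space_calderon QE.quot])
  fix f assume f: "f \<in> carrier \<F>"
    and "\<And>e. e > 0 \<Longrightarrow> \<exists>k\<in>carrier \<F>. eval_at \<theta> k = \<zero>\<^bsub>E\<^esub> \<and> vnorm \<F> (f \<ominus>\<^bsub>\<F>\<^esub> k) < e"
  then have "f th = 0"
    by (intro approx_kernel_eval[OF f]) (simp add: eval_at_def)
  then show "eval_at \<theta> f = \<zero>\<^bsub>E\<^esub>" by (simp add: eval_at_def)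
qed

lemma operator_space_dE: "operator_space dE"
proof (rule operator_space_quotient[OF operator_space_calderon QD.quot])
  fix f assume f: "f \<in> carrier \<F>"
    and approx: "\<And>e. e > 0 \<Longrightarrow> \<exists>k\<in>carrier \<F>. jet k = \<zero>\<^bsub>dE\<^esub> \<and> vnorm \<F> (f \<ominus>\<^bsub>\<F>\<^esub> k) < e"
  have A: "\<exists>k\<in>carrier \<F>. k th = 0 \<and> d\<theta> k = 0 \<and> vnorm \<F> (f \<ominus>\<^bsub>\<F>\<^esub> k) < e" if "e > 0" for e
    using approx[OF that] by (simp add: eval_at_def)
  have "f th = 0"
    using A by (intro approx_kernel_eval[OF f]) blast
  moreover have "d\<theta> f = 0"
  proof -
    obtain C where C: "C \<ge> 0" "\<And>f. f \<in> carrier \<F> \<Longrightarrow> sn (d\<theta> f) \<le> C * vnorm \<F> f"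
      by (rule d\<theta>_bound) blast
    show ?thesis
    proof (rule sn_small_imp_zero[OF _ _ C(1)])
      show "d\<theta> f \<in> Sig" using f by (simp add: d\<theta>_Sig)
      fix e :: real assume "e > 0"
      then obtain k where k: "k \<in> carrier \<F>" "d\<theta> k = 0" "vnorm \<F> (f \<ominus>\<^bsub>\<F>\<^esub> k) < e"
        using A by blast
      have "d\<theta> (f \<ominus>\<^bsub>\<F>\<^esub> k) = d\<theta> f"
        using f k(1,2) d\<theta>_add[of f "\<lambda>z. s (-1) (k z)"] d\<theta>_smult[of k "-1"] calderon_smult[of k "-1"]
        by (simp add: F.minus_conv_smult)
      then have "sn (d\<theta> f) \<le> C * vnorm \<F> (f \<ominus>\<^bsub>\<F>\<^esub> k)"
        using C(2)[OF F.minus_in[OF f k(1)]] by simp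
      also have "\<dots> \<le> C * e" using k(3) C(1) by (intro mult_left_mono) simp_all
      finally show "sn (d\<theta> f) \<le> C * e" .
    qed
  qed
  ultimately show "jet f = \<zero>\<^bsub>dE\<^esub>" by (simp add: eval_at_def)
qed

sublocale OE: opspace E by unfold_locales (rule operator_space_E)
sublocale OD: opspace dE by unfold_locales (rule operator_space_dE)

section \<open>The extension by values and derivatives\<close>

text \<open>Both directions are instances of the lifting lemmas: derivatives of functions vanishing at \<open>\<theta>\<close> are
  values at \<open>\<theta>\<close>, and conversely.\<close>

lemma mem_E_iff_jet: "(0, y) \<in> carrier dE \<longleftrightarrow> y \<in> carrier E"
proof
  assume "(0, y) \<in> carrier dE"
  then obtain f where f: "f \<in> carrier \<F>" "f th = 0" "d\<theta> f = y"
    by (auto simp: eval_at_def)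
  obtain C where "\<And>n f. \<lbrakk>n > 0; f \<in> mats \<F> n; \<And>i j. \<lbrakk>i < n; j < n\<rbrakk> \<Longrightarrow> f i j th = 0\<rbrakk> \<Longrightarrow>
    \<exists>g\<in>mats \<F> n. (\<forall>i<n. \<forall>j<n. g i j th = d\<theta> (f i j)) \<and> mnorm \<F> n g \<le> C * mnorm \<F> n f"
    by (rule kernel_lift) blast
  from this[of 1 "\<lambda>i j. f"] obtain g where "g \<in> mats \<F> 1" "g 0 0 th = y"
    using f by (auto simp: mats_def)
  then show "y \<in> carrier E"
    by (auto simp: mats_def eval_at_def)
next
  assume "y \<in> carrier E"
  then obtain g where g: "g \<in> carrier \<F>" "g th = y"
    by (auto simp: eval_at_def)
  obtain C where "\<And>n g. \<lbrakk>n > 0; g \<in> mats \<F> n\<rbrakk> \<Longrightarrow>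
    \<exists>h\<in>mats \<F> n. (\<forall>i<n. \<forall>j<n. h i j th = 0 \<and> d\<theta> (h i j) = g i j th) \<and> mnorm \<F> n h \<le> C * mnorm \<F> n g"
    by (rule derivative_lift) blast
  from this[of 1 "\<lambda>i j. g"] obtain h where "h \<in> mats \<F> 1" "h 0 0 th = 0" "d\<theta> (h 0 0) = y"
    using g by (auto simp: mats_def)
  then show "(0, y) \<in> carrier dE"
    by (auto simp: mats_def eval_at_def image_iff intro!: bexI[of _ "h 0 0"])
qed

text \<open>A lift \<open>g\<close> of \<open>y\<close> yields a lift \<open>(u / d) g\<close> of \<open>(0, y)\<close>.\<close>

lemma incl_completely_bounded: "completely_bounded E dE (\<lambda>y. (0, y))"
proof -
  obtain C where C: "C \<ge> 0" "\<And>n g. \<lbrakk>n > 0; g \<in> mats \<F> n\<rbrakk> \<Longrightarrow>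
    \<exists>h\<in>mats \<F> n. (\<forall>i<n. \<forall>j<n. h i j th = 0 \<and> d\<theta> (h i j) = g i j th) \<and> mnorm \<F> n h \<le> C * mnorm \<F> n g"
    by (rule derivative_lift) blast
  show ?thesis
  proof (rule completely_boundedI)
    have "(\<lambda>y. (0, y)) \<in> carrier E \<rightarrow> carrier dE"
      using mem_E_iff_jet by blast
    then show "linear_map E dE (\<lambda>y. (0, y))"
      unfolding linear_map_def by simp
    fix n y assume n: "n > 0" and y: "y \<in> mats E n"
    show "mnorm dE n (\<lambda>i j. (0, y i j)) \<le> C * mnorm E n y"
    proof (rule QE.mnorm_quotient_ge_scaled[OF n y C(1)])
      fix g assume g: "g \<in> mats \<F> n" "\<And>i j. \<lbrakk>i < n; j < n\<rbrakk> \<Longrightarrow> eval_at \<theta> (g i j) = y i j"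
      obtain h where h: "h \<in> mats \<F> n" "\<forall>i<n. \<forall>j<n. h i j th = 0 \<and> d\<theta> (h i j) = g i j th"
        "mnorm \<F> n h \<le> C * mnorm \<F> n g"
        using C(2)[OF n g(1)] by blast
      have "mnorm dE n (\<lambda>i j. (0, y i j)) \<le> mnorm \<F> n h"
        using h(2) g(2) by (intro QD.mnorm_quotient_le[OF n h(1)]) (simp add: eval_at_def)
      then show "mnorm dE n (\<lambda>i j. (0, y i j)) \<le> C * mnorm \<F> n g"
        using h(3) by linarith
    qed
  qed
qed

text \<open>A lift \<open>f\<close> of \<open>(0, y)\<close> yields a lift \<open>(d / u) f\<close> of \<open>y\<close>.\<close>

lemma incl_bounded_below: "bounded_below E dE (\<lambda>y. (0, y))"
proof -
  obtain C where C: "C \<ge> 0" "\<And>n f. \<lbrakk>n > 0; f \<in> mats \<F> n; \<And>i j. \<lbrakk>i < n; j < n\<rbrakk> \<Longrightarrow> f i j th = 0\<rbrakk> \<Longrightarrow>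
    \<exists>g\<in>mats \<F> n. (\<forall>i<n. \<forall>j<n. g i j th = d\<theta> (f i j)) \<and> mnorm \<F> n g \<le> C * mnorm \<F> n f"
    by (rule kernel_lift) blast
  show ?thesis
    unfolding bounded_below_def
  proof (intro exI[of _ C] allI impI ballI)
    fix n :: nat and y assume n: "n > 0" and y: "y \<in> mats E n"
    have y': "(\<lambda>k l. (0, y k l)) \<in> mats dE n"
      using y mem_E_iff_jet by (simp add: mats_def del: E_simps dE_simps)
    show "mnorm E n y \<le> C * mnorm dE n (\<lambda>k l. (0, y k l))"
    proof (rule QD.mnorm_quotient_ge_scaled[OF n y' C(1)])
      fix f assume f: "f \<in> mats \<F> n" "\<And>i j. \<lbrakk>i < n; j < n\<rbrakk> \<Longrightarrow> jet (f i j) = (0, y i j)"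
      have "f i j th = 0" if "i < n" "j < n" for i j
        using f(2)[OF that] by (simp add: eval_at_def)
      then obtain g where g: "g \<in> mats \<F> n" "\<forall>i<n. \<forall>j<n. g i j th = d\<theta> (f i j)"
        "mnorm \<F> n g \<le> C * mnorm \<F> n f"
        using C(2)[OF n f(1)] by blast
      have "mnorm E n y \<le> mnorm \<F> n g"
        using g(2) f(2) by (intro QE.mnorm_quotient_le[OF n g(1)]) (simp add: eval_at_def)
      then show "mnorm E n y \<le> C * mnorm \<F> n f"
        using g(3) by linarith
    qed
  qed
qed

lemma proj_completely_bounded: "completely_bounded dE E fst"
proof (rule completely_boundedI)
  show "linear_map dE E fst"
    by (auto simp: linear_map_def)
  fix n u assume n: "n > 0" and u: "u \<in> mats dE n"
  show "mnorm E n (\<lambda>i j. fst (u i j)) \<le> 1 * mnorm dE n u"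
  proof (rule QD.mnorm_quotient_ge_scaled[OF n u])
    fix f assume f: "f \<in> mats \<F> n" "\<And>i j. \<lbrakk>i < n; j < n\<rbrakk> \<Longrightarrow> jet (f i j) = u i j"
    show "mnorm E n (\<lambda>i j. fst (u i j)) \<le> 1 * mnorm \<F> n f"
      using f(2)[symmetric] QE.mnorm_quotient_le[OF n f(1), of "\<lambda>i j. fst (u i j)"] by simp
  qed simp
qed

text \<open>A lift of a matrix over \<open>E\<close> to \<open>\<F>\<close> has a jet, whose norm is at most that of the lift.\<close>

lemma proj_bounded_lifts: "bounded_lifts dE E fst"
proof -
  from QE.bounded_lifts_quotient[OF operator_space_E, unfolded bounded_lifts_def] obtain K where
    "\<forall>n>0. \<forall>z\<in>mats E n. \<exists>f\<in>mats \<F> n. (\<forall>i<n. \<forall>j<n. eval_at \<theta> (f i j) = z i j) \<and> mnorm \<F> n f \<le> K * mnorm E n z" ..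
  then have K: "\<exists>f\<in>mats \<F> n. (\<forall>i<n. \<forall>j<n. eval_at \<theta> (f i j) = z i j) \<and> mnorm \<F> n f \<le> K * mnorm E n z"
    if "n > 0" "z \<in> mats E n" for n z
    using that by simp
  show ?thesis
    unfolding bounded_lifts_def
  proof (intro exI[of _ K] allI impI ballI)
    fix n :: nat and z assume n: "n > 0" and z: "z \<in> mats E n"
    obtain f where f: "f \<in> mats \<F> n" "\<forall>i<n. \<forall>j<n. eval_at \<theta> (f i j) = z i j" "mnorm \<F> n f \<le> K * mnorm E n z"
      using K[OF n z] by blast
    have "mnorm dE n (\<lambda>i j. jet (f i j)) \<le> mnorm \<F> n f"
      by (rule QD.mnorm_quotient_le[OF n f(1)]) (rule refl)
    moreover have "(\<lambda>i j. jet (f i j)) \<in> mats dE n"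
      using f(1) by (simp add: mats_def)
    ultimately show "\<exists>x\<in>mats dE n. (\<forall>i<n. \<forall>j<n. fst (x i j) = z i j) \<and> mnorm dE n x \<le> K * mnorm E n z"
      using f(2,3) by (intro bexI[of _ "\<lambda>i j. jet (f i j)"]) auto
  qed
qed

lemma derived_exact: "(\<lambda>y. (0, y)) ` carrier E = a_kernel dE E fst"
proof -
  have "u \<in> a_kernel dE E fst \<longleftrightarrow> u \<in> carrier dE \<and> fst u = 0" for u
    by (simp add: a_kernel_def')
  moreover have "u \<in> carrier dE \<and> fst u = 0 \<longleftrightarrow> u \<in> (\<lambda>y. (0, y)) ` carrier E" for u
    using mem_E_iff_jet[of "snd u"] by (cases u) (simp add: image_iff del: E_simps dE_simps, metis)
  ultimately show ?thesis by blast
qed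

theorem derived_extension: "extension_sequence E dE E (\<lambda>y. (0, y)) fst"
  by (intro extension_sequenceI operator_space_E operator_space_dE incl_completely_bounded incl_bounded_below
      proj_completely_bounded proj_bounded_lifts derived_exact)

section \<open>The pushout\<close>

abbreviation FE :: "((complex \<Rightarrow> 'v) \<times> 'v) opspace" where "FE \<equiv> op_sum \<F> E"

abbreviation PO :: "((complex \<Rightarrow> 'v) \<times> 'v) set opspace" where "PO \<equiv> interp_pushout s X0 X1 \<theta>"

text \<open>\<open>R\<close> is the jet on \<open>\<F>\<close> and the inclusion \<open>x \<mapsto> (0, x)\<close> on \<open>E\<close>; it vanishes on the pairs
  \<open>(f, - f' \<theta>)\<close> because the jet of \<open>f\<close> is \<open>(0, f' \<theta>)\<close> when \<open>f \<theta> = 0\<close>.\<close>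

definition R :: "(complex \<Rightarrow> 'v) \<times> 'v \<Rightarrow> 'v \<times> 'v" where
  "R u = (fst u th, d\<theta> (fst u) + snd u)"

lemma operator_space_FE: "operator_space FE"
  by (rule operator_space_op_sum[OF operator_space_calderon operator_space_E])

sublocale OFE: opspace FE by unfold_locales (rule operator_space_FE)

lemma R_eq: "R u = jet (fst u) \<oplus>\<^bsub>dE\<^esub> (0, snd u)"
  by (simp add: R_def eval_at_def)

lemma R_completely_bounded: "completely_bounded FE dE R"
proof -
  note j = linear_mapD[OF completely_bounded_linear[OF QE.Y.cmodule_axioms QD.Y.cmodule_axioms incl_completely_bounded]]
  obtain C where C: "C \<ge> 0" "\<And>n y. \<lbrakk>n > 0; y \<in> mats E n\<rbrakk> \<Longrightarrow> mnorm dE n (\<lambda>i j. (0, y i j)) \<le> C * mnorm E n y"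
    by (rule completely_boundedE[OF incl_completely_bounded operator_space_E]) blast
  show ?thesis
  proof (rule completely_boundedI)
    have "R u \<in> carrier dE" if "u \<in> carrier FE" for u
      unfolding R_eq using that QD.Q(1)[of "fst u"] j(1)[of "snd u"]
      by (intro QD.Y.M.a_closed) (simp_all only: op_sum_simps mem_Times_iff)
    moreover have "R (\<lambda>z. 0, 0) = (0, 0)"
      by (simp add: R_def d\<theta>_zero)
    ultimately show "linear_map FE dE R"
      unfolding linear_map_def
      by (auto simp: R_def d\<theta>_add d\<theta>_smult X0.sub.scale_right_distrib)
    fix n u assume n: "n > 0" and u: "u \<in> mats FE n"
    have u1: "(\<lambda>i j. fst (u i j)) \<in> mats \<F> n" and u2: "(\<lambda>i j. snd (u i j)) \<in> mats E n"
      using u by (simp_all add: mats_def mem_Times_iff)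
    have m1: "(\<lambda>i j. jet (fst (u i j))) \<in> mats dE n"
      using u1 by (simp add: mats_def)
    have m2: "(\<lambda>i j. (0, snd (u i j))) \<in> mats dE n"
      using u2 mem_E_iff_jet by (simp add: mats_def del: E_simps dE_simps)
    have "mnorm dE n (\<lambda>i j. R (u i j)) \<le> mnorm dE n (\<lambda>i j. jet (fst (u i j))) + mnorm dE n (\<lambda>i j. (0, snd (u i j)))"
      unfolding R_eq by (rule OD.mnorm_triangle[OF n m1 m2])
    also have "mnorm dE n (\<lambda>i j. jet (fst (u i j))) \<le> mnorm \<F> n (\<lambda>i j. fst (u i j))"
      by (rule QD.mnorm_quotient_le[OF n u1]) (rule refl)
    also have "mnorm dE n (\<lambda>i j. (0, snd (u i j))) \<le> C * mnorm E n (\<lambda>i j. snd (u i j))"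
      by (rule C(2)[OF n u2])
    also have "mnorm \<F> n (\<lambda>i j. fst (u i j)) \<le> mnorm FE n u" by simp
    also have "C * mnorm E n (\<lambda>i j. snd (u i j)) \<le> C * mnorm FE n u"
      by (intro mult_left_mono C(1)) simp
    finally show "mnorm dE n (\<lambda>i j. R (u i j)) \<le> (1 + C) * mnorm FE n u"
      by (simp only: distrib_right mult_1)
  qed
qed

lemma linear_map_R: "linear_map FE dE R"
  by (rule completely_bounded_linear[OF OFE.cmodule_axioms QD.Y.cmodule_axioms R_completely_bounded])

text \<open>Already the summand \<open>\<F>\<close> is mapped onto \<open>dE\<close>, as a metric quotient.\<close>

lemma R_bounded_lifts: "bounded_lifts FE dE R"
proof -
  from QD.bounded_lifts_quotient[OF operator_space_dE, unfolded bounded_lifts_def] obtain K where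
    "\<forall>n>0. \<forall>z\<in>mats dE n. \<exists>f\<in>mats \<F> n. (\<forall>i<n. \<forall>j<n. jet (f i j) = z i j) \<and> mnorm \<F> n f \<le> K * mnorm dE n z" ..
  then have K: "\<exists>f\<in>mats \<F> n. (\<forall>i<n. \<forall>j<n. jet (f i j) = z i j) \<and> mnorm \<F> n f \<le> K * mnorm dE n z"
    if "n > 0" "z \<in> mats dE n" for n z
    using that by simp
  show ?thesis
    unfolding bounded_lifts_def
  proof (intro exI[of _ K] allI impI ballI)
    fix n :: nat and z assume n: "n > 0" and z: "z \<in> mats dE n"
    obtain f where f: "f \<in> mats \<F> n" "\<forall>i<n. \<forall>j<n. jet (f i j) = z i j" "mnorm \<F> n f \<le> K * mnorm dE n z"
      using K[OF n z] by blast
    have 0: "mnorm E n (\<lambda>i j. 0) = 0"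
      using OE.mnorm_zero[OF n] by simp
    have "mnorm FE n (\<lambda>i j. (f i j, 0)) = mnorm \<F> n f"
      using Fm.mnorm_nonneg[OF n f(1)] by (simp add: 0)
    moreover have "(\<lambda>i j. (f i j, 0)) \<in> mats FE n"
      using f(1) QE.Y.M.zero_closed by (simp add: mats_def del: E_simps(1))
    moreover have "R (f i j, 0) = z i j" if "i < n" "j < n" for i j
      using f(2) that by (simp add: R_def eval_at_def)
    ultimately show "\<exists>x\<in>mats FE n. (\<forall>i<n. \<forall>j<n. R (x i j) = z i j) \<and> mnorm FE n x \<le> K * mnorm dE n z"
      using f(3) by (intro bexI[of _ "\<lambda>i j. (f i j, 0)"]) simp_all
  qed
qed

text \<open>Without the closure the relation is the kernel of \<open>R\<close>, by solving \<open>f' \<theta> + x = 0\<close> for \<open>x\<close>; a kernel is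
  closed.\<close>

lemma interp_rel_eq: "interp_rel s X0 X1 \<theta> = a_kernel FE dE R"
proof -
  have ker: "carrier (ker_eval s X0 X1 \<theta>) = {f \<in> carrier \<F>. f th = 0}"
    by (simp add: ker_eval_def op_subspace_def a_kernel_def' ambient_def eval_at_def)
  have dE_in: "d\<theta> f \<in> carrier E" if "f \<in> carrier \<F>" "f th = 0" for f
  proof -
    have "(0, d\<theta> f) \<in> carrier dE"
      using QD.Q(1)[OF that(1)] that(2) by (simp only: eval_at_def)
    then show ?thesis unfolding mem_E_iff_jet .
  qed
  have neg: "\<ominus>\<^bsub>E\<^esub> y = - y" if "y \<in> carrier E" for y
    using QE.Y.smult_neg_1[OF that] by simp
  have neg_in: "- y \<in> carrier E" if "y \<in> carrier E" for y
    using QE.Y.M.a_inv_closed[OF that] neg[OF that] by simp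
  have "{(f, \<ominus>\<^bsub>E\<^esub> d\<theta> f) | f. f \<in> carrier (ker_eval s X0 X1 \<theta>)} = a_kernel FE dE R"
  proof (intro equalityI subsetI)
    fix u assume "u \<in> {(f, \<ominus>\<^bsub>E\<^esub> d\<theta> f) | f. f \<in> carrier (ker_eval s X0 X1 \<theta>)}"
    then obtain f where f: "f \<in> carrier \<F>" "f th = 0" and u: "u = (f, - d\<theta> f)"
      unfolding ker using neg dE_in by blast
    show "u \<in> a_kernel FE dE R"
      using f neg_in[OF dE_in[OF f]] by (simp add: u a_kernel_def' R_def)
  next
    fix u assume "u \<in> a_kernel FE dE R"
    then have u: "fst u \<in> carrier \<F>" "fst u th = 0" "d\<theta> (fst u) + snd u = 0"
      by (auto simp: a_kernel_def' R_def)
    have "snd u = - d\<theta> (fst u)"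
      using u(3) by (simp add: add_eq_0_iff)
    then have "u = (fst u, \<ominus>\<^bsub>E\<^esub> d\<theta> (fst u))"
      using neg[OF dE_in[OF u(1,2)]] by (simp add: prod_eq_iff)
    then show "u \<in> {(f, \<ominus>\<^bsub>E\<^esub> d\<theta> f) | f. f \<in> carrier (ker_eval s X0 X1 \<theta>)}"
      unfolding ker using u(1,2) by blast
  qed
  then show ?thesis
    unfolding interp_rel_def pushout_rel_def
    using closure_of_kernel[OF operator_space_FE operator_space_dE R_completely_bounded] by simp
qed

lemma PO_eq: "PO = op_quotient FE (a_kernel FE dE R)"
  using interp_rel_eq by (simp add: interp_pushout_def pushout_def interp_rel_def)

lemma operator_space_PO: "operator_space PO"
  unfolding PO_eq
  by (rule operator_space_quotient_kernel[OF operator_space_FE operator_space_dE R_completely_bounded])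

definition T :: "((complex \<Rightarrow> 'v) \<times> 'v) set \<Rightarrow> 'v \<times> 'v" where
  "T C = the_elem (R ` C)"

lemma submodule_kernel_R: "submodule (a_kernel FE dE R) complex_ring FE"
  by (rule submodule_kernel[OF OFE.cmodule_axioms QD.Y.cmodule_axioms linear_map_R])

sublocale QP: metric_quotient_map FE PO "\<lambda>u. a_kernel FE dE R +>\<^bsub>FE\<^esub> u"
  by unfold_locales (simp only: PO_eq metric_quotient_op_quotient[OF OFE.cmodule_axioms submodule_kernel_R])

lemma image_R_coset: "u \<in> carrier FE \<Longrightarrow> R ` (a_kernel FE dE R +>\<^bsub>FE\<^esub> u) = {R u}"
  by (rule image_kernel_coset[OF OFE.cmodule_axioms QD.Y.cmodule_axioms linear_map_R])

lemma T_coset: "u \<in> carrier FE \<Longrightarrow> T (a_kernel FE dE R +>\<^bsub>FE\<^esub> u) = R u"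
  by (simp only: T_def image_R_coset the_elem_eq)

theorem T_complete_iso: "complete_iso PO dE T"
proof (rule QP.factor_complete_iso[OF operator_space_dE R_completely_bounded R_bounded_lifts])
  fix u assume u: "u \<in> carrier FE"
  show "T (a_kernel FE dE R +>\<^bsub>FE\<^esub> u) = R u" by (rule T_coset[OF u])
  assume "R u = \<zero>\<^bsub>dE\<^esub>"
  then have "u \<in> a_kernel FE dE R" using u by (simp add: a_kernel_def')
  then show "a_kernel FE dE R +>\<^bsub>FE\<^esub> u = \<zero>\<^bsub>PO\<^esub>"
    using OFE.coset_eq_self_iff[OF submodule_kernel_R u] unfolding PO_eq op_quotient_def by simp
qed

lemma zero_pair_in_FE: "y \<in> carrier E \<Longrightarrow> (\<lambda>z. 0, y) \<in> carrier FE"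
  using calderon_zero by simp

lemma pushout_incl_eq: "pushout_incl s X0 X1 \<theta> y = a_kernel FE dE R +>\<^bsub>FE\<^esub> (\<lambda>z. 0, y)"
  by (simp only: pushout_incl_def interp_rel_eq)

lemma T_pushout_incl:
  assumes "y \<in> carrier E"
  shows "T (pushout_incl s X0 X1 \<theta> y) = (0, y)"
  unfolding pushout_incl_eq T_coset[OF zero_pair_in_FE[OF assms]] by (simp add: R_def d\<theta>_zero)

lemma pushout_proj_eq:
  assumes "C \<in> carrier PO"
  shows "pushout_proj \<theta> C = fst (T C)"
proof -
  obtain u where u: "u \<in> carrier FE" "C = a_kernel FE dE R +>\<^bsub>FE\<^esub> u"
    using assms QP.onto by blast
  have "(\<lambda>(f, x). eval_at \<theta> f) ` C = fst ` R ` C"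
    unfolding image_image by (intro image_cong) (auto simp: R_def eval_at_def)
  also have "\<dots> = {fst (R u)}"
    unfolding u(2) image_R_coset[OF u(1)] by simp
  finally show ?thesis
    unfolding pushout_proj_def u(2) T_coset[OF u(1)] by simp
qed

theorem pushout_extension: "extension_sequence E PO E (pushout_incl s X0 X1 \<theta>) (pushout_proj \<theta>)"
proof (rule extension_sequence_pullback[OF operator_space_E operator_space_PO operator_space_dE operator_space_E
      T_complete_iso incl_completely_bounded incl_bounded_below proj_completely_bounded proj_bounded_lifts derived_exact])
  fix y assume y: "y \<in> carrier E"
  show "pushout_incl s X0 X1 \<theta> y \<in> carrier PO"
    unfolding pushout_incl_eq by (rule QP.Q(1)[OF zero_pair_in_FE[OF y]])
  show "T (pushout_incl s X0 X1 \<theta> y) = (0, y)" by (rule T_pushout_incl[OF y])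
qed (rule pushout_proj_eq)

end

theorem proposition3p2:
  fixes s :: "complex \<Rightarrow> 'v \<Rightarrow> 'v::{topological_ab_group_add, t2_space}"
    and X0 X1 :: "'v opspace" and \<theta> :: real
  assumes "compatible_couple s X0 X1" and "0 < \<theta>" and "\<theta> < 1"
  shows "extension_sequence (interp s X0 X1 \<theta>) (interp_pushout s X0 X1 \<theta>) (interp s X0 X1 \<theta>)
           (pushout_incl s X0 X1 \<theta>) (pushout_proj \<theta>) \<and>
         extension_sequence (interp s X0 X1 \<theta>) (dinterp s X0 X1 \<theta>) (interp s X0 X1 \<theta>)
           (\<lambda>y. (0, y)) fst \<and>
         (\<exists>T. complete_iso (interp_pushout s X0 X1 \<theta>) (dinterp s X0 X1 \<theta>) T \<and>
              (\<forall>x\<in>carrier (interp s X0 X1 \<theta>). T (pushout_incl s X0 X1 \<theta> x) = (0, x)) \<and>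
              (\<forall>C\<in>carrier (interp_pushout s X0 X1 \<theta>). fst (T C) = pushout_proj \<theta> C))"
proof -
  interpret interpolation s X0 X1 \<theta>
    using assms by unfold_locales
  show ?thesis
    using pushout_extension derived_extension T_complete_iso T_pushout_incl pushout_proj_eq
    by (intro conjI exI[of _ T]) auto
qed

end
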